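(* Let $V$ be a finite set, $\omega_1,\omega_2$ valuated matroids on $2^V$, and $k$ a nonnegative integer. Let $r$ be the maximum of the ranks of $\omega_1$ and $\omega_2$, and let $\gamma$ be the time required for computing a function value (of $\omega_1$ or $\omega_2$). Then the problem $(\mathrm{V}_{\ge k})$: minimize $\omega_1(X_1)+\omega_2(X_2)$ over $X_1,X_2\subseteq V$ subject to $|X_1\cap X_2|\ge k$ can be solved in $O(|V|rk\gamma+|V|k\log|V|)$ time, and the problem $(\mathrm{V}_{=k})$: minimize $\omega_1(X_1)+\omega_2(X_2)$ over $X_1,X_2\subseteq V$ subject to $|X_1\cap X_2|=k$ can be solved in $O(|V|r^2\gamma+|V|r\log|V|)$ time.
   Context: A function $\omega\colon2^V\to\mathbf{R}\cup\{+\infty\}$, with $\operatorname{dom}\omega=\{X\mid\omega(X)<+\infty\}$, is a valuated matroid if for all $X,Y\in\operatorname{dom}\omega$ and $v\in X\setminus Y$ there exists $u\in Y\setminus X$ with $\omega(X)+\omega(Y)\ge\omega((X\setminus\{v\})\cup\{u\})+\omega((Y\cup\{v\})\setminus\{u\})$. All members of $\operatorname{dom}\omega$ have the same cardinality, called the rank of $\omega$. To solve a problem means to output an optimal solution of finite objective value, or to report that no feasible solution of finite objective value exists. Each $\omega_i$ is given by an evaluation oracle together with a member of $\operatorname{dom}\omega_i$; arithmetic operations take unit time. In the $O$-bounds each parameter factor (such as $k$, $r$, $\log|V|$) is understood as at least $1$. *)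

theory Defs
  imports Complex_Main "HOL-Library.Extended_Real"
begin

section \<open>Valuated matroids\<close>

text \<open>
  A function \<open>2\<^sup>V \<rightarrow> \<real> \<union> {+\<infinity>}\<close> is represented by a function on all sets of which only the
  values on subsets of \<open>V\<close> are ever used.
\<close>

definition vdom :: "'a set \<Rightarrow> ('a set \<Rightarrow> ereal) \<Rightarrow> 'a set set" where
  "vdom V \<omega> = {X. X \<subseteq> V \<and> \<omega> X < \<infinity>}"

definition valuated_matroid :: "'a set \<Rightarrow> ('a set \<Rightarrow> ereal) \<Rightarrow> bool" where
  "valuated_matroid V \<omega> \<longleftrightarrow>
     (\<forall>X\<subseteq>V. \<omega> X \<noteq> -\<infinity>) \<and>
     (\<forall>X\<in>vdom V \<omega>. \<forall>Y\<in>vdom V \<omega>. \<forall>v\<in>X - Y. \<exists>u\<in>Y - X.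
        \<omega> X + \<omega> Y \<ge> \<omega> ((X - {v}) \<union> {u}) + \<omega> ((Y \<union> {v}) - {u}))"

definition vrank :: "'a set \<Rightarrow> ('a set \<Rightarrow> ereal) \<Rightarrow> nat" where
  "vrank V \<omega> = (THE r. \<exists>X\<in>vdom V \<omega>. card X = r)"

lemma vdom_card_le:
  assumes "finite V" "valuated_matroid V \<omega>" "X \<in> vdom V \<omega>" "Y \<in> vdom V \<omega>"
  shows "card X \<le> card Y"
  using assms(3)
proof (induction "card (X - Y)" arbitrary: X rule: less_induct)
  case less
  have fin: "finite X" "finite Y"
    using assms(1,4) less.prems by (auto simp: vdom_def intro: finite_subset)
  show ?case
  proof (cases "X \<subseteq> Y")
    case True
    then show ?thesis using fin by (simp add: card_mono)
  next
    case False
    then obtain v where v: "v \<in> X - Y" by blast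
    then obtain u where u: "u \<in> Y - X"
      and ex: "\<omega> X + \<omega> Y \<ge> \<omega> ((X - {v}) \<union> {u}) + \<omega> ((Y \<union> {v}) - {u})"
      using assms(2,4) less.prems unfolding valuated_matroid_def by blast
    let ?X = "(X - {v}) \<union> {u}"
    let ?Y = "(Y \<union> {v}) - {u}"
    have sub: "?X \<subseteq> V" "?Y \<subseteq> V"
      using u v less.prems assms(4) by (auto simp: vdom_def)
    have "\<omega> ?Y \<noteq> -\<infinity>"
      using assms(2) sub unfolding valuated_matroid_def by blast
    moreover have "\<omega> X + \<omega> Y < \<infinity>"
      using less.prems assms(4) by (auto simp: vdom_def)
    ultimately have "\<omega> ?X < \<infinity>"
      using ex by (cases "\<omega> ?X"; cases "\<omega> ?Y") auto
    then have "?X \<in> vdom V \<omega>" using sub by (simp add: vdom_def)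
    moreover have "card (?X - Y) < card (X - Y)"
      using fin u v by (intro psubset_card_mono) auto
    ultimately have "card ?X \<le> card Y" by (rule less.hyps[rotated])
    moreover have "card ?X = card X"
      using fin u v card_Suc_Diff1[of X v] by simp
    ultimately show ?thesis by simp
  qed
qed

lemma vrank_eq_card:
  assumes "finite V" "valuated_matroid V \<omega>" "X \<in> vdom V \<omega>"
  shows "vrank V \<omega> = card X"
  unfolding vrank_def
proof (rule the_equality)
  show "\<exists>Y\<in>vdom V \<omega>. card Y = card X" using assms(3) by blast
next
  fix r assume "\<exists>Y\<in>vdom V \<omega>. card Y = r"
  then obtain Y where "Y \<in> vdom V \<omega>" "card Y = r" by blast
  then show "r = card X" using vdom_card_le[OF assms(1,2)] assms(3) by (metis le_antisym)
qed


section \<open>Problems\<close>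

definition feasible_ge :: "'a set \<Rightarrow> nat \<Rightarrow> ('a set \<times> 'a set) set" where
  "feasible_ge V k = {(X1, X2). X1 \<subseteq> V \<and> X2 \<subseteq> V \<and> card (X1 \<inter> X2) \<ge> k}"

definition feasible_eq :: "'a set \<Rightarrow> nat \<Rightarrow> ('a set \<times> 'a set) set" where
  "feasible_eq V k = {(X1, X2). X1 \<subseteq> V \<and> X2 \<subseteq> V \<and> card (X1 \<inter> X2) = k}"

definition objective ::
  "('a set \<Rightarrow> ereal) \<Rightarrow> ('a set \<Rightarrow> ereal) \<Rightarrow> 'a set \<times> 'a set \<Rightarrow> ereal" where
  "objective \<omega>1 \<omega>2 = (\<lambda>(X1, X2). \<omega>1 X1 + \<omega>2 X2)"

definition finite_optimal :: "'b set \<Rightarrow> ('b \<Rightarrow> ereal) \<Rightarrow> 'b \<Rightarrow> bool" where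
  "finite_optimal F f x \<longleftrightarrow> x \<in> F \<and> f x < \<infinity> \<and> (\<forall>y\<in>F. f x \<le> f y)"


section \<open>Machine model\<close>

text \<open>
  A unit-cost real random access machine with two evaluation oracles, presented as a structured
  language. Besides scalar variables there are one-dimensional arrays, unbounded in length and
  accessed with computed indices; a program mentions only finitely many of them. Integers and
  reals are kept apart: there is no rounding, and integers, which serve for counting and
  addressing, have no unit-cost multiplication or general division, so that no information can be
  packed into huge integers in few steps. Program constants are integers.
\<close>

type_synonym vname = string

record state =
  ivar :: "vname \<Rightarrow> nat"
  rvar :: "vname \<Rightarrow> real"
  iarr :: "vname \<Rightarrow> nat \<Rightarrow> nat"
  rarr :: "vname \<Rightarrow> nat \<Rightarrow> real"

datatype iexp =
    INum nat | IVar vname | IArr vname iexp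
  | IAdd iexp iexp | ISub iexp iexp | IHalf iexp

datatype rexp =
    RNum int | RVar vname | RArr vname iexp
  | RAdd rexp rexp | RSub rexp rexp | RMul rexp rexp | RDiv rexp rexp

datatype bexp =
    ILess iexp iexp | IEq iexp iexp | RLess rexp rexp | REq rexp rexp
  | BNot bexp | BAnd bexp bexp

datatype oracle_id = Omega1 | Omega2

datatype com =
    Skip
  | IAssign vname iexp
  | RAssign vname rexp
  | IStore vname iexp iexp
  | RStore vname iexp rexp
  | Query oracle_id vname vname vname
  | Seq com com
  | Cond bexp com com
  | While bexp com

text \<open>\<open>ISub\<close> is truncated subtraction, and division by zero yields zero.\<close>

fun ival :: "iexp \<Rightarrow> state \<Rightarrow> nat" where
  "ival (INum m) s = m"
| "ival (IVar x) s = ivar s x"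
| "ival (IArr a i) s = iarr s a (ival i s)"
| "ival (IAdd p q) s = ival p s + ival q s"
| "ival (ISub p q) s = ival p s - ival q s"
| "ival (IHalf p) s = ival p s div 2"

fun rval :: "rexp \<Rightarrow> state \<Rightarrow> real" where
  "rval (RNum m) s = of_int m"
| "rval (RVar x) s = rvar s x"
| "rval (RArr a i) s = rarr s a (ival i s)"
| "rval (RAdd p q) s = rval p s + rval q s"
| "rval (RSub p q) s = rval p s - rval q s"
| "rval (RMul p q) s = rval p s * rval q s"
| "rval (RDiv p q) s = rval p s / rval q s"

fun bval :: "bexp \<Rightarrow> state \<Rightarrow> bool" where
  "bval (ILess p q) s \<longleftrightarrow> ival p s < ival q s"
| "bval (IEq p q) s \<longleftrightarrow> ival p s = ival q s"
| "bval (RLess p q) s \<longleftrightarrow> rval p s < rval q s"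
| "bval (REq p q) s \<longleftrightarrow> rval p s = rval q s"
| "bval (BNot b) s \<longleftrightarrow> \<not> bval b s"
| "bval (BAnd b c) s \<longleftrightarrow> bval b s \<and> bval c s"

fun icost :: "iexp \<Rightarrow> nat" where
  "icost (INum m) = 1"
| "icost (IVar x) = 1"
| "icost (IArr a i) = 1 + icost i"
| "icost (IAdd p q) = 1 + icost p + icost q"
| "icost (ISub p q) = 1 + icost p + icost q"
| "icost (IHalf p) = 1 + icost p"

fun rcost :: "rexp \<Rightarrow> nat" where
  "rcost (RNum m) = 1"
| "rcost (RVar x) = 1"
| "rcost (RArr a i) = 1 + icost i"
| "rcost (RAdd p q) = 1 + rcost p + rcost q"
| "rcost (RSub p q) = 1 + rcost p + rcost q"
| "rcost (RMul p q) = 1 + rcost p + rcost q"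
| "rcost (RDiv p q) = 1 + rcost p + rcost q"

fun bcost :: "bexp \<Rightarrow> nat" where
  "bcost (ILess p q) = 1 + icost p + icost q"
| "bcost (IEq p q) = 1 + icost p + icost q"
| "bcost (RLess p q) = 1 + rcost p + rcost q"
| "bcost (REq p q) = 1 + rcost p + rcost q"
| "bcost (BNot b) = 1 + bcost b"
| "bcost (BAnd b c) = 1 + bcost b + bcost c"

definition array_set :: "nat \<Rightarrow> (nat \<Rightarrow> nat) \<Rightarrow> nat set" where
  "array_set n a = {i. i < n \<and> a i \<noteq> 0}"

text \<open>
  \<open>exec n \<Omega> \<gamma> c s t s'\<close>: started in \<open>s\<close>, the program \<open>c\<close> halts in \<open>s'\<close> after time \<open>t\<close>. The ground
  set is \<open>{0..<n}\<close>. The command \<open>Query w a x y\<close> evaluates the oracle \<open>w\<close> at the set whose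
  characteristic vector is in the integer array \<open>a\<close>; it sets \<open>x\<close> to 1 and \<open>y\<close> to the value if the
  value is finite, and \<open>x\<close> to 0 otherwise. It takes time \<open>\<gamma>\<close>, plus one unit for the call.
\<close>

inductive exec ::
  "nat \<Rightarrow> (oracle_id \<Rightarrow> nat set \<Rightarrow> ereal) \<Rightarrow> real \<Rightarrow> com \<Rightarrow> state \<Rightarrow> real \<Rightarrow> state \<Rightarrow> bool"
  for n :: nat and \<Omega> :: "oracle_id \<Rightarrow> nat set \<Rightarrow> ereal" and \<gamma> :: real
where
  Skip: "exec n \<Omega> \<gamma> Skip s 1 s"
| IAssign: "exec n \<Omega> \<gamma> (IAssign x p) s (1 + real (icost p))
     (s\<lparr>ivar := (ivar s)(x := ival p s)\<rparr>)"
| RAssign: "exec n \<Omega> \<gamma> (RAssign x p) s (1 + real (rcost p))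
     (s\<lparr>rvar := (rvar s)(x := rval p s)\<rparr>)"
| IStore: "exec n \<Omega> \<gamma> (IStore a i p) s (1 + real (icost i) + real (icost p))
     (s\<lparr>iarr := (iarr s)(a := (iarr s a)(ival i s := ival p s))\<rparr>)"
| RStore: "exec n \<Omega> \<gamma> (RStore a i p) s (1 + real (icost i) + real (rcost p))
     (s\<lparr>rarr := (rarr s)(a := (rarr s a)(ival i s := rval p s))\<rparr>)"
| QueryFin: "\<Omega> w (array_set n (iarr s a)) = ereal c \<Longrightarrow>
     exec n \<Omega> \<gamma> (Query w a x y) s (1 + \<gamma>)
       (s\<lparr>ivar := (ivar s)(x := 1), rvar := (rvar s)(y := c)\<rparr>)"
| QueryInf: "\<Omega> w (array_set n (iarr s a)) = \<infinity> \<Longrightarrow>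
     exec n \<Omega> \<gamma> (Query w a x y) s (1 + \<gamma>) (s\<lparr>ivar := (ivar s)(x := 0)\<rparr>)"
| Seq: "exec n \<Omega> \<gamma> c1 s t1 s1 \<Longrightarrow> exec n \<Omega> \<gamma> c2 s1 t2 s2 \<Longrightarrow>
     exec n \<Omega> \<gamma> (Seq c1 c2) s (t1 + t2) s2"
| CondTrue: "bval b s \<Longrightarrow> exec n \<Omega> \<gamma> c1 s t s1 \<Longrightarrow>
     exec n \<Omega> \<gamma> (Cond b c1 c2) s (1 + real (bcost b) + t) s1"
| CondFalse: "\<not> bval b s \<Longrightarrow> exec n \<Omega> \<gamma> c2 s t s1 \<Longrightarrow>
     exec n \<Omega> \<gamma> (Cond b c1 c2) s (1 + real (bcost b) + t) s1"
| WhileFalse: "\<not> bval b s \<Longrightarrow> exec n \<Omega> \<gamma> (While b c) s (1 + real (bcost b)) s"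
| WhileTrue: "bval b s \<Longrightarrow> exec n \<Omega> \<gamma> c s t1 s1 \<Longrightarrow> exec n \<Omega> \<gamma> (While b c) s1 t2 s2 \<Longrightarrow>
     exec n \<Omega> \<gamma> (While b c) s (1 + real (bcost b) + t1 + t2) s2"

inductive_cases SkipE: "exec n \<Omega> \<gamma> Skip s t s'"
inductive_cases IAssignE: "exec n \<Omega> \<gamma> (IAssign x p) s t s'"
inductive_cases RAssignE: "exec n \<Omega> \<gamma> (RAssign x p) s t s'"
inductive_cases IStoreE: "exec n \<Omega> \<gamma> (IStore a i p) s t s'"
inductive_cases RStoreE: "exec n \<Omega> \<gamma> (RStore a i p) s t s'"
inductive_cases QueryE: "exec n \<Omega> \<gamma> (Query w a x y) s t s'"
inductive_cases SeqE: "exec n \<Omega> \<gamma> (Seq c1 c2) s t s'"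
inductive_cases CondE: "exec n \<Omega> \<gamma> (Cond b c1 c2) s t s'"
inductive_cases WhileE: "exec n \<Omega> \<gamma> (While b c) s t s'"

lemma exec_deterministic:
  "exec n \<Omega> \<gamma> c s t s' \<Longrightarrow> exec n \<Omega> \<gamma> c s u s'' \<Longrightarrow> t = u \<and> s' = s''"
proof (induction arbitrary: u s'' rule: exec.induct)
  case (Seq c1 s t1 s1 c2 t2 s2)
  from Seq.prems show ?case by (rule SeqE) (auto dest!: Seq.IH)
next
  case (CondTrue b s c1 t s1 c2)
  from CondTrue.prems show ?case by (rule CondE) (use CondTrue.hyps in \<open>auto dest: CondTrue.IH\<close>)
next
  case (CondFalse b s c2 t s1 c1)
  from CondFalse.prems show ?case by (rule CondE) (use CondFalse.hyps in \<open>auto dest: CondFalse.IH\<close>)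
next
  case (WhileFalse b s c)
  from WhileFalse.prems show ?case by (rule WhileE) (use WhileFalse.hyps in auto)
next
  case (WhileTrue b s c t1 s1 t2 s2)
  from WhileTrue.prems show ?case
  proof (rule WhileE)
    fix u1 s3 u2
    assume u: "u = 1 + real (bcost b) + u1 + u2"
      and e: "exec n \<Omega> \<gamma> c s u1 s3" "exec n \<Omega> \<gamma> (While b c) s3 u2 s''"
    have "t1 = u1 \<and> s1 = s3" by (rule WhileTrue.IH(1)[OF e(1)])
    moreover from this have "t2 = u2 \<and> s2 = s''" using WhileTrue.IH(2) e(2) by blast
    ultimately show ?thesis using u by simp
  qed (use WhileTrue.hyps in auto)
qed (auto elim: SkipE IAssignE RAssignE IStoreE RStoreE QueryE)


section \<open>Solving a problem\<close>

text \<open>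
  The machine addresses the elements of the ground set by their position in an enumeration \<open>e\<close>. It
  receives \<open>|V|\<close>, \<open>k\<close> and the characteristic vectors of a member of each effective domain, all
  other memory being zero. It reports that there is no feasible solution of finite objective value
  by leaving 0 in \<open>found\<close>; otherwise its solution is in the arrays \<open>X1\<close> and \<open>X2\<close>.
\<close>

definition char_array :: "nat \<Rightarrow> (nat \<Rightarrow> 'a) \<Rightarrow> 'a set \<Rightarrow> nat \<Rightarrow> nat" where
  "char_array n e B = (\<lambda>i. if i < n \<and> e i \<in> B then 1 else 0)"

definition initial_state ::
  "nat \<Rightarrow> (nat \<Rightarrow> 'a) \<Rightarrow> nat \<Rightarrow> 'a set \<Rightarrow> 'a set \<Rightarrow> state" where
  "initial_state n e k B1 B2 =
     \<lparr>ivar = (\<lambda>_. 0)(''n'' := n, ''k'' := k),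
      rvar = (\<lambda>_. 0),
      iarr = (\<lambda>_ _. 0)(''B1'' := char_array n e B1, ''B2'' := char_array n e B2),
      rarr = (\<lambda>_ _. 0)\<rparr>"

definition oracles ::
  "(nat \<Rightarrow> 'a) \<Rightarrow> ('a set \<Rightarrow> ereal) \<Rightarrow> ('a set \<Rightarrow> ereal) \<Rightarrow> oracle_id \<Rightarrow> nat set \<Rightarrow> ereal" where
  "oracles e \<omega>1 \<omega>2 w I = (case w of Omega1 \<Rightarrow> \<omega>1 (e ` I) | Omega2 \<Rightarrow> \<omega>2 (e ` I))"

definition output_pair :: "nat \<Rightarrow> (nat \<Rightarrow> 'a) \<Rightarrow> state \<Rightarrow> 'a set \<times> 'a set" where
  "output_pair n e s = (e ` array_set n (iarr s ''X1''), e ` array_set n (iarr s ''X2''))"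

definition correct_output ::
  "nat \<Rightarrow> (nat \<Rightarrow> 'a) \<Rightarrow> ('a set \<times> 'a set) set \<Rightarrow> ('a set \<times> 'a set \<Rightarrow> ereal) \<Rightarrow> state \<Rightarrow> bool"
where
  "correct_output n e F f s \<longleftrightarrow>
     (if ivar s ''found'' = 0 then \<not> (\<exists>x\<in>F. f x < \<infinity>)
      else finite_optimal F f (output_pair n e s))"

definition solves_within ::
  "com \<Rightarrow> 'a set \<Rightarrow> ('a set \<Rightarrow> ereal) \<Rightarrow> ('a set \<Rightarrow> ereal) \<Rightarrow> nat \<Rightarrow> ('a set \<times> 'a set) set \<Rightarrow>
     real \<Rightarrow> real \<Rightarrow> bool"
where
  "solves_within P V \<omega>1 \<omega>2 k F \<gamma> T \<longleftrightarrow>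
     (\<forall>e B1 B2. bij_betw e {..<card V} V \<and> B1 \<in> vdom V \<omega>1 \<and> B2 \<in> vdom V \<omega>2 \<longrightarrow>
       (\<exists>t s. exec (card V) (oracles e \<omega>1 \<omega>2) \<gamma> P (initial_state (card V) e k B1 B2) t s \<and>
          t \<le> T \<and> correct_output (card V) e F (objective \<omega>1 \<omega>2) s))"

end

theory Submission
  imports Defs
begin

text \<open>
  Minimizers of both functions are found greedily. Starting from them, the intersection is enlarged
  one element at a time along shortest augmenting paths in the exchange graph. A single potential
  \<open>p\<close> with \<open>0 \<le> p \<le> lam\<close> certifies optimality: \<open>X\<close> minimizes \<open>f1 - p\<close>, \<open>T\<close> minimizes \<open>f2 + p\<close>, and \<open>p\<close>
  is 0 on the unmatched elements of \<open>X\<close> and \<open>lam\<close> on those of \<open>T\<close>. In Dijkstra's algorithm with labels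
  changed only on strict improvement, every parent is the earliest settled node with a tight arc to
  its child, so the exchanges on the path cannot be crossed and can be performed simultaneously.
  If no path exists, raising \<open>lam\<close> without bound shows infeasibility.

  One search takes \<open>O(n r \<gamma> + n log n)\<close> time. Only the at most \<open>r\<close> nodes of \<open>X\<close> have arcs of the first
  type, so only they can lower labels outside \<open>T\<close>: a tournament tree for these labels is rebuilt in
  time \<open>O(n)\<close> after such a node is settled, and any other settled node costs one deletion of
  \<open>O(log n)\<close>. The labels in \<open>T\<close> are searched linearly.

  For intersections of size exactly \<open>k\<close>, an upper bound on the intersection becomes a lower bound by
  complementing the second set. If the optimal pair for the lower bound exceeds it, then \<open>lam = 0\<close>
  and both sets are minimizers; since minimizers are connected by single exchanges, a walk back to
  the initial minimizers changes the size by at most one at a time and meets \<open>k\<close>.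
\<close>

section \<open>Valuated matroids\<close>

text \<open>Exchanges that are valid one at a time need not be valid together. The classical remedy
  is a path with fewest arcs among the shortest ones, hence a lexicographic search; here the order
  in which nodes are settled takes over that role, and the path is applied from the sink backwards,
  so that each exchange already performed lies nearer the sink than all remaining ones.

  The cost of a round is governed by the number of expanded nodes times the length of the list of
  \<open>T\<close>. Since \<open>T - snk = X - src\<close>, only nodes of \<open>X\<close> or
  outside \<open>T\<close> are expanded. Either \<open>T\<close> has at most \<open>r\<close>
  elements, or, in the complementary form, at most \<open>2 * r\<close> nodes are expanded; both
  ways the product is of order \<open>n * r\<close>.

  For the exact problem the form is chosen such that the initial minimizers do not exceed the lower
  bound \<open>K\<close> to be imposed. An optimal pair with more than \<open>K\<close> common
  elements and the initial pair then enclose \<open>K\<close>, which is why a walk between them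
  cannot miss it.\<close>

definition vm :: "'a set set \<Rightarrow> ('a set \<Rightarrow> real) \<Rightarrow> bool" where
  "vm D f \<longleftrightarrow> (\<forall>X\<in>D. \<forall>Y\<in>D. \<forall>v\<in>X - Y. \<exists>u\<in>Y - X.
     insert u (X - {v}) \<in> D \<and> insert v (Y - {u}) \<in> D \<and>
     f (insert u (X - {v})) + f (insert v (Y - {u})) \<le> f X + f Y)"

definition argmin :: "'a set set \<Rightarrow> ('a set \<Rightarrow> real) \<Rightarrow> 'a set set" where
  "argmin D f = {X\<in>D. \<forall>Y\<in>D. f X \<le> f Y}"

lemma vmE:
  assumes "vm D f" "X \<in> D" "Y \<in> D" "v \<in> X" "v \<notin> Y"
  obtains u where "u \<in> Y" "u \<notin> X" "insert u (X - {v}) \<in> D" "insert v (Y - {u}) \<in> D"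
    "f (insert u (X - {v})) + f (insert v (Y - {u})) \<le> f X + f Y"
  using assms unfolding vm_def by blast

lemma sum_exchange:
  fixes q :: "'a \<Rightarrow> real"
  assumes "finite X" "v \<in> X" "u \<notin> X"
  shows "sum q (insert u (X - {v})) = sum q X - q v + q u"
  using assms by (simp add: sum_diff1)

lemma vm_add_modular:
  assumes "vm D f" "\<forall>X\<in>D. finite X"
  shows "vm D (\<lambda>X. f X + sum q X)"
  unfolding vm_def
proof (intro ballI)
  fix X Y v assume XY: "X \<in> D" "Y \<in> D" "v \<in> X - Y"
  then obtain u where u: "u \<in> Y" "u \<notin> X" "insert u (X - {v}) \<in> D" "insert v (Y - {u}) \<in> D"
    "f (insert u (X - {v})) + f (insert v (Y - {u})) \<le> f X + f Y"
    using vmE[OF assms(1)] by (metis DiffE)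
  have "sum q (insert u (X - {v})) = sum q X - q v + q u"
       "sum q (insert v (Y - {u})) = sum q Y - q u + q v"
    using XY u assms(2) sum_exchange[of X v u q] sum_exchange[of Y u v q] by auto
  with u show "\<exists>u\<in>Y - X. insert u (X - {v}) \<in> D \<and> insert v (Y - {u}) \<in> D \<and>
     f (insert u (X - {v})) + sum q (insert u (X - {v})) + (f (insert v (Y - {u})) + sum q (insert v (Y - {u})))
       \<le> f X + sum q X + (f Y + sum q Y)"
    by (intro bexI[of _ u]) auto
qed

text \<open>The two sets produced by an exchange cost together at most twice the minimum, so each of
  them attains it. Minimizers thus satisfy the simultaneous basis exchange of a matroid.\<close>

lemma argmin_exchange:
  assumes "vm D f" "X \<in> argmin D f" "Y \<in> argmin D f" "v \<in> X" "v \<notin> Y"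
  obtains u where "u \<in> Y" "u \<notin> X" "insert u (X - {v}) \<in> argmin D f" "insert v (Y - {u}) \<in> argmin D f"
proof -
  have "X \<in> D" "Y \<in> D" using assms(2,3) by (auto simp: argmin_def)
  then obtain u where u: "u \<in> Y" "u \<notin> X" "insert u (X - {v}) \<in> D" "insert v (Y - {u}) \<in> D"
    "f (insert u (X - {v})) + f (insert v (Y - {u})) \<le> f X + f Y"
    using vmE[OF assms(1) _ _ assms(4,5)] by blast
  moreover have "f X \<le> f (insert u (X - {v}))" "f Y \<le> f (insert v (Y - {u}))"
    using u assms(2,3) by (auto simp: argmin_def)
  moreover have "\<forall>Z\<in>D. f X \<le> f Z" "\<forall>Z\<in>D. f Y \<le> f Z" using assms(2,3) by (auto simp: argmin_def)
  ultimately have "insert u (X - {v}) \<in> argmin D f" "insert v (Y - {u}) \<in> argmin D f"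
    unfolding argmin_def by force+
  with u that show thesis by blast
qed

text \<open>Induction on the distance from \<open>X\<close> to a competitor \<open>Y\<close>: an
  exchange replaces \<open>Y\<close> by a set closer to \<open>X\<close>, and since the exchanged
  neighbour of \<open>X\<close> is no better than \<open>X\<close>, the new set is no worse than
  \<open>Y\<close>. Checking single exchanges, that is arcs, therefore certifies a minimum.\<close>

lemma argmin_local:
  assumes "vm D f" "\<forall>X\<in>D. finite X" "X \<in> D"
    and loc: "\<And>u v. u \<in> X \<Longrightarrow> v \<notin> X \<Longrightarrow> insert v (X - {u}) \<in> D \<Longrightarrow> f X \<le> f (insert v (X - {u}))"
    and eqc: "\<forall>Y\<in>D. card Y = card X"
  shows "X \<in> argmin D f"
proof -
  have "f X \<le> f Y" if "Y \<in> D" for Y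
    using that
  proof (induction "card (X - Y)" arbitrary: Y rule: less_induct)
    case less
    show ?case
    proof (cases "X \<subseteq> Y")
      case True
      then have "X = Y" using less.prems assms(2) eqc by (simp add: card_subset_eq)
      then show ?thesis by simp
    next
      case False
      then obtain v where v: "v \<in> X" "v \<notin> Y" by blast
      obtain u where u: "u \<in> Y" "u \<notin> X" "insert u (X - {v}) \<in> D" "insert v (Y - {u}) \<in> D"
        "f (insert u (X - {v})) + f (insert v (Y - {u})) \<le> f X + f Y"
        using vmE[OF assms(1) assms(3) less.prems v] by blast
      have "card (X - insert v (Y - {u})) < card (X - Y)"
        using assms(2,3) u v by (intro psubset_card_mono) auto
      then have "f X \<le> f (insert v (Y - {u}))" using less.hyps u by blast
      moreover have "f X \<le> f (insert u (X - {v}))" using loc u v by blast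
      ultimately show ?thesis using u by linarith
    qed
  qed
  with assms(3) show ?thesis by (auto simp: argmin_def)
qed

text \<open>Complementation reverses the roles: for \<open>v\<close> in \<open>X - Y\<close> the
  exchange is applied to the pair \<open>U - Y\<close>, \<open>U - X\<close>, where \<open>v\<close>
  leaves the former.\<close>

lemma vm_compl:
  assumes "vm D f" "\<forall>X\<in>D. X \<subseteq> U"
  shows "vm {T. T \<subseteq> U \<and> U - T \<in> D} (\<lambda>T. f (U - T))"
  unfolding vm_def
proof (intro ballI)
  fix X Y v assume "X \<in> {T. T \<subseteq> U \<and> U - T \<in> D}" "Y \<in> {T. T \<subseteq> U \<and> U - T \<in> D}" "v \<in> X - Y"
  then have h: "X \<subseteq> U" "Y \<subseteq> U" "U - X \<in> D" "U - Y \<in> D" "v \<in> U - Y" "v \<notin> U - X" "v \<in> X" "v \<notin> Y" by auto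
  obtain u where u: "u \<in> U - X" "u \<notin> U - Y" "insert u ((U - Y) - {v}) \<in> D" "insert v ((U - X) - {u}) \<in> D"
    "f (insert u ((U - Y) - {v})) + f (insert v ((U - X) - {u})) \<le> f (U - Y) + f (U - X)"
    using vmE[OF assms(1) h(4,3,5,6)] by blast
  have e: "insert u ((U - Y) - {v}) = U - insert v (Y - {u})" "insert v ((U - X) - {u}) = U - insert u (X - {v})"
    using h u by auto
  show "\<exists>u\<in>Y - X. insert u (X - {v}) \<in> {T. T \<subseteq> U \<and> U - T \<in> D} \<and> insert v (Y - {u}) \<in> {T. T \<subseteq> U \<and> U - T \<in> D} \<and>
     f (U - insert u (X - {v})) + f (U - insert v (Y - {u})) \<le> f (U - X) + f (U - Y)"
    using u h unfolding e by (intro bexI[of _ u]) auto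
qed

text \<open>By this lemma, exchanges that cannot be crossed (\<open>nc\<close>) can be performed one by one.\<close>

lemma exchangeable_after_exchange:
  assumes "vm D f" and M: "M = argmin D f"
    and "B \<in> M" "a \<in> B" "b \<notin> B" "a' \<in> B" "b' \<notin> B" "a \<noteq> a'" "b \<noteq> b'"
    and sw: "insert b (B - {a}) \<in> M"
    and nc: "\<not> (insert b (B - {a'}) \<in> M \<and> insert b' (B - {a}) \<in> M)"
  shows "insert b' (insert b (B - {a}) - {a'}) \<in> M \<longleftrightarrow> insert b' (B - {a'}) \<in> M"
proof
  assume l: "insert b' (insert b (B - {a}) - {a'}) \<in> M"
  let ?B2 = "insert b' (insert b (B - {a}) - {a'})"
  have "a \<notin> ?B2" using assms by auto
  obtain w where w: "w \<in> ?B2" "w \<notin> B" "insert w (B - {a}) \<in> M" "insert a (?B2 - {w}) \<in> M"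
    using argmin_exchange[OF assms(1) \<open>B \<in> M\<close>[unfolded M] l[unfolded M] \<open>a \<in> B\<close> \<open>a \<notin> ?B2\<close>] M by blast
  have "insert a (?B2 - {b}) = insert b' (B - {a'})" "insert a (?B2 - {b'}) = insert b (B - {a'})"
    using assms(3-9) by auto
  \<comment> \<open>The choice \<open>w = b\<close> gives the claim; \<open>w = b'\<close> would
    give both crossed exchanges, which \<open>nc\<close> excludes. In the converse direction
    \<open>w = a'\<close> is the crossed case.\<close>
  moreover have "w = b \<or> w = b'" using w by blast
  ultimately show "insert b' (B - {a'}) \<in> M" using w(3,4) nc by metis
next
  assume r: "insert b' (B - {a'}) \<in> M"
  let ?X = "insert b' (B - {a'})" and ?Y = "insert b (B - {a})"
  have "a \<in> ?X" "a \<notin> ?Y" using assms by auto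
  obtain w where w: "w \<in> ?Y" "w \<notin> ?X" "insert w (?X - {a}) \<in> M" "insert a (?Y - {w}) \<in> M"
    using argmin_exchange[OF assms(1) r[unfolded M] sw[unfolded M] \<open>a \<in> ?X\<close> \<open>a \<notin> ?Y\<close>] M by blast
  have "insert a' (?X - {a}) = insert b' (B - {a})" "insert a (?Y - {a'}) = insert b (B - {a'})"
    "insert b (?X - {a}) = insert b' (?Y - {a'})"
    using assms(3-9) by auto
  moreover have "w = a' \<or> w = b" using w by blast
  ultimately show "insert b' (?Y - {a'}) \<in> M" using w(3,4) nc by metis
qed

text \<open>If \<open>u\<close> is missing from the minimizer \<open>Y\<close>, exchange it out of
  the improved set. The element \<open>w\<close> entering there was a competitor in the choice of
  \<open>u\<close> and gains nothing, so putting \<open>u\<close> into \<open>Y\<close> in place of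
  \<open>w\<close> loses nothing. As \<open>w\<close> is outside the improved set, the earlier
  choices \<open>A\<close> are kept.\<close>

lemma greedy_step:
  assumes "vm D f" "X \<in> D" "v \<in> X" "v \<notin> A" "A \<subseteq> X"
    and u: "u = v \<or> u \<notin> X" "insert u (X - {v}) \<in> D"
    and best: "\<And>w. w = v \<or> w \<notin> X \<Longrightarrow> insert w (X - {v}) \<in> D \<Longrightarrow> f (insert u (X - {v})) \<le> f (insert w (X - {v}))"
    and Y: "Y \<in> argmin D f" "A \<subseteq> Y"
  shows "\<exists>Z\<in>argmin D f. insert u A \<subseteq> Z"
proof (cases "u \<in> Y")
  case True
  with Y show ?thesis by blast
next
  case False
  let ?X = "insert u (X - {v})"
  have "Y \<in> D" using Y by (auto simp: argmin_def)
  obtain w where w: "w \<in> Y" "w \<notin> ?X" "insert w (?X - {u}) \<in> D" "insert u (Y - {w}) \<in> D"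
    "f (insert w (?X - {u})) + f (insert u (Y - {w})) \<le> f ?X + f Y"
    using vmE[OF assms(1) u(2) \<open>Y \<in> D\<close> _ False] by blast
  have e: "insert w (?X - {u}) = insert w (X - {v})" using u(1) by auto
  have "f ?X \<le> f (insert w (X - {v}))" using best[of w] w e by auto
  then have "f (insert u (Y - {w})) \<le> f Y" using w e by simp
  moreover have "\<forall>Z\<in>D. f Y \<le> f Z" using Y by (auto simp: argmin_def)
  ultimately have "insert u (Y - {w}) \<in> argmin D f" using w(4) unfolding argmin_def by force
  moreover have "A \<subseteq> insert u (Y - {w})" using Y w assms(4,5) by auto
  ultimately show ?thesis by blast
qed

text \<open>
  Optimality of \<open>(X, T)\<close> by Lagrangian duality: \<open>X - src = T - snk\<close> is the common part, and \<open>lam\<close>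
  is the multiplier of the lower bound on its size.
\<close>

definition cert ::
  "'a set \<Rightarrow> 'a set set \<Rightarrow> ('a set \<Rightarrow> real) \<Rightarrow> 'a set set \<Rightarrow> ('a set \<Rightarrow> real) \<Rightarrow>
   'a set \<Rightarrow> 'a set \<Rightarrow> 'a set \<Rightarrow> 'a set \<Rightarrow> ('a \<Rightarrow> real) \<Rightarrow> real \<Rightarrow> bool"
where
  "cert U D1 f1 D2 f2 X T src snk p lam \<longleftrightarrow>
     X \<in> argmin D1 (\<lambda>Z. f1 Z + sum (\<lambda>v. - p v) Z) \<and> T \<in> argmin D2 (\<lambda>Z. f2 Z + sum p Z) \<and>
     src \<subseteq> X \<and> snk \<subseteq> T \<and> X - src = T - snk \<and>
     (\<forall>v\<in>U. 0 \<le> p v \<and> p v \<le> lam) \<and> (\<forall>v\<in>src. p v = 0) \<and> (\<forall>v\<in>snk. p v = lam)"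

text \<open>Weak duality. For \<open>X\<close> and \<open>T\<close> the potential terms amount to
  \<open>sum p T - sum p X = card snk * lam\<close>; for \<open>Z1\<close> and \<open>Z2\<close>
  they amount to at most \<open>card (Z2 - Z1) * lam\<close>, as \<open>p\<close> lies between 0 and
  \<open>lam\<close>. All members of \<open>D2\<close> have the same size, so the two counts differ
  by \<open>card (Z1 \<inter> Z2) - card (X - src)\<close>.\<close>

lemma cert_bound:
  fixes lam :: real
  assumes c: "cert U D1 f1 D2 f2 X T src snk p lam"
    and "finite U" and sub: "\<forall>Z\<in>D1. Z \<subseteq> U" "\<forall>Z\<in>D2. Z \<subseteq> U" and card: "\<forall>Z\<in>D2. card Z = card T"
    and Z: "Z1 \<in> D1" "Z2 \<in> D2"
  shows "f1 X + f2 T + lam * (real (card (Z1 \<inter> Z2)) - real (card (X - src))) \<le> f1 Z1 + f2 Z2"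
proof -
  have XT: "X \<in> D1" "T \<in> D2" using c by (auto simp: cert_def argmin_def)
  then have fin: "finite X" "finite T" "finite Z1" "finite Z2"
    using Z sub \<open>finite U\<close> by (meson finite_subset)+
  have sk: "src \<subseteq> X" "snk \<subseteq> T" "X - src = T - snk" using c by (auto simp: cert_def)
  then have fs: "finite src" "finite snk" using fin finite_subset by blast+
  have a: "f1 X - sum p X \<le> f1 Z1 - sum p Z1" "f2 T + sum p T \<le> f2 Z2 + sum p Z2"
    using c Z by (auto simp: cert_def argmin_def sum_negf)
  have "sum p X = sum p (X - src) + sum p src" "sum p T = sum p (T - snk) + sum p snk"
    using sk fin by (simp_all add: sum.subset_diff)
  moreover have "sum p src = 0" "sum p snk = real (card snk) * lam"
    using c by (auto simp: cert_def)
  ultimately have b: "sum p T - sum p X = real (card snk) * lam" using sk by simp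
  have "sum p Z1 = sum p (Z1 - Z2) + sum p (Z1 \<inter> Z2)"
    using sum.Int_Diff[OF fin(3), of p Z2] by simp
  moreover have "sum p Z2 = sum p (Z2 - Z1) + sum p (Z1 \<inter> Z2)"
    using sum.Int_Diff[OF fin(4), of p Z1] by (simp add: Int_commute)
  moreover have "0 \<le> sum p (Z1 - Z2)"
    using c Z sub by (intro sum_nonneg) (auto simp: cert_def subset_iff)
  moreover have "sum p (Z2 - Z1) \<le> real (card (Z2 - Z1)) * lam"
    using c Z sub by (intro sum_bounded_above) (auto simp: cert_def subset_iff)
  ultimately have d: "sum p Z1 - sum p Z2 \<ge> - (real (card (Z2 - Z1)) * lam)" by linarith
  have "card (Z2 - Z1) + card (Z1 \<inter> Z2) = card T"
    using card Z(2) fin card_Diff_subset_Int[of Z2 Z1] card_mono[of Z2 "Z2 \<inter> Z1"] by (simp add: Int_commute)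
  moreover have "card snk + card (X - src) = card T"
    using sk fin fs card_Diff_subset[of snk T] card_mono[of T snk] by simp
  ultimately have "real (card snk) - real (card (Z2 - Z1)) = real (card (Z1 \<inter> Z2)) - real (card (X - src))"
    by linarith
  then have "real (card snk) * lam - real (card (Z2 - Z1)) * lam = lam * (real (card (Z1 \<inter> Z2)) - real (card (X - src)))"
    by (metis left_diff_distrib mult.commute)
  with a b d show ?thesis by linarith
qed

section \<open>Weakest preconditions with running time\<close>

fun mods :: "com \<Rightarrow> vname set" where
  "mods Skip = {}"
| "mods (IAssign x p) = {x}"
| "mods (RAssign x p) = {x}"
| "mods (IStore a i p) = {a}"
| "mods (RStore a i p) = {a}"
| "mods (Query w a x y) = {x, y}"
| "mods (Seq c1 c2) = mods c1 \<union> mods c2"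
| "mods (Cond b c1 c2) = mods c1 \<union> mods c2"
| "mods (While b c) = mods c"

text \<open>Names live in four separate stores, but the frame does not tell them apart: a name
  written in one store counts as changed in all of them, so a frame is a mere set of names.\<close>

definition agree :: "vname set \<Rightarrow> state \<Rightarrow> state \<Rightarrow> bool" where
  "agree W s s' \<longleftrightarrow> (\<forall>x. x \<notin> W \<longrightarrow>
     ivar s' x = ivar s x \<and> rvar s' x = rvar s x \<and> iarr s' x = iarr s x \<and> rarr s' x = rarr s x)"

lemma agreeD:
  assumes "agree W s s'" "x \<notin> W"
  shows "ivar s' x = ivar s x" "rvar s' x = rvar s x" "iarr s' x = iarr s x" "rarr s' x = rarr s x"
  using assms by (auto simp: agree_def)

lemma agree_refl [simp]: "agree W s s"
  by (simp add: agree_def)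

lemma agree_trans: "agree W s s' \<Longrightarrow> agree W s' s'' \<Longrightarrow> agree W s s''"
  by (simp add: agree_def)

lemma agree_mono: "agree W s s' \<Longrightarrow> W \<subseteq> W' \<Longrightarrow> agree W' s s'"
  by (auto simp: agree_def)

lemma exec_agree: "exec n \<Omega> \<gamma> c s t s' \<Longrightarrow> agree (mods c) s s'"
proof (induction rule: exec.induct)
  case (Seq c1 s t1 s1 c2 t2 s2)
  then show ?case by (auto simp: agree_def)
next
  case (WhileTrue b s c t1 s1 t2 s2)
  then show ?case by (auto simp: agree_def)
qed (auto simp: agree_def)

section \<open>Total correctness with running time, for oracles given by domains and real
  values\<close>

locale machine =
  fixes n :: nat and \<gamma> :: real
    and D :: "oracle_id \<Rightarrow> nat set set" and f :: "oracle_id \<Rightarrow> nat set \<Rightarrow> real"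
    and \<Omega> :: "oracle_id \<Rightarrow> nat set \<Rightarrow> ereal"
  assumes \<gamma>: "0 \<le> \<gamma>"
    and \<Omega>: "S \<subseteq> {..<n} \<Longrightarrow> \<Omega> w S = (if S \<in> D w then ereal (f w S) else \<infinity>)"
    and D_sub: "S \<in> D w \<Longrightarrow> S \<subseteq> {..<n}"
begin

text \<open>The cost of one oracle call. Being at least 1, a multiple of it absorbs any bounded
  amount of other work next to a query.\<close>

definition G :: real where "G = 1 + \<gamma>"

lemma G1: "1 \<le> G"
  using \<gamma> by (simp add: G_def)

text \<open>The existential asserts termination. As execution is deterministic, one known run
  decides \<open>wpt\<close> (see \<open>wpt_exec\<close>), so the rules for single commands are
  equivalences.\<close>

definition wpt :: "com \<Rightarrow> state \<Rightarrow> (real \<Rightarrow> state \<Rightarrow> bool) \<Rightarrow> bool" where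
  "wpt c s Q \<longleftrightarrow> (\<exists>t s'. exec n \<Omega> \<gamma> c s t s' \<and> Q t s')"

lemma wpt_mono: "wpt c s P \<Longrightarrow> (\<And>t s'. P t s' \<Longrightarrow> Q t s') \<Longrightarrow> wpt c s Q"
  by (auto simp: wpt_def)

lemma wpt_mono_agree:
  "wpt c s P \<Longrightarrow> (\<And>t s'. P t s' \<Longrightarrow> agree (mods c) s s' \<Longrightarrow> Q t s') \<Longrightarrow> wpt c s Q"
  unfolding wpt_def using exec_agree by blast

lemma wpt_exec: "exec n \<Omega> \<gamma> c s t s' \<Longrightarrow> wpt c s Q \<longleftrightarrow> Q t s'"
  unfolding wpt_def using exec_deterministic by blast

lemma wpt_Skip [simp]: "wpt Skip s Q \<longleftrightarrow> Q 1 s"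
  by (rule wpt_exec[OF exec.Skip])

lemma wpt_IAssign [simp]: "wpt (IAssign x p) s Q \<longleftrightarrow>
    Q (1 + real (icost p)) (s\<lparr>ivar := (ivar s)(x := ival p s)\<rparr>)"
  by (rule wpt_exec[OF exec.IAssign])

lemma wpt_RAssign [simp]: "wpt (RAssign x p) s Q \<longleftrightarrow>
    Q (1 + real (rcost p)) (s\<lparr>rvar := (rvar s)(x := rval p s)\<rparr>)"
  by (rule wpt_exec[OF exec.RAssign])

lemma wpt_IStore [simp]: "wpt (IStore a i p) s Q \<longleftrightarrow>
    Q (1 + real (icost i) + real (icost p)) (s\<lparr>iarr := (iarr s)(a := (iarr s a)(ival i s := ival p s))\<rparr>)"
  by (rule wpt_exec[OF exec.IStore])

lemma wpt_RStore [simp]: "wpt (RStore a i p) s Q \<longleftrightarrow>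
    Q (1 + real (icost i) + real (rcost p)) (s\<lparr>rarr := (rarr s)(a := (rarr s a)(ival i s := rval p s))\<rparr>)"
  by (rule wpt_exec[OF exec.RStore])

lemma wpt_Seq [simp]: "wpt (Seq c1 c2) s Q \<longleftrightarrow> wpt c1 s (\<lambda>t s'. wpt c2 s' (\<lambda>t' s''. Q (t + t') s''))"
  unfolding wpt_def by (blast intro: exec.Seq elim!: SeqE)

lemma wpt_Cond [simp]: "wpt (Cond b c1 c2) s Q \<longleftrightarrow>
    (if bval b s then wpt c1 s (\<lambda>t s'. Q (1 + real (bcost b) + t) s')
     else wpt c2 s (\<lambda>t s'. Q (1 + real (bcost b) + t) s'))"
  unfolding wpt_def by (auto intro: exec.CondTrue exec.CondFalse elim!: CondE)

lemma wpt_Query [simp]: "wpt (Query w a x y) s Q \<longleftrightarrow>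
    (if array_set n (iarr s a) \<in> D w
     then Q (1 + \<gamma>) (s\<lparr>ivar := (ivar s)(x := 1),
            rvar := (rvar s)(y := f w (array_set n (iarr s a)))\<rparr>)
     else Q (1 + \<gamma>) (s\<lparr>ivar := (ivar s)(x := 0)\<rparr>))"
proof -
  have "array_set n (iarr s a) \<subseteq> {..<n}" by (auto simp: array_set_def)
  note v = \<Omega>[OF this, of w]
  show ?thesis
  proof (cases "array_set n (iarr s a) \<in> D w")
    case True
    then have "\<Omega> w (array_set n (iarr s a)) = ereal (f w (array_set n (iarr s a)))" using v by simp
    then show ?thesis using True by (simp add: wpt_exec[OF exec.QueryFin])
  next
    case False
    then have "\<Omega> w (array_set n (iarr s a)) = \<infinity>" using v by simp
    then show ?thesis using False by (simp add: wpt_exec[OF exec.QueryInf])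
  qed
qed

text \<open>Amortization: the potential pays for each guard and body. An iteration takes time at
  least 1, so the potential drops by at least 1, and its integer part doubles as the termination
  measure.\<close>

lemma wpt_While_ex:
  assumes step: "\<And>s. Inv s \<Longrightarrow> bval b s \<Longrightarrow>
      wpt c s (\<lambda>t s'. Inv s' \<and> 1 + real (bcost b) + t + \<Phi> s' \<le> \<Phi> s)"
    and nonneg: "\<And>s. Inv s \<Longrightarrow> (0::real) \<le> \<Phi> s"
    and "Inv s"
  shows "\<exists>t s'. exec n \<Omega> \<gamma> (While b c) s t s' \<and> Inv s' \<and> \<not> bval b s' \<and>
           t \<le> \<Phi> s - \<Phi> s' + 1 + real (bcost b)"
  using \<open>Inv s\<close>
proof (induction "nat \<lfloor>\<Phi> s\<rfloor>" arbitrary: s rule: less_induct)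
  case less
  show ?case
  proof (cases "bval b s")
    case False
    then have "exec n \<Omega> \<gamma> (While b c) s (1 + real (bcost b)) s" by (rule exec.WhileFalse)
    then show ?thesis using False less.prems by (intro exI[of _ "1 + real (bcost b)"] exI[of _ s]) simp
  next
    case True
    from step[OF less.prems True] obtain t s' where
      e: "exec n \<Omega> \<gamma> c s t s'" "Inv s'" "1 + real (bcost b) + t + \<Phi> s' \<le> \<Phi> s"
      by (auto simp: wpt_def)
    have "0 \<le> t" using e(1) \<gamma> by (induction rule: exec.induct) auto
    then have "\<Phi> s' + 1 \<le> \<Phi> s" using e by linarith
    then have "nat \<lfloor>\<Phi> s'\<rfloor> < nat \<lfloor>\<Phi> s\<rfloor>" using nonneg[OF e(2)] by linarith
    then obtain t2 s2 where f: "exec n \<Omega> \<gamma> (While b c) s' t2 s2" "Inv s2" "\<not> bval b s2"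
      "t2 \<le> \<Phi> s' - \<Phi> s2 + 1 + real (bcost b)"
      using less.hyps e(2) by blast
    have "exec n \<Omega> \<gamma> (While b c) s (1 + real (bcost b) + t + t2) s2"
      using True e(1) f(1) by (rule exec.WhileTrue)
    then show ?thesis using e(3) f(2-4) by (intro exI conjI) (assumption+, linarith)
  qed
qed

lemma wpt_While:
  assumes "Inv s"
    and "\<And>s'. Inv s' \<Longrightarrow> agree (mods c) s s' \<Longrightarrow> bval b s' \<Longrightarrow>
      wpt c s' (\<lambda>t s''. Inv s'' \<and> 1 + real (bcost b) + t + \<Phi> s'' \<le> \<Phi> s')"
    and "\<And>s'. Inv s' \<Longrightarrow> (0::real) \<le> \<Phi> s'"
    and "\<And>t s'. Inv s' \<Longrightarrow> agree (mods c) s s' \<Longrightarrow> \<not> bval b s' \<Longrightarrow>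
      t \<le> \<Phi> s - \<Phi> s' + 1 + real (bcost b) \<Longrightarrow> Q t s'"
  shows "wpt (While b c) s Q"
proof -
  have st: "wpt c s' (\<lambda>t s''. (Inv s'' \<and> agree (mods c) s s'') \<and> 1 + real (bcost b) + t + \<Phi> s'' \<le> \<Phi> s')"
    if "Inv s' \<and> agree (mods c) s s'" "bval b s'" for s'
    using that assms(2)[of s'] by (auto elim!: wpt_mono_agree intro: agree_trans)
  have "Inv s \<and> agree (mods c) s s" using assms(1) by simp
  from wpt_While_ex[where Inv = "\<lambda>s'. Inv s' \<and> agree (mods c) s s'", OF st _ this] assms(3,4)
  show ?thesis unfolding wpt_def by blast
qed

end

section \<open>Counted loops\<close>

definition For :: "vname \<Rightarrow> vname \<Rightarrow> com \<Rightarrow> com" where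
  "For x m c = Seq (IAssign x (INum 0)) (While (ILess (IVar x) (IVar m))
     (Seq c (IAssign x (IAdd (IVar x) (INum 1)))))"

lemma mods_For [simp]: "mods (For x m c) = insert x (mods c)"
  by (auto simp: For_def)

context machine
begin

text \<open>An iteration adds 4 for the guard and 4 for the increment to the time of the body; the 6
  outside the sum are the initial assignment (2) and the failing guard (4).
  \<open>Inv (Suc i)\<close> is asked of the state with the counter already advanced, so
  \<open>Inv\<close> always describes the loop head.\<close>

lemma wpt_For:
  assumes "Inv 0 (s\<lparr>ivar := (ivar s)(x := 0)\<rparr>)" "x \<noteq> m" "x \<notin> mods c" "m \<notin> mods c"
    and step: "\<And>i s'. i < ivar s m \<Longrightarrow> Inv i s' \<Longrightarrow> ivar s' x = i \<Longrightarrow> agree (insert x (mods c)) s s' \<Longrightarrow>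
      wpt c s' (\<lambda>t s''. Inv (Suc i) (s''\<lparr>ivar := (ivar s'')(x := Suc i)\<rparr>) \<and> t \<le> T i)"
    and T: "\<And>i. 0 \<le> T i"
    and post: "\<And>t s'. Inv (ivar s m) s' \<Longrightarrow> agree (insert x (mods c)) s s' \<Longrightarrow>
      t \<le> 6 + (\<Sum>i<ivar s m. T i + 8) \<Longrightarrow> Q t s'"
  shows "wpt (For x m c) s Q"
proof -
  let ?N = "ivar s m" and ?s = "s\<lparr>ivar := (ivar s)(x := 0)\<rparr>"
  let ?I = "\<lambda>s'. ivar s' x \<le> ?N \<and> Inv (ivar s' x) s'"
  let ?\<Phi> = "\<lambda>s'. \<Sum>i=ivar s' x..<?N. T i + 8"
  have ag: "agree (insert x (mods c)) s s'" if "agree (mods (Seq c (IAssign x (IAdd (IVar x) (INum 1))))) ?s s'" for s'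
    using that by (auto simp: agree_def)
  have "wpt (While (ILess (IVar x) (IVar m)) (Seq c (IAssign x (IAdd (IVar x) (INum 1))))) ?s
     (\<lambda>t s'. Q (2 + t) s')"
  proof (rule wpt_While[where Inv = ?I and \<Phi> = ?\<Phi>])
    show "?I ?s" using assms(1) by simp
  next
    fix s' assume I: "?I s'" and a: "agree (mods (Seq c (IAssign x (IAdd (IVar x) (INum 1))))) ?s s'"
      and b: "bval (ILess (IVar x) (IVar m)) s'"
    have m: "ivar s' m = ?N" using agreeD(1)[OF ag[OF a]] assms(2,4) by auto
    have lt: "ivar s' x < ?N" using b m by simp
    have "wpt c s' (\<lambda>t s''. Inv (Suc (ivar s' x)) (s''\<lparr>ivar := (ivar s'')(x := Suc (ivar s' x))\<rparr>) \<and> t \<le> T (ivar s' x))"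
      using step[OF lt _ _ ag[OF a]] I by auto
    note body = this
    show "wpt (Seq c (IAssign x (IAdd (IVar x) (INum 1)))) s'
      (\<lambda>t s''. ?I s'' \<and> 1 + real (bcost (ILess (IVar x) (IVar m))) + t + ?\<Phi> s'' \<le> ?\<Phi> s')"
      unfolding wpt_Seq wpt_IAssign
    proof (rule wpt_mono_agree[OF body])
      fix t s'' assume h: "Inv (Suc (ivar s' x)) (s''\<lparr>ivar := (ivar s'')(x := Suc (ivar s' x))\<rparr>) \<and> t \<le> T (ivar s' x)"
        and "agree (mods c) s' s''"
      then have x: "ivar s'' x = ivar s' x" using assms(3) agreeD(1) by auto
      have "(\<Sum>i=ivar s' x..<?N. T i + 8) = T (ivar s' x) + 8 + (\<Sum>i=Suc (ivar s' x)..<?N. T i + 8)"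
        using lt by (rule sum.atLeast_Suc_lessThan)
      then show "?I (s''\<lparr>ivar := (ivar s'')(x := ival (IAdd (IVar x) (INum 1)) s'')\<rparr>) \<and>
          1 + real (bcost (ILess (IVar x) (IVar m))) + (t + (1 + real (icost (IAdd (IVar x) (INum 1))))) +
            ?\<Phi> (s''\<lparr>ivar := (ivar s'')(x := ival (IAdd (IVar x) (INum 1)) s'')\<rparr>) \<le> ?\<Phi> s'"
        using h x lt by simp
    qed
  next
    show "0 \<le> ?\<Phi> s'" for s' using T by (intro sum_nonneg) (simp add: add_nonneg_nonneg)
  next
    fix t s' assume I: "?I s'" and a: "agree (mods (Seq c (IAssign x (IAdd (IVar x) (INum 1))))) ?s s'"
      and b: "\<not> bval (ILess (IVar x) (IVar m)) s'"
      and t: "t \<le> ?\<Phi> ?s - ?\<Phi> s' + 1 + real (bcost (ILess (IVar x) (IVar m)))"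
    have m: "ivar s' m = ?N" using agreeD(1)[OF ag[OF a]] assms(2,4) by auto
    have "ivar s' x = ?N" using b m I by simp
    then show "Q (2 + t) s'" using post[OF _ ag[OF a]] I t by (simp add: atLeast0LessThan)
  qed
  then show ?thesis by (simp add: For_def)
qed

end

section \<open>Shortest paths in the exchange graph\<close>

locale exchange_graph =
  fixes n :: nat
    and D1 :: "nat set set" and f1 :: "nat set \<Rightarrow> real"
    and D2 :: "nat set set" and f2 :: "nat set \<Rightarrow> real"
    and X T src snk :: "nat set" and p :: "nat \<Rightarrow> real" and lam :: real
  assumes vm1: "vm D1 f1" and vm2: "vm D2 f2"
    and sub1: "Z \<in> D1 \<Longrightarrow> Z \<subseteq> {..<n}" and sub2: "Z \<in> D2 \<Longrightarrow> Z \<subseteq> {..<n}"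
    and card1: "Z \<in> D1 \<Longrightarrow> card Z = card X" and card2: "Z \<in> D2 \<Longrightarrow> card Z = card T"
    and cert: "cert {..<n} D1 f1 D2 f2 X T src snk p lam"
begin

lemma X: "X \<in> D1" "X \<subseteq> {..<n}" "finite X" and T: "T \<in> D2" "T \<subseteq> {..<n}" "finite T"
proof -
  show X: "X \<in> D1" and T: "T \<in> D2" using cert by (auto simp: cert_def argmin_def)
  show "X \<subseteq> {..<n}" "T \<subseteq> {..<n}" using X T sub1 sub2 by auto
  then show "finite X" "finite T" by (auto intro: finite_subset)
qed

lemma fin1: "\<forall>Z\<in>D1. finite Z" and fin2: "\<forall>Z\<in>D2. finite Z"
  using sub1 sub2 by (auto intro: finite_subset)

lemma src: "src \<subseteq> X" "src \<subseteq> {..<n}" and snk: "snk \<subseteq> T" "snk \<subseteq> {..<n}" and bal: "X - src = T - snk"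
  using cert X T by (auto simp: cert_def)

text \<open>Type 1 arcs are exchanges in \<open>X\<close>, type 2 arcs are exchanges in \<open>T\<close> with reversed direction.\<close>

definition arc :: "nat \<Rightarrow> nat \<Rightarrow> nat \<Rightarrow> bool" where
  "arc t u v \<longleftrightarrow>
     t = 1 \<and> u \<in> X \<and> v < n \<and> v \<notin> X \<and> insert v (X - {u}) \<in> D1 \<or>
     t = 2 \<and> v \<in> T \<and> u < n \<and> u \<notin> T \<and> insert u (T - {v}) \<in> D2"

text \<open>Exchange cost reduced by the potential, as in successive shortest paths: along a path
  the potential terms telescope, and optimality of \<open>X\<close> and \<open>T\<close> under
  \<open>p\<close> makes the length of every arc nonnegative.\<close>

definition red_cost :: "nat \<Rightarrow> nat \<Rightarrow> nat \<Rightarrow> real" where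
  "red_cost t u v = (if t = 1 then f1 (insert v (X - {u})) - f1 X else f2 (insert u (T - {v})) - f2 T) + p u - p v"

lemma arc_less: "arc t u v \<Longrightarrow> u < n" "arc t u v \<Longrightarrow> v < n"
  using X T by (auto simp: arc_def)

lemma red_cost_nonneg: "arc t u v \<Longrightarrow> 0 \<le> red_cost t u v"
proof -
  assume a: "arc t u v"
  have m: "X \<in> argmin D1 (\<lambda>Z. f1 Z + sum (\<lambda>v. - p v) Z)" "T \<in> argmin D2 (\<lambda>Z. f2 Z + sum p Z)"
    using cert by (auto simp: cert_def)
  from a consider "t = 1" "u \<in> X" "v \<notin> X" "insert v (X - {u}) \<in> D1"
    | "t = 2" "v \<in> T" "u \<notin> T" "insert u (T - {v}) \<in> D2" by (auto simp: arc_def)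
  then show ?thesis
  proof cases
    case 1
    have "f1 X + sum (\<lambda>v. - p v) X \<le> f1 (insert v (X - {u})) + sum (\<lambda>v. - p v) (insert v (X - {u}))"
      using m(1) 1 by (auto simp: argmin_def)
    then show ?thesis using sum_exchange[OF X(3) 1(2,3), of "\<lambda>v. - p v"] 1 by (simp add: red_cost_def)
  next
    case 2
    have "f2 T + sum p T \<le> f2 (insert u (T - {v})) + sum p (insert u (T - {v}))"
      using m(2) 2 by (auto simp: argmin_def)
    then show ?thesis using sum_exchange[OF T(3) 2(2,3), of p] 2 by (simp add: red_cost_def)
  qed
qed

text \<open>
  The state of the search: \<open>st v\<close> is 0, 1 or 2 if \<open>v\<close> is unreached, labelled or settled, \<open>lab\<close> is the
  tentative distance, \<open>pt v\<close> is the type of the arc from the parent \<open>par v\<close> (0 at a source), \<open>\<tau>\<close>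
  numbers the settled nodes, and \<open>R\<close> holds for the arcs scanned so far. Labels only change on a
  strict improvement, hence the strict inequality for nodes settled before the parent.
\<close>

definition search_inv ::
  "(nat \<Rightarrow> nat \<Rightarrow> nat \<Rightarrow> bool) \<Rightarrow> (nat \<Rightarrow> nat) \<Rightarrow> (nat \<Rightarrow> real) \<Rightarrow> (nat \<Rightarrow> nat) \<Rightarrow> (nat \<Rightarrow> nat) \<Rightarrow>
   (nat \<Rightarrow> nat) \<Rightarrow> nat \<Rightarrow> bool"
where
  "search_inv R st lab par pt \<tau> m \<longleftrightarrow>
     (\<forall>v\<in>src. st v \<noteq> 0 \<and> pt v = 0 \<and> lab v = 0) \<and>
     (\<forall>v<n. v \<notin> src \<and> st v \<noteq> 0 \<longrightarrow>
        par v < n \<and> st (par v) = 2 \<and> arc (pt v) (par v) v \<and> lab v = lab (par v) + red_cost (pt v) (par v) v \<and>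
        (\<forall>t u. u < n \<and> st u = 2 \<and> \<tau> u < \<tau> (par v) \<and> arc t u v \<longrightarrow> lab v < lab u + red_cost t u v) \<and>
        (st v = 2 \<longrightarrow> \<tau> (par v) < \<tau> v)) \<and>
     (\<forall>t u v. st u = 2 \<and> R t u v \<and> arc t u v \<longrightarrow> st v \<noteq> 0 \<and> lab v \<le> lab u + red_cost t u v) \<and>
     (\<forall>u<n. \<forall>v<n. st u = 2 \<and> st v = 1 \<longrightarrow> lab u \<le> lab v) \<and>
     (\<forall>v<n. st v \<noteq> 0 \<longrightarrow> 0 \<le> lab v) \<and>
     (\<forall>v<n. st v = 2 \<longrightarrow> \<tau> v < m) \<and>
     (\<forall>v<n. st v \<le> 2)"

lemma search_inv_relaxed:
  assumes "search_inv R st lab par pt \<tau> m"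
    "\<forall>t u v. st u = 2 \<and> R' t u v \<and> arc t u v \<longrightarrow> st v \<noteq> 0 \<and> lab v \<le> lab u + red_cost t u v"
  shows "search_inv R' st lab par pt \<tau> m"
  using assms unfolding search_inv_def by (elim conjE, intro conjI)

lemma search_invD:
  assumes "search_inv R st lab par pt \<tau> m"
  shows "\<forall>v\<in>src. st v \<noteq> 0 \<and> pt v = 0 \<and> lab v = 0"
    and "v < n \<Longrightarrow> v \<notin> src \<Longrightarrow> st v \<noteq> 0 \<Longrightarrow>
        par v < n \<and> st (par v) = 2 \<and> arc (pt v) (par v) v \<and> lab v = lab (par v) + red_cost (pt v) (par v) v \<and>
        (\<forall>t u. u < n \<and> st u = 2 \<and> \<tau> u < \<tau> (par v) \<and> arc t u v \<longrightarrow> lab v < lab u + red_cost t u v) \<and>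
        (st v = 2 \<longrightarrow> \<tau> (par v) < \<tau> v)"
    and "\<forall>t u v. st u = 2 \<and> R t u v \<and> arc t u v \<longrightarrow> st v \<noteq> 0 \<and> lab v \<le> lab u + red_cost t u v"
    and "\<forall>u<n. \<forall>v<n. st u = 2 \<and> st v = 1 \<longrightarrow> lab u \<le> lab v"
    and "\<forall>v<n. st v \<noteq> 0 \<longrightarrow> 0 \<le> lab v"
    and "\<forall>v<n. st v = 2 \<longrightarrow> \<tau> v < m"
    and "\<forall>v<n. st v \<le> 2"
proof -
  have 2: "\<forall>v<n. v \<notin> src \<and> st v \<noteq> 0 \<longrightarrow>
        par v < n \<and> st (par v) = 2 \<and> arc (pt v) (par v) v \<and> lab v = lab (par v) + red_cost (pt v) (par v) v \<and>
        (\<forall>t u. u < n \<and> st u = 2 \<and> \<tau> u < \<tau> (par v) \<and> arc t u v \<longrightarrow> lab v < lab u + red_cost t u v) \<and>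
        (st v = 2 \<longrightarrow> \<tau> (par v) < \<tau> v)"
    using assms unfolding search_inv_def by (elim conjE)
  show "v < n \<Longrightarrow> v \<notin> src \<Longrightarrow> st v \<noteq> 0 \<Longrightarrow>
        par v < n \<and> st (par v) = 2 \<and> arc (pt v) (par v) v \<and> lab v = lab (par v) + red_cost (pt v) (par v) v \<and>
        (\<forall>t u. u < n \<and> st u = 2 \<and> \<tau> u < \<tau> (par v) \<and> arc t u v \<longrightarrow> lab v < lab u + red_cost t u v) \<and>
        (st v = 2 \<longrightarrow> \<tau> (par v) < \<tau> v)"
    by (rule 2[rule_format]) simp_all
qed (insert assms[unfolded search_inv_def], (elim conjE, assumption)+)

lemma search_inv_arc:
  assumes "search_inv R st lab par pt \<tau> m" "st u = 2" "R t u v" "arc t u v"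
  shows "st v \<noteq> 0 \<and> lab v \<le> lab u + red_cost t u v"
  using search_invD(3)[OF assms(1)] assms(2-) by blast

lemma search_inv_mono:
  assumes "search_inv R st lab par pt \<tau> m" "\<And>t u v. R' t u v \<Longrightarrow> arc t u v \<Longrightarrow> R t u v"
  shows "search_inv R' st lab par pt \<tau> m"
proof (rule search_inv_relaxed[OF assms(1)], intro allI impI, elim conjE)
  fix t u v assume "st u = 2" "R' t u v" "arc t u v"
  then show "st v \<noteq> 0 \<and> lab v \<le> lab u + red_cost t u v"
    using search_inv_arc[OF assms(1) _ assms(2)] by simp
qed

lemma search_inv_init:
  assumes "\<And>v. v < n \<Longrightarrow> st v = (if v \<in> src then 1 else 0)"
    "\<And>v. v \<in> src \<Longrightarrow> pt v = 0 \<and> lab v = 0"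
  shows "search_inv R st lab par pt \<tau> 0"
  using assms src arc_less unfolding search_inv_def by (auto split: if_splits)

text \<open>Parents are settled, so \<open>v\<close> is not yet the parent of any labelled node, and
  its number \<open>m\<close> exceeds all earlier ones. The clauses about parents therefore survive,
  and only the arcs out of \<open>v\<close> are left to scan.\<close>

lemma search_inv_settle:
  assumes d: "search_inv R st lab par pt \<tau> m" and v: "v < n" "st v = 1"
    and min: "\<And>w. w < n \<Longrightarrow> st w = 1 \<Longrightarrow> lab v \<le> lab w" and R: "\<And>t u w. R t u w"
  shows "search_inv (\<lambda>t u w. u \<noteq> v) (st(v := 2)) lab par pt (\<tau>(v := m)) (Suc m)"
proof -
  have d1: "\<forall>v\<in>src. st v \<noteq> 0 \<and> pt v = 0 \<and> lab v = 0"
    and d2: "\<And>v. v<n \<Longrightarrow> v \<notin> src \<Longrightarrow> st v \<noteq> 0 \<Longrightarrow>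
        par v < n \<and> st (par v) = 2 \<and> arc (pt v) (par v) v \<and> lab v = lab (par v) + red_cost (pt v) (par v) v \<and>
        (\<forall>t u. u < n \<and> st u = 2 \<and> \<tau> u < \<tau> (par v) \<and> arc t u v \<longrightarrow> lab v < lab u + red_cost t u v) \<and>
        (st v = 2 \<longrightarrow> \<tau> (par v) < \<tau> v)"
    and d3: "\<forall>t u v. st u = 2 \<and> R t u v \<and> arc t u v \<longrightarrow> st v \<noteq> 0 \<and> lab v \<le> lab u + red_cost t u v"
    and d4: "\<forall>u<n. \<forall>v<n. st u = 2 \<and> st v = 1 \<longrightarrow> lab u \<le> lab v"
    and d5: "\<forall>v<n. st v \<noteq> 0 \<longrightarrow> 0 \<le> lab v"
    and d6: "\<forall>v<n. st v = 2 \<longrightarrow> \<tau> v < m"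
    and d7: "\<forall>v<n. st v \<le> 2"
    using search_invD[OF d] by (assumption | blast)+
  show ?thesis
    unfolding search_inv_def
  proof (intro conjI allI impI)
    show "\<forall>w\<in>src. (st(v := 2)) w \<noteq> 0 \<and> pt w = 0 \<and> lab w = 0" using d1 by auto
  next
    fix w assume w: "w < n" "w \<notin> src \<and> (st(v := 2)) w \<noteq> 0"
    then have "st w \<noteq> 0" using v by (auto split: if_splits)
    note e = d2[OF w(1) conjunct1[OF w(2)] this]
    then have pv: "par w \<noteq> v" using v by auto
    show "par w < n" "(st(v := 2)) (par w) = 2" "arc (pt w) (par w) w" "lab w = lab (par w) + red_cost (pt w) (par w) w"
      using e by auto
    show "(\<tau>(v := m)) (par w) < (\<tau>(v := m)) w" if "(st(v := 2)) w = 2"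
      using e pv d6 that by (auto split: if_splits)
    fix t u assume u: "u < n \<and> (st(v := 2)) u = 2 \<and> (\<tau>(v := m)) u < (\<tau>(v := m)) (par w) \<and> arc t u w"
    have "\<tau> (par w) < m" using e d6 by blast
    then have "u \<noteq> v" using u pv by auto
    then show "lab w < lab u + red_cost t u w" using e u pv by auto
  next
    fix t u w assume "(st(v := 2)) u = 2 \<and> u \<noteq> v \<and> arc t u w"
    then have "st w \<noteq> 0 \<and> lab w \<le> lab u + red_cost t u w" using d3 R by auto
    then show "(st(v := 2)) w \<noteq> 0" "lab w \<le> lab u + red_cost t u w" by auto
  next
    fix u w assume "u < n" "w < n" "(st(v := 2)) u = 2 \<and> (st(v := 2)) w = 1"
    then show "lab u \<le> lab w" using d4 min by (auto split: if_splits)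
  next
    fix w assume w: "w < n"
    show "0 \<le> lab w" if "(st(v := 2)) w \<noteq> 0" using d5 v w that by (auto split: if_splits)
    show "(\<tau>(v := m)) w < Suc m" if "(st(v := 2)) w = 2" using d6 w that by (auto split: if_splits simp: less_SucI)
    show "(st(v := 2)) w \<le> 2" using d7 w by auto
  qed
qed

lemma search_inv_no_arc:
  assumes "search_inv R st lab par pt \<tau> m" "\<not> arc t v w"
    "\<And>t' u' w'. R' t' u' w' \<Longrightarrow> R t' u' w' \<or> (t' = t \<and> u' = v \<and> w' = w)"
  shows "search_inv R' st lab par pt \<tau> m"
  using assms(1) by (rule search_inv_mono) (use assms(2,3) in blast)

text \<open>A settled head needs no comparison: its label is at most that of \<open>v\<close>, and
  reduced costs are nonnegative. This justifies that the program skips settled nodes.\<close>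

lemma search_inv_keep:
  assumes d: "search_inv R st lab par pt \<tau> m" and v: "v < n" "st v = 2" and w: "w < n"
    and lab: "\<And>u. u < n \<Longrightarrow> st u = 2 \<Longrightarrow> lab u \<le> lab v"
    and k: "st w = 2 \<or> st w \<noteq> 0 \<and> lab w \<le> lab v + red_cost t v w"
    and R': "\<And>t' u' w'. R' t' u' w' \<Longrightarrow> R t' u' w' \<or> (t' = t \<and> u' = v \<and> w' = w)"
  shows "search_inv R' st lab par pt \<tau> m"
proof (cases "arc t v w")
  case False
  with d show ?thesis using R' by (rule search_inv_no_arc)
next
  case True
  have "st w \<noteq> 0 \<and> lab w \<le> lab v + red_cost t v w" using k lab[OF w] red_cost_nonneg[OF True] by auto
  note new = this
  show ?thesis
  proof (rule search_inv_relaxed[OF d], intro allI impI, elim conjE)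
    fix t' u' w' assume "st u' = 2" "R' t' u' w'" "arc t' u' w'"
    then show "st w' \<noteq> 0 \<and> lab w' \<le> lab u' + red_cost t' u' w'"
      using search_inv_arc[OF d] R' new by metis
  qed
qed

text \<open>The strict clause for the new parent \<open>v\<close> holds because every node settled
  earlier has been scanned: an arc from it to \<open>w\<close> has already bounded
  \<open>lab w\<close> by the length of its route, and the new label lies strictly below
  \<open>lab w\<close>. If \<open>w\<close> is unreached, no such arc exists.\<close>

lemma search_inv_update:
  assumes d: "search_inv R st lab par pt \<tau> m" and v: "v < n" "st v = 2" and w: "w < n" "st w \<noteq> 2"
    and a: "arc t v w"
    and lab: "\<And>u. u < n \<Longrightarrow> st u = 2 \<Longrightarrow> lab u \<le> lab v"
    and k: "st w = 0 \<or> lab v + red_cost t v w < lab w"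
    and R: "\<And>t' u' w'. u' \<noteq> v \<Longrightarrow> R t' u' w'"
    and R': "\<And>t' u' w'. R' t' u' w' \<Longrightarrow> R t' u' w' \<or> (t' = t \<and> u' = v \<and> w' = w)"
  shows "search_inv R' (st(w := 1)) (lab(w := lab v + red_cost t v w)) (par(w := v)) (pt(w := t)) \<tau> m"
proof -
  have d1: "\<forall>v\<in>src. st v \<noteq> 0 \<and> pt v = 0 \<and> lab v = 0"
    and d2: "\<And>v. v<n \<Longrightarrow> v \<notin> src \<Longrightarrow> st v \<noteq> 0 \<Longrightarrow>
        par v < n \<and> st (par v) = 2 \<and> arc (pt v) (par v) v \<and> lab v = lab (par v) + red_cost (pt v) (par v) v \<and>
        (\<forall>t u. u < n \<and> st u = 2 \<and> \<tau> u < \<tau> (par v) \<and> arc t u v \<longrightarrow> lab v < lab u + red_cost t u v) \<and>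
        (st v = 2 \<longrightarrow> \<tau> (par v) < \<tau> v)"
    and d3: "\<And>t u v. st u = 2 \<Longrightarrow> R t u v \<Longrightarrow> arc t u v \<Longrightarrow> st v \<noteq> 0 \<and> lab v \<le> lab u + red_cost t u v"
    and d4: "\<forall>u<n. \<forall>v<n. st u = 2 \<and> st v = 1 \<longrightarrow> lab u \<le> lab v"
    and d5: "\<forall>v<n. st v \<noteq> 0 \<longrightarrow> 0 \<le> lab v"
    and d6: "\<forall>v<n. st v = 2 \<longrightarrow> \<tau> v < m"
    and d7: "\<forall>v<n. st v \<le> 2"
    using search_invD[OF d] by (assumption | blast)+
  have c: "0 \<le> red_cost t v w" using a by (rule red_cost_nonneg)
  have lv: "0 \<le> lab v" using d5 v by simp
  have wv: "w \<noteq> v" using v w by auto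
  \<comment> \<open>A source is labelled 0 from the start, and no nonnegative length improves on
    that.\<close>
  have ws: "w \<notin> src" using d1 k c lv by force
  show ?thesis
    unfolding search_inv_def
  proof (intro conjI allI impI)
    show "\<forall>x\<in>src. (st(w := 1)) x \<noteq> 0 \<and> (pt(w := t)) x = 0 \<and> (lab(w := lab v + red_cost t v w)) x = 0" using d1 ws by auto
  next
    fix x assume x: "x < n" "x \<notin> src \<and> (st(w := 1)) x \<noteq> 0"
    have new: "lab v + red_cost t v w < lab u + red_cost t' u w" if "u < n" "st u = 2" "\<tau> u < \<tau> v" "arc t' u w" for t' u
    proof -
      have "u \<noteq> v" using that by auto
      then have "st w \<noteq> 0 \<and> lab w \<le> lab u + red_cost t' u w" using d3[OF that(2) R that(4)] by simp
      with k show ?thesis by auto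
    qed
    have old: "x \<noteq> w \<Longrightarrow> par x \<noteq> w \<and> st x \<noteq> 0" using d2[OF x(1)] x(2) w by auto
    show "(par(w := v)) x < n" "(st(w := 1)) ((par(w := v)) x) = 2" "arc ((pt(w := t)) x) ((par(w := v)) x) x"
      using d2[OF x(1)] x(2) v a wv old by auto
    show "(lab(w := lab v + red_cost t v w)) x = (lab(w := lab v + red_cost t v w)) ((par(w := v)) x) + red_cost ((pt(w := t)) x) ((par(w := v)) x) x"
      using d2[OF x(1)] x(2) wv old by auto
    show "\<tau> ((par(w := v)) x) < \<tau> x" if "(st(w := 1)) x = 2"
      using d2[OF x(1)] x(2) that by (auto split: if_splits)
    fix t' u assume u: "u < n \<and> (st(w := 1)) u = 2 \<and> \<tau> u < \<tau> ((par(w := v)) x) \<and> arc t' u x"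
    then have "u \<noteq> w" "st u = 2" by (auto split: if_splits)
    then show "(lab(w := lab v + red_cost t v w)) x < (lab(w := lab v + red_cost t v w)) u + red_cost t' u x"
      using new[of u t'] u d2[OF x(1)] x(2) old by (auto split: if_splits)
  next
    fix t' u x assume u: "(st(w := 1)) u = 2 \<and> R' t' u x \<and> arc t' u x"
    then have uw: "u \<noteq> w" "st u = 2" by (auto split: if_splits)
    have r: "R t' u x \<or> (t' = t \<and> u = v \<and> x = w)" using R' u by blast
    have r3: "R t' u x \<Longrightarrow> st x \<noteq> 0 \<and> lab x \<le> lab u + red_cost t' u x" using d3 uw u by blast
    show "(st(w := 1)) x \<noteq> 0" using r r3 by auto
    show "(lab(w := lab v + red_cost t v w)) x \<le> (lab(w := lab v + red_cost t v w)) u + red_cost t' u x"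
      using r r3 uw k by auto
  next
    fix u x assume "u < n" "x < n" "(st(w := 1)) u = 2 \<and> (st(w := 1)) x = 1"
    then show "(lab(w := lab v + red_cost t v w)) u \<le> (lab(w := lab v + red_cost t v w)) x"
      using d4 lab[of u] c by (auto split: if_splits)
  next
    fix x assume x: "x < n"
    show "0 \<le> (lab(w := lab v + red_cost t v w)) x" if "(st(w := 1)) x \<noteq> 0" using d5 x that c lv by (auto split: if_splits)
    show "\<tau> x < m" if "(st(w := 1)) x = 2" using d6 x that by (auto split: if_splits)
    show "(st(w := 1)) x \<le> 2" using d7 x by auto
  qed
qed

text \<open>The potential grows by the distance truncated at \<open>\<Delta>\<close>. Truncated
  distances still satisfy the triangle inequality along every arc, so no single exchange improves,
  and local optimality is global. Sources stay at 0, while sinks, none of which is settled, rise by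
  the full \<open>\<Delta>\<close>, the increase of the multiplier.\<close>

lemma search_inv_cert:
  assumes d: "search_inv R st lab par pt \<tau> m" and R: "\<And>t u w. R t u w"
    and set: "\<And>v. v < n \<Longrightarrow> st v = 2 \<Longrightarrow> lab v \<le> \<Delta>" and uns: "\<And>v. v < n \<Longrightarrow> st v = 1 \<Longrightarrow> \<Delta> \<le> lab v"
    and "0 \<le> \<Delta>" and snk': "\<And>v. v \<in> snk \<Longrightarrow> st v \<noteq> 2"
    and p': "\<And>v. v < n \<Longrightarrow> p' v = p v + (if st v = 2 then lab v else \<Delta>)"
  shows "cert {..<n} D1 f1 D2 f2 X T src snk p' (lam + \<Delta>)"
proof -
  have d1: "\<forall>v\<in>src. st v \<noteq> 0 \<and> pt v = 0 \<and> lab v = 0"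
    and d3: "\<And>t u v. st u = 2 \<Longrightarrow> R t u v \<Longrightarrow> arc t u v \<Longrightarrow> st v \<noteq> 0 \<and> lab v \<le> lab u + red_cost t u v"
    and d5: "\<forall>v<n. st v \<noteq> 0 \<longrightarrow> 0 \<le> lab v"
    and d7: "\<forall>v<n. st v \<le> 2"
    using search_invD[OF d] by (assumption | blast)+
  let ?\<delta> = "\<lambda>v. if st v = 2 then lab v else \<Delta>"
  have feas: "?\<delta> v \<le> ?\<delta> u + red_cost t u v" if a: "arc t u v" for t u v
  proof (cases "st u = 2")
    case True
    then have "st v \<noteq> 0 \<and> lab v \<le> lab u + red_cost t u v" using d3 R a by blast
    moreover have "st v \<noteq> 0 \<Longrightarrow> st v \<noteq> 2 \<Longrightarrow> st v = 1" using d7 arc_less(2)[OF a] by (auto simp: le_less)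
    ultimately show ?thesis using True uns[OF arc_less(2)[OF a]] by auto
  next
    case False
    then show ?thesis using set[OF arc_less(2)[OF a]] red_cost_nonneg[OF a] by auto
  qed
  have m1: "X \<in> argmin D1 (\<lambda>Z. f1 Z + sum (\<lambda>v. - p' v) Z)"
  proof (rule argmin_local[OF vm_add_modular[OF vm1 fin1] fin1 X(1)])
    fix u v assume u: "u \<in> X" "v \<notin> X" "insert v (X - {u}) \<in> D1"
    have "v < n" using sub1[OF u(3)] by auto
    then have "arc 1 u v" using u by (simp add: arc_def)
    from feas[OF this] have "f1 (insert v (X - {u})) - f1 X + p' u - p' v \<ge> 0"
      using p' \<open>v < n\<close> u(1) X(2) by (auto simp: red_cost_def)
    then show "f1 X + (\<Sum>v\<in>X. - p' v) \<le> f1 (insert v (X - {u})) + (\<Sum>v\<in>insert v (X - {u}). - p' v)"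
      using sum_exchange[OF X(3) u(1,2), of "\<lambda>v. - p' v"] by simp
  qed (use card1 in auto)
  have m2: "T \<in> argmin D2 (\<lambda>Z. f2 Z + sum p' Z)"
  proof (rule argmin_local[OF vm_add_modular[OF vm2 fin2] fin2 T(1)])
    fix v u assume u: "v \<in> T" "u \<notin> T" "insert u (T - {v}) \<in> D2"
    have "u < n" using sub2[OF u(3)] by auto
    then have "arc 2 u v" using u by (simp add: arc_def)
    from feas[OF this] have "f2 (insert u (T - {v})) - f2 T + p' u - p' v \<ge> 0"
      using p' \<open>u < n\<close> u(1) T(2) by (auto simp: red_cost_def)
    then show "f2 T + sum p' T \<le> f2 (insert u (T - {v})) + sum p' (insert u (T - {v}))"
      using sum_exchange[OF T(3) u(1,2), of p'] by simp
  qed (use card2 in auto)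
  have old: "(\<forall>v\<in>{..<n}. 0 \<le> p v \<and> p v \<le> lam) \<and> (\<forall>v\<in>src. p v = 0) \<and> (\<forall>v\<in>snk. p v = lam)"
    using cert by (simp add: cert_def)
  have "\<forall>v\<in>{..<n}. 0 \<le> p' v \<and> p' v \<le> lam + \<Delta>"
    using old p' set d5 \<open>0 \<le> \<Delta>\<close> by (auto intro!: add_nonneg_nonneg add_mono)
  moreover have "\<forall>v\<in>src. p' v = 0"
  proof
    fix v assume v: "v \<in> src"
    then have "v < n" "st v \<noteq> 0" "lab v = 0" using d1 src by auto
    then have "st v \<noteq> 2 \<Longrightarrow> \<Delta> \<le> 0" using uns[of v] d7 by (force simp: le_less)
    then show "p' v = 0" using p'[OF \<open>v < n\<close>] old v \<open>lab v = 0\<close> \<open>0 \<le> \<Delta>\<close> by auto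
  qed
  moreover have "\<forall>v\<in>snk. p' v = lam + \<Delta>"
    using p' old snk' snk by auto
  ultimately show ?thesis using m1 m2 src snk bal unfolding cert_def by blast
qed

lemma search_inv_infeasible:
  assumes d: "search_inv R st lab par pt \<tau> m" and R: "\<And>t u w. R t u w"
    and no: "\<And>v. v < n \<Longrightarrow> st v \<noteq> 1" and snk': "\<And>v. v \<in> snk \<Longrightarrow> st v \<noteq> 2"
    and Z: "Z1 \<in> D1" "Z2 \<in> D2"
  shows "card (Z1 \<inter> Z2) \<le> card (X - src)"
proof (rule ccontr)
  assume "\<not> ?thesis"
  then have gt: "1 \<le> real (card (Z1 \<inter> Z2)) - real (card (X - src))" by simp
  have lam: "f1 X + f2 T + (lam + \<Delta>) * (real (card (Z1 \<inter> Z2)) - real (card (X - src))) \<le> f1 Z1 + f2 Z2"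
    if "0 \<le> \<Delta>" "\<And>v. v < n \<Longrightarrow> lab v \<le> \<Delta>" for \<Delta>
    using search_inv_cert[OF d R _ _ that(1) snk', of "\<lambda>v. p v + (if st v = 2 then lab v else \<Delta>)"] that no
    by (intro cert_bound[where U = "{..<n}"]) (use sub1 sub2 card2 Z in auto)
  \<comment> \<open>The sum dominates all labels, \<open>\<bar>lam\<bar>\<close> keeps
    \<open>lam + \<Delta>\<close> nonnegative, and the last two terms lift
    \<open>lam + \<Delta>\<close> above the difference in cost that \<open>cert_bound\<close> would
    have to respect.\<close>
  define \<Delta> where "\<Delta> = (\<Sum>v<n. \<bar>lab v\<bar>) + \<bar>lam\<bar> + \<bar>f1 Z1 + f2 Z2 - f1 X - f2 T\<bar> + 1"
  have "lab v \<le> (\<Sum>v<n. \<bar>lab v\<bar>)" if "v < n" for v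
    using member_le_sum[of v "{..<n}" "\<lambda>v. \<bar>lab v\<bar>"] that by auto
  then have "lab v \<le> \<Delta>" if "v < n" for v using that by (force simp: \<Delta>_def)
  moreover have "0 \<le> (\<Sum>v<n. \<bar>lab v\<bar>)" by (intro sum_nonneg) auto
  then have "0 \<le> \<Delta>" and g: "f1 Z1 + f2 Z2 - f1 X - f2 T < lam + \<Delta>" "0 \<le> lam + \<Delta>"
    unfolding \<Delta>_def by linarith+
  ultimately have "f1 X + f2 T + (lam + \<Delta>) * (real (card (Z1 \<inter> Z2)) - real (card (X - src))) \<le> f1 Z1 + f2 Z2"
    using lam by blast
  moreover have "lam + \<Delta> \<le> (lam + \<Delta>) * (real (card (Z1 \<inter> Z2)) - real (card (X - src)))"
    using mult_left_mono[OF gt g(2)] by simp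
  ultimately show False using g by linarith
qed

end

text \<open>
  Augmentation along the parent pointers from the sink \<open>t\<close> back to a source. When the walk is at
  \<open>v\<close>, the exchanges on the path after \<open>v\<close> have been performed, giving \<open>A\<close> and \<open>B\<close>. Exchanges
  between nodes settled before \<open>v\<close> are not affected, since every parent is the earliest settled
  node from which its child has a tight arc.
\<close>

locale augmentation = exchange_graph +
  fixes st :: "nat \<Rightarrow> nat" and lab :: "nat \<Rightarrow> real" and par pt \<tau> :: "nat \<Rightarrow> nat" and m t :: nat
    and p' :: "nat \<Rightarrow> real" and R :: "nat \<Rightarrow> nat \<Rightarrow> nat \<Rightarrow> bool" and lam' :: real
  assumes d: "search_inv R st lab par pt \<tau> m"
    and t: "t \<in> snk" "st t = 2"
    and t_only: "\<And>v. v \<in> snk \<Longrightarrow> st v = 2 \<Longrightarrow> v = t"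
    and t_last: "\<And>v. v < n \<Longrightarrow> st v = 2 \<Longrightarrow> \<tau> v \<le> \<tau> t"
    and p': "\<And>v. v < n \<Longrightarrow> st v = 2 \<Longrightarrow> p' v = p v + lab v"
    and cert': "cert {..<n} D1 f1 D2 f2 X T src snk p' lam'"
begin

text \<open>The minimizers under the new potential. The locale prescribes \<open>p'\<close> by
  labels on settled nodes only, because the path runs through settled nodes only.\<close>

definition "M1 = argmin D1 (\<lambda>Z. f1 Z + sum (\<lambda>v. - p' v) Z)"
definition "M2 = argmin D2 (\<lambda>Z. f2 Z + sum p' Z)"

lemma XM: "X \<in> M1" and TM: "T \<in> M2"
  using cert' by (auto simp: cert_def M1_def M2_def)

text \<open>The exchange changes the objective behind \<open>M1\<close> by
  \<open>lab u + red_cost 1 u v - lab v\<close>. As \<open>X\<close> is a minimizer, the result is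
  one exactly if this change vanishes.\<close>

lemma tight1:
  assumes "u \<in> X" "v \<notin> X" "v < n" "st u = 2" "st v = 2"
  shows "insert v (X - {u}) \<in> M1 \<longleftrightarrow> arc 1 u v \<and> lab v = lab u + red_cost 1 u v"
proof (cases "insert v (X - {u}) \<in> D1")
  case True
  then have a: "arc 1 u v" using assms by (simp add: arc_def)
  have u: "u < n" using assms X by auto
  let ?g = "\<lambda>Z. f1 Z + sum (\<lambda>v. - p' v) Z"
  have e: "?g (insert v (X - {u})) = ?g X + (lab u + red_cost 1 u v - lab v)"
    using sum_exchange[OF X(3) assms(1,2), of "\<lambda>v. - p' v"] p'[OF u assms(4)] p'[OF assms(3,5)]
    by (simp add: red_cost_def)
  have X: "\<forall>Z\<in>D1. ?g X \<le> ?g Z" using XM by (auto simp: M1_def argmin_def)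
  have "insert v (X - {u}) \<in> M1 \<longleftrightarrow> ?g (insert v (X - {u})) \<le> ?g X"
    using True X XM unfolding M1_def argmin_def by fastforce
  moreover have "?g X \<le> ?g (insert v (X - {u}))" using X True by blast
  ultimately show ?thesis using a e by auto
qed (auto simp: M1_def argmin_def arc_def)

lemma tight2:
  assumes "u \<notin> T" "v \<in> T" "u < n" "st u = 2" "st v = 2"
  shows "insert u (T - {v}) \<in> M2 \<longleftrightarrow> arc 2 u v \<and> lab v = lab u + red_cost 2 u v"
proof (cases "insert u (T - {v}) \<in> D2")
  case True
  then have a: "arc 2 u v" using assms by (simp add: arc_def)
  have v: "v < n" using assms T by auto
  let ?g = "\<lambda>Z. f2 Z + sum p' Z"
  have e: "?g (insert u (T - {v})) = ?g T + (lab u + red_cost 2 u v - lab v)"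
    using sum_exchange[OF T(3) assms(2,1), of p'] p'[OF v assms(5)] p'[OF assms(3,4)]
    by (simp add: red_cost_def)
  have T: "\<forall>Z\<in>D2. ?g T \<le> ?g Z" using TM by (auto simp: M2_def argmin_def)
  have "insert u (T - {v}) \<in> M2 \<longleftrightarrow> ?g (insert u (T - {v})) \<le> ?g T"
    using True T TM unfolding M2_def argmin_def by fastforce
  moreover have "?g T \<le> ?g (insert u (T - {v}))" using T True by blast
  ultimately show ?thesis using a e by auto
qed (auto simp: M2_def argmin_def arc_def)

text \<open>The matched parts of \<open>A\<close> and \<open>B\<close> may disagree at
  \<open>v\<close> only. A \<open>v\<close> that is no source is a surplus in \<open>B\<close>,
  cured by adding it to \<open>A\<close> (type 1) or by dropping it from \<open>B\<close> (type 2);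
  either exchange moves the defect to the parent. At a source the sets agree: after a type 1 arc it
  is in neither, after a type 2 arc in both. The last two clauses admit \<open>y = v\<close>, since
  the exchange into \<open>v\<close> comes next.\<close>

definition augment_inv :: "nat \<Rightarrow> nat set \<Rightarrow> nat set \<Rightarrow> bool" where
  "augment_inv v A B \<longleftrightarrow> v < n \<and> st v = 2 \<and> v \<notin> snk - {t} \<and> A \<in> M1 \<and> B \<in> M2 \<and>
     (\<forall>x. x < n \<and> st x = 2 \<and> \<tau> x < \<tau> v \<longrightarrow> (x \<in> A \<longleftrightarrow> x \<in> X) \<and> (x \<in> B \<longleftrightarrow> x \<in> T)) \<and>
     (\<forall>w. w \<noteq> v \<longrightarrow> (w \<in> A - src \<longleftrightarrow> w \<in> B - (snk - {t}))) \<and>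
     (if v \<in> src then v \<in> A \<longleftrightarrow> v \<in> B else v \<in> B \<and> v \<notin> A) \<and>
     src - {v} \<subseteq> A \<and> snk - {t} \<subseteq> B \<and>
     (\<forall>x y. x \<in> X \<and> st x = 2 \<and> \<tau> x < \<tau> v \<and> y < n \<and> y \<notin> X \<and> st y = 2 \<and> (\<tau> y < \<tau> v \<or> y = v) \<longrightarrow>
        (insert y (A - {x}) \<in> M1 \<longleftrightarrow> insert y (X - {x}) \<in> M1)) \<and>
     (\<forall>x y. x < n \<and> x \<notin> T \<and> st x = 2 \<and> \<tau> x < \<tau> v \<and> y \<in> T \<and> st y = 2 \<and> (\<tau> y < \<tau> v \<or> y = v) \<longrightarrow>
        (insert x (B - {y}) \<in> M2 \<longleftrightarrow> insert x (T - {y}) \<in> M2))"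

lemma augment_inv_init: "augment_inv t X T"
proof -
  have "t < n" "t \<in> T" using t snk by auto
  then show ?thesis
    unfolding augment_inv_def using XM TM t src snk bal by auto
qed

lemma augment_inv_step:
  assumes a: "augment_inv v A B" and v: "v \<notin> src" and u: "u = par v"
  shows "u < n" "st u = 2" "\<tau> u < \<tau> v" "arc (pt v) u v" "u \<noteq> v" "v < n"
    and "pt v = 1 \<Longrightarrow> u \<in> A \<and> v \<notin> A \<and> augment_inv u (insert v (A - {u})) B"
    and "pt v = 2 \<Longrightarrow> u \<notin> B \<and> v \<in> B \<and> augment_inv u A (insert u (B - {v}))"
proof -
  have av: "v < n" "st v = 2" "v \<notin> snk - {t}" "A \<in> M1" "B \<in> M2" "v \<in> B" "v \<notin> A"
    and mem: "\<And>x. x < n \<Longrightarrow> st x = 2 \<Longrightarrow> \<tau> x < \<tau> v \<Longrightarrow> (x \<in> A \<longleftrightarrow> x \<in> X) \<and> (x \<in> B \<longleftrightarrow> x \<in> T)"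
    and bl: "\<And>w. w \<noteq> v \<Longrightarrow> (w \<in> A - src \<longleftrightarrow> w \<in> B - (snk - {t}))"
    and ss: "src - {v} \<subseteq> A" "snk - {t} \<subseteq> B"
    and e1: "\<And>x y. x \<in> X \<Longrightarrow> st x = 2 \<Longrightarrow> \<tau> x < \<tau> v \<Longrightarrow> y < n \<Longrightarrow> y \<notin> X \<Longrightarrow> st y = 2 \<Longrightarrow> (\<tau> y < \<tau> v \<or> y = v) \<Longrightarrow>
        (insert y (A - {x}) \<in> M1 \<longleftrightarrow> insert y (X - {x}) \<in> M1)"
    and e2: "\<And>x y. x < n \<Longrightarrow> x \<notin> T \<Longrightarrow> st x = 2 \<Longrightarrow> \<tau> x < \<tau> v \<Longrightarrow> y \<in> T \<Longrightarrow> st y = 2 \<Longrightarrow> (\<tau> y < \<tau> v \<or> y = v) \<Longrightarrow>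
        (insert x (B - {y}) \<in> M2 \<longleftrightarrow> insert x (T - {y}) \<in> M2)"
    using a v unfolding augment_inv_def by simp_all
  have "st v \<noteq> 0" using av(2) by simp
  note pv = search_invD(2)[OF d av(1) v this, folded u]
  show u1: "u < n" "st u = 2" "\<tau> u < \<tau> v" "arc (pt v) u v" "u \<noteq> v" "v < n" using pv av(1,2) by auto
  have lv: "lab v = lab u + red_cost (pt v) u v" using pv by simp
  have strict: "lab v < lab x + red_cost s x v" if "x < n" "st x = 2" "\<tau> x < \<tau> u" "arc s x v" for s x
    using pv that by blast
  have ut: "u \<noteq> t" using u1(3) t_last[OF av(1,2)] by auto
  then have usnk: "u \<notin> snk" using t_only u1(2) by blast
  have vsrc: "x \<in> src \<Longrightarrow> x \<noteq> v" for x using v by auto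
  {
    assume p1: "pt v = 1"
    then have uX: "u \<in> X" "v \<notin> X" using u1(4) by (auto simp: arc_def)
    have uA: "u \<in> A" using mem[OF u1(1-3)] uX by simp
    have uB: "u \<in> src \<longleftrightarrow> u \<notin> B"
    proof -
      have "u \<in> src \<longleftrightarrow> u \<notin> T" using bal uX usnk by auto
      then show ?thesis using mem[OF u1(1-3)] by simp
    qed
    have "insert v (X - {u}) \<in> M1" using tight1[OF uX av(1) u1(2) av(2)] u1(4) lv p1 by simp
    then have A': "insert v (A - {u}) \<in> M1"
      using e1[OF uX(1) u1(2,3) av(1) uX(2) av(2)] by simp
    have e1': "insert y (insert v (A - {u}) - {x}) \<in> M1 \<longleftrightarrow> insert y (X - {x}) \<in> M1"
      if h: "x \<in> X" "st x = 2" "\<tau> x < \<tau> u" "y < n" "y \<notin> X" "st y = 2" "\<tau> y < \<tau> u \<or> y = u" for x y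
    proof -
      have xn: "x < n" using h X by auto
      have xA: "x \<in> A" using mem[OF xn h(2)] h u1(3) by auto
      \<comment> \<open>The alternative \<open>y = u\<close> is void, as \<open>u\<close> lies in
        \<open>X\<close> and \<open>y\<close> does not.\<close>
      have yu: "\<tau> y < \<tau> u" "y \<noteq> u" using h uX by auto
      have yA: "y \<notin> A" using mem[OF h(4,6)] h(5) yu u1(3) by auto
      \<comment> \<open>A tight arc from \<open>x\<close> to \<open>v\<close> is impossible because
        \<open>x\<close> was settled before the parent \<open>u\<close>. Hence one of the two
        crossed exchanges is missing, and exchanging \<open>u\<close> for \<open>v\<close> does not
        affect the pair \<open>x\<close>, \<open>y\<close>.\<close>
      have "\<not> insert v (X - {x}) \<in> M1"
        using tight1[OF h(1) uX(2) av(1) h(2) av(2)] strict[OF xn h(2,3), of 1] by auto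
      then have nt: "\<not> insert v (A - {x}) \<in> M1"
        using e1[OF h(1,2) _ av(1) uX(2) av(2)] h(3) u1(3) by auto
      have "insert y (insert v (A - {u}) - {x}) \<in> M1 \<longleftrightarrow> insert y (A - {x}) \<in> M1"
        by (rule exchangeable_after_exchange[OF vm_add_modular[OF vm1 fin1] M1_def av(4) uA av(7) xA yA _ _ A'])
          (use nt h yu u1(3) in auto)
      also have "\<dots> \<longleftrightarrow> insert y (X - {x}) \<in> M1"
        using e1[OF h(1,2) _ h(4-6)] h(3) yu u1(3) by auto
      finally show ?thesis .
    qed
    have "augment_inv u (insert v (A - {u})) B"
      unfolding augment_inv_def
    proof (intro conjI allI impI)
      show "u < n" "st u = 2" "u \<notin> snk - {t}" "insert v (A - {u}) \<in> M1" "B \<in> M2"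
        using u1 usnk A' av by auto
      fix x assume "x < n \<and> st x = 2 \<and> \<tau> x < \<tau> u"
      then show "x \<in> insert v (A - {u}) \<longleftrightarrow> x \<in> X" "x \<in> B \<longleftrightarrow> x \<in> T" using mem u1(3) by auto
    next
      fix w assume "w \<noteq> u"
      then show "w \<in> insert v (A - {u}) - src \<longleftrightarrow> w \<in> B - (snk - {t})"
        using bl[of w] av v by (cases "w = v") auto
    next
      show "if u \<in> src then u \<in> insert v (A - {u}) \<longleftrightarrow> u \<in> B else u \<in> B \<and> u \<notin> insert v (A - {u})"
        using uB u1(5) by auto
      show "src - {u} \<subseteq> insert v (A - {u})" "snk - {t} \<subseteq> B" using ss by auto
    next
      fix x y assume "x \<in> X \<and> st x = 2 \<and> \<tau> x < \<tau> u \<and> y < n \<and> y \<notin> X \<and> st y = 2 \<and> (\<tau> y < \<tau> u \<or> y = u)"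
      then show "insert y (insert v (A - {u}) - {x}) \<in> M1 \<longleftrightarrow> insert y (X - {x}) \<in> M1" using e1' by blast
    next
      fix x y assume "x < n \<and> x \<notin> T \<and> st x = 2 \<and> \<tau> x < \<tau> u \<and> y \<in> T \<and> st y = 2 \<and> (\<tau> y < \<tau> u \<or> y = u)"
      then show "insert x (B - {y}) \<in> M2 \<longleftrightarrow> insert x (T - {y}) \<in> M2" using e2[of x y] u1(3) by auto
    qed
    then show "u \<in> A \<and> v \<notin> A \<and> augment_inv u (insert v (A - {u})) B" using uA av by simp
  }
  {
    assume p2: "pt v = 2"
    then have uT: "u \<notin> T" "v \<in> T" using u1(4) by (auto simp: arc_def)
    have uB: "u \<notin> B" using mem[OF u1(1-3)] uT by simp
    have uA: "u \<in> src \<longleftrightarrow> u \<in> A"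
    proof -
      have "u \<in> src \<longleftrightarrow> u \<in> X" using bal uT src by auto
      then show ?thesis using mem[OF u1(1-3)] by simp
    qed
    have "insert u (T - {v}) \<in> M2" using tight2[OF uT u1(1,2) av(2)] u1(4) lv p2 by simp
    then have B': "insert u (B - {v}) \<in> M2"
      using e2[OF u1(1) uT(1) u1(2,3) uT(2) av(2)] by simp
    have e2': "insert x (insert u (B - {v}) - {y}) \<in> M2 \<longleftrightarrow> insert x (T - {y}) \<in> M2"
      if h: "x < n" "x \<notin> T" "st x = 2" "\<tau> x < \<tau> u" "y \<in> T" "st y = 2" "\<tau> y < \<tau> u \<or> y = u" for x y
    proof -
      have yn: "y < n" using h T by auto
      have xB: "x \<notin> B" using mem[OF h(1,3)] h u1(3) by auto
      have yu: "\<tau> y < \<tau> u" "y \<noteq> u" using h uT by auto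
      have yB: "y \<in> B" using mem[OF yn h(6)] h(5) yu u1(3) by auto
      have "\<not> insert x (T - {v}) \<in> M2"
        using tight2[OF h(2) uT(2) h(1,3) av(2)] strict[OF h(1,3,4), of 2] by auto
      then have nt: "\<not> insert x (B - {v}) \<in> M2"
        using e2[OF h(1-3) _ uT(2) av(2)] h(4) u1(3) by auto
      have "insert x (insert u (B - {v}) - {y}) \<in> M2 \<longleftrightarrow> insert x (B - {y}) \<in> M2"
        by (rule exchangeable_after_exchange[OF vm_add_modular[OF vm2 fin2] M2_def av(5) av(6) uB yB xB _ _ B'])
          (use nt h yu u1(3) in auto)
      also have "\<dots> \<longleftrightarrow> insert x (T - {y}) \<in> M2"
        using e2[OF h(1-3) _ h(5,6)] h(4) yu u1(3) by auto
      finally show ?thesis .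
    qed
    have "augment_inv u A (insert u (B - {v}))"
      unfolding augment_inv_def
    proof (intro conjI allI impI)
      show "u < n" "st u = 2" "u \<notin> snk - {t}" "A \<in> M1" "insert u (B - {v}) \<in> M2"
        using u1 usnk B' av by auto
      fix x assume "x < n \<and> st x = 2 \<and> \<tau> x < \<tau> u"
      then show "x \<in> A \<longleftrightarrow> x \<in> X" "x \<in> insert u (B - {v}) \<longleftrightarrow> x \<in> T" using mem u1(3) by auto
    next
      fix w assume "w \<noteq> u"
      then show "w \<in> A - src \<longleftrightarrow> w \<in> insert u (B - {v}) - (snk - {t})"
        using bl[of w] av v by (cases "w = v") auto
    next
      show "if u \<in> src then u \<in> A \<longleftrightarrow> u \<in> insert u (B - {v}) else u \<in> insert u (B - {v}) \<and> u \<notin> A"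
        using uA by auto
      show "src - {u} \<subseteq> A" "snk - {t} \<subseteq> insert u (B - {v})" using ss av v by auto
    next
      fix x y assume "x \<in> X \<and> st x = 2 \<and> \<tau> x < \<tau> u \<and> y < n \<and> y \<notin> X \<and> st y = 2 \<and> (\<tau> y < \<tau> u \<or> y = u)"
      then show "insert y (A - {x}) \<in> M1 \<longleftrightarrow> insert y (X - {x}) \<in> M1" using e1[of x y] u1(3) by auto
    next
      fix x y assume "x < n \<and> x \<notin> T \<and> st x = 2 \<and> \<tau> x < \<tau> u \<and> y \<in> T \<and> st y = 2 \<and> (\<tau> y < \<tau> u \<or> y = u)"
      then show "insert x (insert u (B - {v}) - {y}) \<in> M2 \<longleftrightarrow> insert x (T - {y}) \<in> M2" using e2' by blast
    qed
    then show "u \<notin> B \<and> v \<in> B \<and> augment_inv u A (insert u (B - {v}))" using uB av by simp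
  }
qed

text \<open>Only \<open>s\<close> and \<open>t\<close> leave the sets of unmatched elements. All
  members of \<open>D1\<close> have the same size, so having one source less means one matched
  element more.\<close>

lemma augment_inv_final:
  assumes a: "augment_inv s A B" and s: "s \<in> src"
  shows "cert {..<n} D1 f1 D2 f2 A B (src - {s}) (snk - {t}) p' lam'"
    and "card (A - (src - {s})) = Suc (card (X - src))"
proof -
  have av: "s \<notin> snk - {t}" "A \<in> M1" "B \<in> M2" "s \<in> A \<longleftrightarrow> s \<in> B"
    and bl: "\<And>w. w \<noteq> s \<Longrightarrow> (w \<in> A - src \<longleftrightarrow> w \<in> B - (snk - {t}))"
    and ss: "src - {s} \<subseteq> A" "snk - {t} \<subseteq> B"
    using a s unfolding augment_inv_def by simp_all
  have "w \<in> A - (src - {s}) \<longleftrightarrow> w \<in> B - (snk - {t})" for w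
    using av bl[of w] by (cases "w = s") auto
  then have "A - (src - {s}) = B - (snk - {t})" by blast
  then show "cert {..<n} D1 f1 D2 f2 A B (src - {s}) (snk - {t}) p' lam'"
    using cert' av ss unfolding cert_def M1_def M2_def by simp
  have A: "A \<in> D1" using av by (auto simp: M1_def argmin_def)
  then have cA: "card A = card X" and fA: "finite A" using card1 fin1 by auto
  have fs: "finite src" using src X finite_subset by blast
  have "card (A - (src - {s})) = card A - card (src - {s})" using ss fs by (intro card_Diff_subset) auto
  moreover have "card (X - src) = card X - card src" using src fs by (intro card_Diff_subset)
  moreover have "Suc (card (src - {s})) = card src" using fs s by (rule card_Suc_Diff1)
  moreover have "card src \<le> card X" using src X by (simp add: card_mono)
  ultimately show "card (A - (src - {s})) = Suc (card (X - src))" using cA by linarith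
qed

end

section \<open>Greedy minimization\<close>

notation Seq (infixr ";;" 60)

abbreviation IfT :: "bexp \<Rightarrow> com \<Rightarrow> com" where
  "IfT b c \<equiv> Cond b c Skip"

text \<open>Cells must be exactly 0 or 1, because a flip replaces \<open>a i\<close> by
  \<open>1 - a i\<close> in truncated subtraction.\<close>

definition bits :: "nat \<Rightarrow> (nat \<Rightarrow> nat) \<Rightarrow> nat set \<Rightarrow> bool" where
  "bits n a S \<longleftrightarrow> (\<forall>i<n. a i = (if i \<in> S then 1 else 0)) \<and> S \<subseteq> {..<n}"

definition toggle :: "'a \<Rightarrow> 'a set \<Rightarrow> 'a set" where
  "toggle u S = (if u \<in> S then S - {u} else insert u S)"

lemma argmin_nonempty:
  assumes "finite D" "X \<in> D"
  obtains M where "M \<in> argmin D f"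
proof -
  have "Min (f ` D) \<in> f ` D" using assms by (intro Min_in) auto
  then obtain M where M: "M \<in> D" "f M = Min (f ` D)" by force
  then have "f M \<le> f Y" if "Y \<in> D" for Y using that assms by simp
  with M have "M \<in> argmin D f" by (simp add: argmin_def)
  then show thesis by (rule that)
qed

lemma array_set_bits: "bits n a S \<Longrightarrow> array_set n a = S"
  by (auto simp: bits_def array_set_def split: if_splits)

lemma bits_iff: "bits n a S \<Longrightarrow> i < n \<Longrightarrow> a i = (if i \<in> S then 1 else 0)"
  by (simp add: bits_def)

lemma bits_toggle: "bits n a S \<Longrightarrow> u < n \<Longrightarrow> bits n (a(u := 1 - a u)) (toggle u S)"
  by (auto simp: bits_def toggle_def)

lemma toggle_swap: "u \<in> S \<Longrightarrow> v \<notin> S \<Longrightarrow> toggle v (toggle u S) = insert v (S - {u})"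
  by (auto simp: toggle_def)

lemma toggle_swap2: "u \<in> S \<Longrightarrow> v \<notin> S \<Longrightarrow> toggle u (toggle v S) = insert v (S - {u})"
  by (auto simp: toggle_def)

definition flip :: "vname \<Rightarrow> vname \<Rightarrow> com" where
  "flip a i = IStore a (IVar i) (ISub (INum 1) (IArr a (IVar i)))"

text \<open>Flipping two bits, querying and flipping back costs a constant besides the query itself,
  whereas a fresh copy of the array would cost order of \<open>n\<close> for every arc.\<close>

definition query_swap :: "oracle_id \<Rightarrow> vname \<Rightarrow> vname \<Rightarrow> vname \<Rightarrow> com" where
  "query_swap w a i j = flip a i;; flip a j;; Query w a ''qf'' ''qv'';; flip a j;; flip a i"

lemma mods_flip [simp]: "mods (flip a i) = {a}"
  by (simp add: flip_def)

lemma mods_query_swap [simp]: "mods (query_swap w a i j) = {a, ''qf'', ''qv''}"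
  by (auto simp: query_swap_def)

context machine
begin

lemma wpt_flip [simp]: "wpt (flip a i) s Q \<longleftrightarrow>
   Q 6 (s\<lparr>iarr := (iarr s)(a := (iarr s a)(ivar s i := 1 - iarr s a (ivar s i)))\<rparr>)"
  by (simp add: flip_def)

text \<open>The 25 consists of four flips of cost 6 and the unit charged for the call; after the
  second pair of flips the array is the original one, so only the outcome of the query is
  visible.\<close>

lemma wpt_query_swap:
  assumes b: "bits n (iarr s a) S" and i: "ivar s i < n" "ivar s j < n" "i \<noteq> ''qf''" "j \<noteq> ''qf''"
    and S': "S' = toggle (ivar s j) (toggle (ivar s i) S)"
  shows "wpt (query_swap w a i j) s Q \<longleftrightarrow>
    (if S' \<in> D w then Q (25 + \<gamma>) (s\<lparr>ivar := (ivar s)(''qf'' := 1), rvar := (rvar s)(''qv'' := f w S')\<rparr>)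
     else Q (25 + \<gamma>) (s\<lparr>ivar := (ivar s)(''qf'' := 0)\<rparr>))"
proof -
  let ?u = "ivar s i" and ?v = "ivar s j" and ?a = "iarr s a"
  let ?a1 = "?a(?u := 1 - ?a ?u)"
  let ?a2 = "?a1(?v := 1 - ?a1 ?v)"
  let ?a3 = "?a2(?v := 1 - ?a2 ?v)"
  have "bits n ?a2 S'"
    unfolding S' by (intro bits_toggle b i)
  then have a2: "array_set n ?a2 = S'" by (rule array_set_bits)
  have "?a ?u \<le> 1" "?a ?v \<le> 1" using bits_iff[OF b] i by auto
  then have a4: "?a3(?u := 1 - ?a3 ?u) = ?a" by (auto simp: fun_eq_iff)
  show ?thesis
    using a2 a4 i(3,4) by (simp add: query_swap_def fun_upd_same fun_upd_other del: fun_upd_apply)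
qed

end

text \<open>Each element of the initial basis \<open>b\<close> is replaced by a best element, \<open>bi\<close>.\<close>

definition best_replacement :: "oracle_id \<Rightarrow> vname \<Rightarrow> com" where
  "best_replacement w x =
     IAssign ''bi'' (IVar ''i'');; RAssign ''bv'' (RVar ''cv'');;
     For ''j'' ''n'' (IfT (IEq (IArr x (IVar ''j'')) (INum 0))
       (query_swap w x ''i'' ''j'';;
        IfT (BAnd (IEq (IVar ''qf'') (INum 1)) (RLess (RVar ''qv'') (RVar ''bv'')))
          (IAssign ''bi'' (IVar ''j'');; RAssign ''bv'' (RVar ''qv''))));;
     flip x ''i'';; flip x ''bi'';; RAssign ''cv'' (RVar ''bv'')"

definition minimize :: "oracle_id \<Rightarrow> vname \<Rightarrow> vname \<Rightarrow> com" where
  "minimize w b x =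
     For ''i'' ''n'' (IStore x (IVar ''i'') (IArr b (IVar ''i'')));;
     Query w x ''qf'' ''cv'';;
     For ''i'' ''n'' (IfT (IEq (IArr b (IVar ''i'')) (INum 1)) (best_replacement w x))"

lemma mods_best_replacement [simp]:
  "mods (best_replacement w x) = {x, ''bi'', ''bv'', ''j'', ''qf'', ''qv'', ''cv''}"
  by (auto simp: best_replacement_def)

lemma mods_minimize [simp]:
  "mods (minimize w b x) = {x, ''i'', ''bi'', ''bv'', ''j'', ''qf'', ''qv'', ''cv''}"
  by (auto simp: minimize_def)

context machine
begin

lemma wpt_best_replacement:
  assumes b: "bits n (iarr s x) S" and n: "ivar s ''n'' = n" and i: "ivar s ''i'' = i" "i \<in> S"
    and S: "S \<in> D w" "rvar s ''cv'' = f w S"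
    and x: "x \<notin> {''i'', ''bi'', ''bv'', ''j'', ''qf'', ''qv'', ''cv'', ''n''}"
    and post: "\<And>t s' u. u = i \<or> u \<notin> S \<Longrightarrow> insert u (S - {i}) \<in> D w \<Longrightarrow>
       (\<And>v. v = i \<or> v \<notin> S \<Longrightarrow> insert v (S - {i}) \<in> D w \<Longrightarrow> f w (insert u (S - {i})) \<le> f w (insert v (S - {i}))) \<Longrightarrow>
       bits n (iarr s' x) (insert u (S - {i})) \<Longrightarrow> rvar s' ''cv'' = f w (insert u (S - {i})) \<Longrightarrow>
       t \<le> 100 * G * (n + 1) \<Longrightarrow> agree (mods (best_replacement w x)) s s' \<Longrightarrow> Q t s'"
  shows "wpt (best_replacement w x) s Q"
proof -
  have "i < n" using b i by (auto simp: bits_def)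
  let ?ex = "\<lambda>u. insert u (S - {i})"
  let ?J = "\<lambda>j s'. iarr s' x = iarr s x \<and> (ivar s' ''bi'' = i \<or> ivar s' ''bi'' \<notin> S) \<and> ivar s' ''bi'' < n \<and>
     ?ex (ivar s' ''bi'') \<in> D w \<and> rvar s' ''bv'' = f w (?ex (ivar s' ''bi'')) \<and> rvar s' ''bv'' \<le> f w S \<and>
     (\<forall>u<j. u \<notin> S \<and> ?ex u \<in> D w \<longrightarrow> rvar s' ''bv'' \<le> f w (?ex u))"
  have "wpt (best_replacement w x) s (\<lambda>t s'. \<exists>u. (u = i \<or> u \<notin> S) \<and> ?ex u \<in> D w \<and>
      (\<forall>v. v = i \<or> v \<notin> S \<longrightarrow> ?ex v \<in> D w \<longrightarrow> f w (?ex u) \<le> f w (?ex v)) \<and>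
      bits n (iarr s' x) (?ex u) \<and> rvar s' ''cv'' = f w (?ex u) \<and> t \<le> 100 * G * (n + 1))"
    unfolding best_replacement_def wpt_Seq wpt_IAssign wpt_RAssign
  proof (rule wpt_For[where Inv = ?J and T = "\<lambda>_. 70 * G"], goal_cases)
    case 1
    then show ?case using i S \<open>i < n\<close> by (simp add: insert_absorb)
  next
    case (5 j s')
    note ag = agreeD[OF 5(4)]
    have j: "j < n" "ivar s' ''j'' = j" "ivar s' ''i'' = i" "ivar s' ''n'' = n"
      using 5(1,3) ag(1)[of "''i''"] ag(1)[of "''n''"] n i x by auto
    have bx: "bits n (iarr s' x) S" using 5(2) b by simp
    have e: "toggle j (toggle i S) = ?ex j" if "j \<notin> S" using toggle_swap i(2) that by fast
    show ?case
    proof (cases "j \<in> S")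
      case True
      then have "iarr s' x j = 1" using bits_iff[OF bx j(1)] by simp
      then show ?thesis using 5(2) j True G1 by (auto simp: less_Suc_eq)
    next
      case False
      then have "iarr s' x j = 0" using bits_iff[OF bx j(1)] by simp
      then show ?thesis using 5(2) j False \<open>i < n\<close> \<gamma>
        by (auto simp: less_Suc_eq wpt_query_swap[OF bx, of "''i''" "''j''" "?ex j"] e G_def)
    qed
  next
    case (7 t s')
    note ag = agreeD[OF 7(2)]
    have j: "ivar s' ''i'' = i" "ivar s' ''n'' = n"
      using ag(1)[of "''i''"] ag(1)[of "''n''"] n i x by auto
    let ?u = "ivar s' ''bi''"
    have bx: "bits n (iarr s' x) S" using 7(1) b by simp
    have "bits n ((iarr s' x)(i := 1 - iarr s' x i)) (toggle i S)" (is "bits n ?a1 _")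
      using bits_toggle[OF bx \<open>i < n\<close>] .
    then have b2: "bits n (?a1(?u := 1 - ?a1 ?u)) (toggle ?u (toggle i S))"
      by (rule bits_toggle) (use 7 in auto)
    \<comment> \<open>If \<open>bi\<close> still equals \<open>i\<close>, the two flips cancel, and
      \<open>?ex i\<close> is \<open>S\<close> as well.\<close>
    have tt: "toggle ?u (toggle i S) = ?ex ?u" using 7(1) i(2) by (auto simp: toggle_def)
    have t: "t \<le> 6 + n * (70 * G + 8)" using 7(3) n by simp
    have G: "real n \<le> n * G" using G1 by (simp add: mult_le_cancel_left1)
    have nn: "ivar s ''n'' = n" by (rule n)
    have best: "f w (?ex ?u) \<le> f w (?ex v)" if "v = i \<or> v \<notin> S" "?ex v \<in> D w" for v
    proof -
      have "v = i \<Longrightarrow> ?ex v = S" using i by auto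
      moreover have "v < n" using D_sub[OF that(2)] by auto
      ultimately show ?thesis using 7(1) that n by auto
    qed
    have "6 + n * (70 * G + 8) = 6 + 70 * (n * G) + 8 * real n" "100 * G * (n + 1) = 100 * (n * G) + 100 * G"
      by (simp_all add: algebra_simps)
    then have t: "t + 18 \<le> 100 * G * (n + 1)" using t G G1 by linarith
    have tt': "bits n (?a1(?u := 1 - ?a1 ?u)) (?ex ?u)" using b2 tt by simp
    show ?case
      unfolding wpt_flip wpt_RAssign
      by (rule exI[of _ ?u]) (use 7(1) best tt' j t in \<open>simp add: algebra_simps\<close>)
  qed (use x G1 in auto)
  then show ?thesis by (rule wpt_mono_agree) (use post in blast)
qed

lemma wpt_minimize:
  assumes n: "ivar s ''n'' = n" and B: "bits n (iarr s b) B" "B \<in> D w"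
    and vm: "vm (D w) (f w)" and card: "\<And>S. S \<in> D w \<Longrightarrow> card S = card B"
    and x: "x \<notin> {''i'', ''bi'', ''bv'', ''j'', ''qf'', ''qv'', ''cv'', ''n''}"
    and y: "b \<notin> {x, ''i'', ''bi'', ''bv'', ''j'', ''qf'', ''qv'', ''cv'', ''n''}"
    and post: "\<And>t s' S. bits n (iarr s' x) S \<Longrightarrow> S \<in> argmin (D w) (f w) \<Longrightarrow>
       t \<le> 200 * G * (n + 1) * (card B + 1) \<Longrightarrow> agree (mods (minimize w b x)) s s' \<Longrightarrow> Q t s'"
  shows "wpt (minimize w b x) s Q"
proof -
  have B_sub: "B \<subseteq> {..<n}" and fB: "finite B" using D_sub[OF B(2)] by (auto intro: finite_subset)
  have nG: "real n \<le> n * G" using G1 by (simp add: mult_le_cancel_left1)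
  \<comment> \<open>\<open>C\<close> consists of the elements chosen so far; some minimizer contains all of them.\<close>
  let ?J = "\<lambda>i s'. iarr s' b = iarr s b \<and> (\<exists>S. bits n (iarr s' x) S \<and> S \<in> D w \<and> rvar s' ''cv'' = f w S \<and>
      B \<inter> {i..} \<subseteq> S \<and> (\<exists>C M. C \<subseteq> S \<and> C \<inter> (B \<inter> {i..}) = {} \<and> card C = card (B \<inter> {..<i}) \<and>
        M \<in> argmin (D w) (f w) \<and> C \<subseteq> M))"
  have "finite (D w)" using D_sub by (auto intro: finite_subset[of _ "Pow {..<n}"])
  then obtain M0 where M0: "M0 \<in> argmin (D w) (f w)" using argmin_nonempty B(2) by blast
  let ?T = "\<lambda>i. 20 * G + (if i \<in> B then 100 * G * (n + 1) else 0)"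
  have "wpt (minimize w b x) s (\<lambda>t s'. \<exists>S. bits n (iarr s' x) S \<and> S \<in> argmin (D w) (f w) \<and>
      t \<le> 200 * G * (n + 1) * (card B + 1))"
    unfolding minimize_def wpt_Seq
  proof (rule wpt_For[where Inv = "\<lambda>i s'. iarr s' b = iarr s b \<and> (\<forall>j<i. iarr s' x j = iarr s b j)" and T = "\<lambda>_. 5"], goal_cases)
    case (5 i s')
    then show ?case using y by (auto simp: less_Suc_eq)
  next
    case (7 t1 s1)
    note ag = agreeD[OF 7(2)]
    have bx: "bits n (iarr s1 x) B" using 7(1) B n by (auto simp: bits_def)
    have n1: "ivar s1 ''n'' = n" using ag(1)[of "''n''"] n x by auto
    have t1: "t1 \<le> 6 + 13 * real n" using 7(3) n by simp
    have b1: "iarr s1 b = iarr s b" using 7(1) by simp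
    have "wpt (For ''i'' ''n'' (IfT (IEq (IArr b (IVar ''i'')) (INum 1)) (best_replacement w x)))
       (s1\<lparr>ivar := (ivar s1)(''qf'' := 1), rvar := (rvar s1)(''cv'' := f w B)\<rparr>)
       (\<lambda>t' s''. \<exists>S. bits n (iarr s'' x) S \<and> S \<in> argmin (D w) (f w) \<and> t1 + (1 + \<gamma> + t') \<le> 200 * G * (n + 1) * (card B + 1))"
    proof (rule wpt_For[where Inv = ?J and T = ?T], goal_cases)
      case 1
      have "\<exists>C M. C \<subseteq> B \<and> C \<inter> (B \<inter> {0..}) = {} \<and> card C = card (B \<inter> {..<0}) \<and>
        M \<in> argmin (D w) (f w) \<and> C \<subseteq> M"
        by (rule exI[of _ "{}"], rule exI[of _ M0]) (simp add: M0)
      then show ?case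
        by (intro conjI, simp add: b1, intro exI[of _ B]) (use bx B in simp)
    next
      case (5 i s2)
      note ag = agreeD[OF 5(4)]
      have i: "i < n" "ivar s2 ''i'' = i" "ivar s2 ''n'' = n"
        using 5(1,3) ag(1)[of "''n''"] n1 x by auto
      from 5(2) obtain S C M where S: "bits n (iarr s2 x) S" "S \<in> D w" "rvar s2 ''cv'' = f w S"
        "B \<inter> {i..} \<subseteq> S" "C \<subseteq> S" "C \<inter> (B \<inter> {i..}) = {}" "card C = card (B \<inter> {..<i})"
        "M \<in> argmin (D w) (f w)" "C \<subseteq> M" and b2: "iarr s2 b = iarr s b" by blast
      have bi: "iarr s2 b i = (if i \<in> B then 1 else 0)" using bits_iff[OF B(1) i(1)] b2 by simp
      show ?case
      proof (cases "i \<in> B")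
        case False
        then have "B \<inter> {i..} = B \<inter> {Suc i..}" "B \<inter> {..<Suc i} = B \<inter> {..<i}"
          by (auto simp: less_Suc_eq Suc_le_eq order_less_le)
        then have "?J (Suc i) s2" using S b2 by metis
        then show ?thesis using False bi x i G1 by simp
      next
        case True
        have iS: "i \<in> S" using S(4) True by auto
        have C: "i \<notin> C" "finite C" using S(5,6) True D_sub[OF S(2)] by (auto intro: finite_subset)
        have cS: "B \<inter> {..<Suc i} = insert i (B \<inter> {..<i})" using True by (auto simp: less_Suc_eq)
        have "wpt (best_replacement w x) s2 (\<lambda>t s''. ?J (Suc i) (s''\<lparr>ivar := (ivar s'')(''i'' := Suc i)\<rparr>) \<and> t + 5 \<le> ?T i)"
        proof (rule wpt_best_replacement[OF S(1) i(3) i(2) iS S(2,3) x], goal_cases)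
          case (1 t s3 u)
          obtain Z where Z: "Z \<in> argmin (D w) (f w)" "insert u C \<subseteq> Z"
            using greedy_step[OF vm S(2) iS C(1) S(5) 1(1,2) 1(3) S(8,9)] by blast
          have uC: "u \<notin> C" using 1(1) S(5) C(1) by auto
          have "iarr s3 b = iarr s b" using agreeD(3)[OF 1(7), of b] b2 y x by simp
          moreover have "B \<inter> {Suc i..} \<subseteq> insert u (S - {i})" using S(4) by auto
          moreover have "insert u C \<subseteq> insert u (S - {i})" using S(5) C by auto
          moreover have "insert u C \<inter> (B \<inter> {Suc i..}) = {}"
            using S(4,6) 1(1) by (auto simp: Suc_le_eq)
          moreover have "card (insert u C) = card (B \<inter> {..<Suc i})"
            using uC C(2) S(7) by (simp add: cS)
          ultimately have "?J (Suc i) s3" using 1(2,4,5) Z by metis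
          then show ?case using 1(6) True G1 by simp
        qed
        then show ?thesis using bi True i by (simp add: algebra_simps)
      qed
    next
      case (6 i)
      then show ?case using G1 by simp
    next
      case (7 t2 s2)
      have n2: "ivar (s1\<lparr>ivar := (ivar s1)(''qf'' := 1), rvar := (rvar s1)(''cv'' := f w B)\<rparr>) ''n'' = n" using n1 by simp
      from 7(1)[unfolded n2] obtain S C M where S: "bits n (iarr s2 x) S" "S \<in> D w" "C \<subseteq> S" "card C = card (B \<inter> {..<n})"
        "M \<in> argmin (D w) (f w)" "C \<subseteq> M" by blast
      have "B \<inter> {..<n} = B" using B_sub by auto
      then have "card C = card B" using S by simp
      moreover have MD: "M \<in> D w" using S(5) by (simp add: argmin_def)
      moreover have "finite S" "finite M" using D_sub[OF S(2)] D_sub[OF MD] by (auto intro: finite_subset)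
      \<comment> \<open>One element has been chosen for each element of \<open>B\<close>, so
        \<open>C\<close> has full size and coincides with both the current set and the minimizer
        that contains it.\<close>
      ultimately have "C = S" "C = M" using S(2,3,6) card card_subset_eq[of S C] card_subset_eq[of M C] by simp_all
      then have SM: "S \<in> argmin (D w) (f w)" using S by simp
      have "(\<Sum>i<n. ?T i + 8) = (\<Sum>i<n. 20 * G + 8) + (\<Sum>i<n. if i \<in> B then 100 * G * (n + 1) else 0)"
        by (simp only: sum.distrib[symmetric] add_ac)
      also have "(\<Sum>i<n. if i \<in> B then 100 * G * real (n + 1) else 0) = card B * (100 * G * (n + 1))"
        using B_sub by (subst sum.inter_restrict[symmetric]) (auto simp: Int_absorb1)
      finally have t2: "t2 \<le> 6 + n * (20 * G + 8) + card B * (100 * G * (n + 1))" using 7(3) n2 by simp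
      let ?c = "real (card B)"
      have e: "200 * G * (n + 1) * (?c + 1) = 200 * (n * G * ?c) + 200 * (n * G) + 200 * (?c * G) + 200 * G"
        "n * (20 * G + 8) = 20 * (n * G) + 8 * real n"
        "?c * (100 * G * (n + 1)) = 100 * (n * G * ?c) + 100 * (?c * G)"
        by (simp_all add: algebra_simps)
      have "0 \<le> n * G * ?c" "0 \<le> ?c * G" using G1 by simp_all
      moreover have "1 + \<gamma> = G" by (simp add: G_def)
      ultimately have "t1 + (1 + \<gamma> + t2) \<le> 200 * G * (n + 1) * (?c + 1)"
        using t1 t2 nG G1 unfolding e by linarith
      then show ?case using S(1) SM by (auto simp: add_ac)
    qed (use x in auto)
    then show ?case using array_set_bits[OF bx] B(2) by simp
  qed (use x y in auto)
  then show ?thesis by (rule wpt_mono_agree) (use post in blast)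
qed

end

section \<open>Tournament trees\<close>

definition better :: "(nat \<Rightarrow> real) \<Rightarrow> nat \<Rightarrow> nat \<Rightarrow> nat" where
  "better d a b = (if a = 0 then b else if b = 0 then a else if d (b - 1) < d (a - 1) then b else a)"

text \<open>
  A tournament tree for the keys \<open>d\<close> of the elements of \<open>L\<close>: the children of node \<open>i\<close> are \<open>2 * i\<close>
  and \<open>2 * i + 1\<close>, the leaf of \<open>v\<close> is \<open>n + v\<close>, and a node stores \<open>v + 1\<close> for the winner \<open>v\<close> or 0.
\<close>

definition tournament :: "nat \<Rightarrow> (nat \<Rightarrow> real) \<Rightarrow> (nat \<Rightarrow> nat) \<Rightarrow> nat set \<Rightarrow> bool" where
  "tournament n d tr L \<longleftrightarrow>
     (\<forall>i. 1 \<le> i \<and> i < n \<longrightarrow> tr i = better d (tr (i + i)) (tr (i + i + 1))) \<and>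
     (\<forall>v<n. tr (n + v) = (if v \<in> L then v + 1 else 0)) \<and> (n = 0 \<longrightarrow> tr 1 = 0)"

lemma tournament_node:
  assumes "tournament n d tr L" "1 \<le> i" "i < 2 * n"
  shows "tr i = 0 \<or> tr i - 1 \<in> L"
  using assms(2,3)
proof (induction "2 * n - i" arbitrary: i rule: less_induct)
  case less
  show ?case
  proof (cases "i < n")
    case False
    then obtain v where "i = n + v" "v < n" using less.prems by (metis add_less_cancel_left le_Suc_ex mult_2 not_less)
    then show ?thesis using assms(1) by (simp add: tournament_def)
  next
    case True
    then have "tr i = better d (tr (i + i)) (tr (i + i + 1))" using assms(1) less.prems by (simp add: tournament_def)
    moreover have "tr (i + i) = 0 \<or> tr (i + i) - 1 \<in> L" "tr (i + i + 1) = 0 \<or> tr (i + i + 1) - 1 \<in> L"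
      using less.hyps[of "i + i"] less.hyps[of "i + i + 1"] less.prems True by simp_all
    ultimately show ?thesis by (auto simp: better_def split: if_splits)
  qed
qed

text \<open>The nodes \<open>(n + v) div 2 ^ j\<close> are the ancestors of the leaf of
  \<open>v\<close>, and the bound is carried upwards from child to parent. The layout works for
  every \<open>n\<close>, not just for powers of two: an inner node \<open>i < n\<close> has its
  children below \<open>2 * n\<close>.\<close>

lemma tournament_le:
  assumes "tournament n d tr L" "v \<in> L" "v < n" "1 \<le> (n + v) div 2 ^ j"
  shows "tr ((n + v) div 2 ^ j) \<noteq> 0 \<and> d (tr ((n + v) div 2 ^ j) - 1) \<le> d v"
  using assms(4)
proof (induction j)
  case 0
  then show ?case using assms(1-3) by (simp add: tournament_def)
next
  case (Suc j)
  let ?c = "(n + v) div 2 ^ j" and ?i = "(n + v) div 2 ^ Suc j"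
  have i: "?i = ?c div 2" by (simp add: power_Suc2 div_mult2_eq del: power_Suc)
  have "x = x div 2 + x div 2 \<or> x = x div 2 + x div 2 + 1" for x :: nat by presburger
  then have c: "?c = ?i + ?i \<or> ?c = ?i + ?i + 1" unfolding i .
  have "?c \<le> n + v" by simp
  then have "?i < n" using i assms(3) by linarith
  then have "tr ?i = better d (tr (?i + ?i)) (tr (?i + ?i + 1))"
    using assms(1) Suc.prems by (simp add: tournament_def)
  moreover have "tr ?c \<noteq> 0 \<and> d (tr ?c - 1) \<le> d v" using Suc.IH Suc.prems i by linarith
  ultimately show ?case using c by (auto simp: better_def)
qed

lemma ex_div_power2: "1 \<le> x \<Longrightarrow> \<exists>j. (x::nat) div 2 ^ j = 1"
proof (induction x rule: less_induct)
  case (less x)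
  show ?case
  proof (cases "x = 1")
    case True
    then show ?thesis by (intro exI[of _ 0]) simp
  next
    case False
    then obtain j where "(x div 2) div 2 ^ j = 1" using less.IH[of "x div 2"] less.prems by force
    then show ?thesis by (intro exI[of _ "Suc j"]) (simp add: div_mult2_eq)
  qed
qed

lemma tournament_root:
  assumes "tournament n d tr L" "L \<subseteq> {..<n}"
  shows "tr 1 = 0 \<and> L = {} \<or> (\<exists>v\<in>L. tr 1 = v + 1 \<and> (\<forall>w\<in>L. d v \<le> d w))"
proof (cases "n = 0")
  case True
  then show ?thesis using assms by (auto simp: tournament_def)
next
  case False
  have le: "tr 1 \<noteq> 0 \<and> d (tr 1 - 1) \<le> d v" if "v \<in> L" for v
  proof -
    have "v < n" using that assms by auto
    moreover obtain j where "(n + v) div 2 ^ j = 1" using ex_div_power2[of "n + v"] False by auto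
    ultimately show ?thesis using tournament_le[OF assms(1) that, of j] by simp
  qed
  have "tr 1 = 0 \<or> tr 1 - 1 \<in> L" using tournament_node[OF assms(1), of 1] False by simp
  then show ?thesis using le by (cases "tr 1 = 0") force+
qed

text \<open>Stored winners belong to \<open>L\<close>, so keys outside \<open>L\<close> are never
  compared. This allows the labels in \<open>T\<close> to be lowered without touching the
  tree.\<close>

lemma tournament_cong:
  assumes "tournament n d tr L" "\<And>v. v \<in> L \<Longrightarrow> d' v = d v"
  shows "tournament n d' tr L"
proof -
  have "better d' (tr (i + i)) (tr (i + i + 1)) = better d (tr (i + i)) (tr (i + i + 1))" if "1 \<le> i" "i < n" for i
    using tournament_node[OF assms(1), of "i + i"] tournament_node[OF assms(1), of "i + i + 1"] assms(2) that
    by (auto simp: better_def)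
  then show ?thesis using assms(1) by (simp add: tournament_def)
qed

definition pull :: com where
  "pull =
     IAssign ''ta'' (IArr ''TR'' (IAdd (IVar ''h'') (IVar ''h'')));;
     IAssign ''tb'' (IArr ''TR'' (IAdd (IAdd (IVar ''h'') (IVar ''h'')) (INum 1)));;
     Cond (IEq (IVar ''ta'') (INum 0)) (IStore ''TR'' (IVar ''h'') (IVar ''tb''))
       (Cond (IEq (IVar ''tb'') (INum 0)) (IStore ''TR'' (IVar ''h'') (IVar ''ta''))
         (Cond (RLess (RArr ''D'' (ISub (IVar ''tb'') (INum 1))) (RArr ''D'' (ISub (IVar ''ta'') (INum 1))))
           (IStore ''TR'' (IVar ''h'') (IVar ''tb'')) (IStore ''TR'' (IVar ''h'') (IVar ''ta''))))"

text \<open>Letting \<open>h\<close> run downwards treats children before their parents. The first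
  store covers \<open>n = 0\<close>, where neither a leaf nor an inner node writes the root
  cell.\<close>

definition rebuild :: com where
  "rebuild =
     IStore ''TR'' (INum 1) (INum 0);;
     For ''y'' ''n'' (Cond (BAnd (IEq (IArr ''ST'' (IVar ''y'')) (INum 1)) (BNot (IEq (IArr ''X2'' (IVar ''y'')) (IVar ''c''))))
       (IStore ''TR'' (IAdd (IVar ''n'') (IVar ''y'')) (IAdd (IVar ''y'') (INum 1)))
       (IStore ''TR'' (IAdd (IVar ''n'') (IVar ''y'')) (INum 0)));;
     IAssign ''h'' (ISub (IVar ''n'') (INum 1));;
     While (ILess (INum 0) (IVar ''h'')) (pull;; IAssign ''h'' (ISub (IVar ''h'') (INum 1)))"

definition delete_leaf :: com where
  "delete_leaf =
     IStore ''TR'' (IAdd (IVar ''n'') (IVar ''v'')) (INum 0);;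
     IAssign ''h'' (IHalf (IAdd (IVar ''n'') (IVar ''v'')));;
     While (ILess (INum 0) (IVar ''h'')) (pull;; IAssign ''h'' (IHalf (IVar ''h'')))"

lemma mods_pull [simp]: "mods pull = {''ta'', ''tb'', ''TR''}"
  by (auto simp: pull_def)

lemma mods_rebuild [simp]: "mods rebuild = {''ta'', ''tb'', ''TR'', ''h'', ''y''}"
  by (auto simp: rebuild_def)

lemma mods_delete_leaf [simp]: "mods delete_leaf = {''ta'', ''tb'', ''TR'', ''h''}"
  by (auto simp: delete_leaf_def)

context machine
begin

lemma wpt_pull:
  assumes "\<And>t s'. iarr s' ''TR'' = (iarr s ''TR'')(ivar s ''h'' := better (rarr s ''D'')
        (iarr s ''TR'' (ivar s ''h'' + ivar s ''h'')) (iarr s ''TR'' (ivar s ''h'' + ivar s ''h'' + 1))) \<Longrightarrow>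
      agree {''ta'', ''tb'', ''TR''} s s' \<Longrightarrow> t \<le> 45 \<Longrightarrow> Q t s'"
  shows "wpt pull s Q"
proof -
  have "wpt pull s (\<lambda>t s'. iarr s' ''TR'' = (iarr s ''TR'')(ivar s ''h'' := better (rarr s ''D'')
        (iarr s ''TR'' (ivar s ''h'' + ivar s ''h'')) (iarr s ''TR'' (ivar s ''h'' + ivar s ''h'' + 1))) \<and> t \<le> 45)"
    by (simp add: pull_def better_def)
  then show ?thesis by (rule wpt_mono_agree) (use assms in simp)
qed

lemma wpt_rebuild:
  assumes n: "ivar s ''n'' = n"
    and post: "\<And>t s'. tournament n (rarr s ''D'') (iarr s' ''TR'')
        {v. v < n \<and> iarr s ''ST'' v = 1 \<and> iarr s ''X2'' v \<noteq> ivar s ''c''} \<Longrightarrow>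
      agree (mods rebuild) s s' \<Longrightarrow> t \<le> 100 * real (n + 1) \<Longrightarrow> Q t s'"
  shows "wpt rebuild s Q"
proof -
  define L where "L = {v. v < n \<and> iarr s ''ST'' v = 1 \<and> iarr s ''X2'' v \<noteq> ivar s ''c''}"
  let ?leaf = "\<lambda>m s'. \<forall>v<m. iarr s' ''TR'' (n + v) = (if v \<in> L then v + 1 else 0)"
  define ok where "ok = (\<lambda>(tr :: nat \<Rightarrow> nat) i. tr i = better (rarr s ''D'') (tr (i + i)) (tr (i + i + 1)))"
  have tn: "tournament n (rarr s ''D'') tr L \<longleftrightarrow> (\<forall>i. 1 \<le> i \<and> i < n \<longrightarrow> ok tr i) \<and>
     (\<forall>v<n. tr (n + v) = (if v \<in> L then v + 1 else 0)) \<and> (n = 0 \<longrightarrow> tr 1 = 0)" for tr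
    unfolding tournament_def ok_def ..
  have "wpt rebuild s (\<lambda>t s'. tournament n (rarr s ''D'') (iarr s' ''TR'') L \<and> t \<le> 100 * (n + 1))"
    unfolding rebuild_def wpt_Seq wpt_IStore wpt_IAssign
  proof (rule wpt_For[where Inv = "\<lambda>m s'. (n = 0 \<longrightarrow> iarr s' ''TR'' 1 = 0) \<and> ?leaf m s'" and T = "\<lambda>_. 18"], goal_cases)
    case (5 i s')
    note ag = agreeD[OF 5(4)]
    have i: "i < n" "ivar s' ''n'' = n" "iarr s' ''ST'' = iarr s ''ST''" "iarr s' ''X2'' = iarr s ''X2''" "ivar s' ''c'' = ivar s ''c''"
      using 5(1) n ag by auto
    have "i \<in> L \<longleftrightarrow> iarr s ''ST'' i = Suc 0 \<and> iarr s ''X2'' i \<noteq> ivar s ''c''" using i by (simp add: L_def)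
    then show ?case using 5(2,3) i by (auto simp: less_Suc_eq)
  next
    case (7 t1 s1)
    note ag = agreeD[OF 7(2)]
    have s1: "ivar s1 ''n'' = n" "rarr s1 ''D'' = rarr s ''D''" "?leaf n s1" "n = 0 \<longrightarrow> iarr s1 ''TR'' 1 = 0"
      using 7(1) n ag by simp_all
    have t1: "t1 \<le> 6 + 26 * real n" using 7(3) n by simp
    let ?s1 = "s1\<lparr>ivar := (ivar s1)(''h'' := ival (ISub (IVar ''n'') (INum 1)) s1)\<rparr>"
    let ?I = "\<lambda>s'. (n = 0 \<longrightarrow> iarr s' ''TR'' 1 = 0) \<and> ?leaf n s' \<and> ivar s' ''h'' \<le> n - 1 \<and>
       (\<forall>i. ivar s' ''h'' < i \<and> i < n \<longrightarrow> ok (iarr s' ''TR'') i)"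
    show ?case
    proof (rule wpt_While[where Inv = ?I and \<Phi> = "\<lambda>s'. 60 * real (ivar s' ''h'')"], goal_cases)
      case 1
      then show ?case using s1 by auto
    next
      case (2 s2)
      note ag = agreeD[OF 2(2)]
      have s2: "rarr s2 ''D'' = rarr s ''D''" using s1 ag by simp
      have h: "0 < ivar s2 ''h''" using 2(3) by simp
      show ?case
        unfolding wpt_Seq wpt_IAssign
      proof (rule wpt_pull, goal_cases)
        case (1 t s3)
        then have h3: "ivar s3 ''h'' = ivar s2 ''h''" using agreeD[OF 1(2)] by simp
        have "?leaf n s3" using 2(1) 1(1) h by auto
        moreover have "ivar s2 ''h'' - 1 < i \<Longrightarrow> i < n \<Longrightarrow>
            ok (iarr s3 ''TR'') i" for i
        proof (cases "i = ivar s2 ''h''")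
          case True
          then show ?thesis using 1(1) h s2 by (simp add: ok_def)
        next
          case False
          then have "ivar s2 ''h'' < i" if "ivar s2 ''h'' - 1 < i" using that by simp
          moreover have "i < n \<Longrightarrow> ivar s2 ''h'' < i \<Longrightarrow> ok (iarr s2 ''TR'') i" using 2(1) by blast
          ultimately show "ivar s2 ''h'' - 1 < i \<Longrightarrow> i < n \<Longrightarrow> ok (iarr s3 ''TR'') i"
            using 1(1) by (simp add: ok_def)
        qed
        ultimately show ?case using 2(1) 1(1,3) h h3 by (auto simp: of_nat_diff)
      qed
    next
      case (4 t2 s2)
      have "ivar s2 ''h'' = 0" using 4(3) by simp
      then have "tournament n (rarr s ''D'') (iarr s2 ''TR'') L" using 4(1) by (auto simp: tn)
      moreover have "real (n - 1) \<le> real n" by simp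
      then have "t2 \<le> 60 * n + 4" using 4(4) s1 by simp
      ultimately show ?case using t1 by simp
    qed auto
  qed (use n in auto)
  then show ?thesis by (rule wpt_mono_agree) (use post in \<open>auto simp: L_def\<close>)
qed

text \<open>Only the current node \<open>h\<close> and its ancestors may violate their equations,
  and moving from \<open>h\<close> to its parent after a \<open>pull\<close> preserves this. The
  potential \<open>60 * (1 + log 2 h)\<close> falls by at least 60 when \<open>h\<close> is halved,
  while a \<open>pull\<close> costs at most 45.\<close>

lemma wpt_delete_leaf:
  assumes n: "ivar s ''n'' = n" and v: "ivar s ''v'' < n"
    and tr: "tournament n (rarr s ''D'') (iarr s ''TR'') L"
    and post: "\<And>t s'. tournament n (rarr s ''D'') (iarr s' ''TR'') (L - {ivar s ''v''}) \<Longrightarrow>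
      agree (mods delete_leaf) s s' \<Longrightarrow> t \<le> 140 * max 1 (log 2 n) \<Longrightarrow> Q t s'"
  shows "wpt delete_leaf s Q"
proof -
  let ?v = "ivar s ''v''" and ?d = "rarr s ''D''"
  let ?ok = "\<lambda>s' i. iarr s' ''TR'' i = better ?d (iarr s' ''TR'' (i + i)) (iarr s' ''TR'' (i + i + 1))"
  let ?I = "\<lambda>s'. (\<forall>w<n. iarr s' ''TR'' (n + w) = (if w \<in> L - {?v} then w + 1 else 0)) \<and> ivar s' ''h'' < n \<and>
     (\<forall>i. 1 \<le> i \<and> i < n \<longrightarrow> ?ok s' i \<or> (\<exists>j. i = ivar s' ''h'' div 2 ^ j))"
  let ?\<Phi> = "\<lambda>s'. if ivar s' ''h'' = 0 then 0 else 60 * (1 + log 2 (ivar s' ''h''))"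
  have "wpt delete_leaf s (\<lambda>t s'. tournament n ?d (iarr s' ''TR'') (L - {?v}) \<and> t \<le> 140 * max 1 (log 2 n))"
    unfolding delete_leaf_def wpt_Seq wpt_IStore wpt_IAssign
  proof (rule wpt_While[where Inv = ?I and \<Phi> = ?\<Phi>], goal_cases)
    case 1
    let ?tr = "(iarr s ''TR'')(n + ?v := 0)"
    have "?tr i = better ?d (?tr (i + i)) (?tr (i + i + 1)) \<or> (\<exists>j. i = (n + ?v) div 2 div 2 ^ j)"
      if i: "1 \<le> i" "i < n" for i
    proof (cases "i + i = n + ?v \<or> i + i + 1 = n + ?v")
      case True
      then have "i = (n + ?v) div 2 div 2 ^ 0" by auto
      then show ?thesis by blast
    next
      case False
      moreover have "iarr s ''TR'' i = better ?d (iarr s ''TR'' (i + i)) (iarr s ''TR'' (i + i + 1))"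
        using tr i by (simp add: tournament_def)
      ultimately show ?thesis using i by simp
    qed
    moreover have "\<forall>w<n. ?tr (n + w) = (if w \<in> L - {?v} then w + 1 else 0)"
      using tr by (simp add: tournament_def)
    moreover have "(n + ?v) div 2 < n" using v by auto
    ultimately show ?case using n by simp
  next
    case (2 s2)
    note ag = agreeD[OF 2(2)]
    have s2: "rarr s2 ''D'' = ?d" using ag by simp
    have h: "0 < ivar s2 ''h''" using 2(3) by simp
    show ?case
      unfolding wpt_Seq wpt_IAssign
    proof (rule wpt_pull, goal_cases)
      case (1 t s3)
      let ?h = "ivar s2 ''h''"
      have h3: "ivar s3 ''h'' = ?h" using agreeD[OF 1(2)] by simp
      have a: "\<forall>w<n. iarr s3 ''TR'' (n + w) = (if w \<in> L - {?v} then w + 1 else 0)"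
        using 2(1) 1(1) by auto
      have b: "?ok s3 i \<or> (\<exists>j. i = ?h div 2 div 2 ^ j)" if i: "1 \<le> i" "i < n" for i
      proof (cases "?ok s2 i")
        case True
        show ?thesis
        \<comment> \<open>An intact equation at another node is disturbed only if it reads cell
          \<open>?h\<close>, that is at the parent of \<open>?h\<close>, which is repaired
          next.\<close>
        proof (cases "i = ?h \<or> i + i = ?h \<or> i + i + 1 = ?h")
          case True
          then consider "i = ?h" | "i = ?h div 2 div 2 ^ 0" by force
          then show ?thesis
          proof cases
            case 1
            with \<open>?ok s2 i\<close> show ?thesis using h \<open>iarr s3 ''TR'' = _\<close> s2 by auto
          qed blast
        next
          case False
          with True show ?thesis using 1(1) by auto
        qed
      next
        case False
        then obtain j where j: "i = ?h div 2 ^ j" using 2(1) i by blast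
        show ?thesis
        proof (cases j)
          case 0
          then show ?thesis using j h 1(1) s2 by auto
        next
          case (Suc j')
          then show ?thesis using j by (auto simp: div_mult2_eq)
        qed
      qed
      have "0 \<le> log 2 ?h" using h by simp
      then have c1: "t \<le> 53 + 60 * log 2 ?h" using 1(3) by linarith
      have c2: "1 + log 2 (?h div 2) \<le> log 2 ?h" if "?h div 2 \<noteq> 0"
      proof -
        have "real (?h div 2) \<le> real ?h / 2" "0 < real (?h div 2)" using that by linarith+
        then have "log 2 (real (?h div 2)) \<le> log 2 (real ?h / 2)" by simp
        also have "\<dots> = log 2 (real ?h) - 1" using h by (simp add: log_divide)
        finally show ?thesis by simp
      qed
      have hn: "?h div 2 < n" using 2(1) by linarith
      show ?case using a b h3 hn
        by (simp only: ival.simps state.simps state.update_convs fun_upd_same) (use c1 c2 h 1(3) in auto)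
    qed
  next
    case (3 s')
    then show ?case by (auto intro!: add_nonneg_nonneg)
  next
    case (4 t2 s2)
    have "ivar s2 ''h'' = 0" using 4(3) by simp
    then have tn: "tournament n ?d (iarr s2 ''TR'') (L - {?v})" using 4(1) v by (auto simp: tournament_def)
    let ?h = "(n + ?v) div 2"
    have "?h \<le> n" using v by linarith
    then have "?h \<noteq> 0 \<Longrightarrow> log 2 ?h \<le> log 2 n" by simp
    then have "t2 \<le> 60 * (1 + max 1 (log 2 n)) + 4" using 4(4) \<open>ivar s2 ''h'' = 0\<close> n by (auto split: if_splits)
    then show ?case using tn n by simp
  qed
  then show ?thesis by (rule wpt_mono_agree) (use post in auto)
qed

end

section \<open>Successive augmentation\<close>

text \<open>
  With \<open>c = 1\<close> the second set is used itself, with \<open>c = 0\<close> it is represented by its complement;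
  the latter turns an upper bound on the intersection into a lower bound.
\<close>

definition side :: "nat \<Rightarrow> nat \<Rightarrow> nat set \<Rightarrow> nat set" where
  "side n c T = (if c = 1 then T else {..<n} - T)"

definition side_dom :: "nat \<Rightarrow> nat \<Rightarrow> nat set set \<Rightarrow> nat set set" where
  "side_dom n c E = {T. T \<subseteq> {..<n} \<and> side n c T \<in> E}"

definition side_fun :: "nat \<Rightarrow> nat \<Rightarrow> (nat set \<Rightarrow> real) \<Rightarrow> nat set \<Rightarrow> real" where
  "side_fun n c g = (\<lambda>T. g (side n c T))"

lemma toggle_side: "u < n \<Longrightarrow> toggle u (side n c T) = side n c (toggle u T)"
  by (auto simp: side_def toggle_def)

text \<open>The reason for comparing cells of \<open>X2\<close> with \<open>c\<close> instead of
  with 1: the same test decides membership in \<open>T\<close> in both representations.\<close>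

lemma bits_side: "bits n a (side n c T) \<Longrightarrow> c \<le> 1 \<Longrightarrow> v < n \<Longrightarrow> a v = c \<longleftrightarrow> v \<in> T"
  by (auto simp: bits_def side_def)

text \<open>The negated conjunction expresses a disjunction: unreached, or strictly improved. With a
  non-strict test a later node could displace the earliest parent, and the exchanges on the path
  could cross.\<close>

definition relax :: "nat \<Rightarrow> vname \<Rightarrow> com" where
  "relax t w =
     IfT (IEq (IVar ''qf'') (INum 1))
      (RAssign ''nd'' (RAdd (RArr ''D'' (IVar ''v'')) (RSub (RAdd (RSub (RVar ''qv'') (RVar w)) (RArr ''P'' (IVar ''v''))) (RArr ''P'' (IVar ''j''))));;
       IfT (BNot (BAnd (BNot (IEq (IArr ''ST'' (IVar ''j'')) (INum 0))) (BNot (RLess (RVar ''nd'') (RArr ''D'' (IVar ''j''))))))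
        (IStore ''ST'' (IVar ''j'') (INum 1);; RStore ''D'' (IVar ''j'') (RVar ''nd'');;
         IStore ''PA'' (IVar ''j'') (IVar ''v'');; IStore ''PT'' (IVar ''j'') (INum t)))"

definition scan1 :: com where
  "scan1 = For ''j'' ''n'' (IfT (BAnd (IEq (IArr ''X1'' (IVar ''j'')) (INum 0)) (BNot (IEq (IArr ''ST'' (IVar ''j'')) (INum 2))))
     (query_swap Omega1 ''X1'' ''v'' ''j'';; relax 1 ''w1''))"

definition scan2 :: com where
  "scan2 = For ''y'' ''nl'' (IAssign ''j'' (IArr ''L'' (IVar ''y''));;
     IfT (BNot (IEq (IArr ''ST'' (IVar ''j'')) (INum 2)))
       (query_swap Omega2 ''X2'' ''v'' ''j'';; relax 2 ''w2''))"

text \<open>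
  The candidates outside \<open>T\<close> are represented by the root of the tournament tree, and the at most \<open>r\<close>
  candidates in \<open>T\<close> are listed in \<open>L\<close>.
\<close>

definition select :: com where
  "select = IAssign ''b'' (IArr ''TR'' (INum 1));;
     For ''y'' ''nl'' (IAssign ''j'' (IArr ''L'' (IVar ''y''));;
       IfT (IEq (IArr ''ST'' (IVar ''j'')) (INum 1))
         (Cond (IEq (IVar ''b'') (INum 0)) (IAssign ''b'' (IAdd (IVar ''j'') (INum 1)))
           (IfT (RLess (RArr ''D'' (IVar ''j'')) (RArr ''D'' (ISub (IVar ''b'') (INum 1))))
             (IAssign ''b'' (IAdd (IVar ''j'') (INum 1))))))"

definition expand :: com where
  "expand = Cond (IEq (IArr ''X1'' (IVar ''v'')) (INum 1)) (scan1;; rebuild) delete_leaf;;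
     IfT (BNot (IEq (IArr ''X2'' (IVar ''v'')) (IVar ''c''))) scan2"

definition settle :: com where
  "settle = IAssign ''v'' (ISub (IVar ''b'') (INum 1));; IStore ''ST'' (IVar ''v'') (INum 2);;
     Cond (IEq (IArr ''SK'' (IVar ''v'')) (INum 1)) (IAssign ''go'' (INum 2)) expand"

text \<open>\<open>go\<close> is 1 while the search runs, 2 once a sink is settled, and 0 when no
  labelled node is left.\<close>

definition search_loop :: com where
  "search_loop = While (IEq (IVar ''go'') (INum 1))
     (select;; Cond (IEq (IVar ''b'') (INum 0)) (IAssign ''go'' (INum 0)) settle)"

lemma mods_relax [simp]: "mods (relax t w) = {''nd'', ''ST'', ''D'', ''PA'', ''PT''}"
  by (auto simp: relax_def)

lemma mods_scan1 [simp]: "mods scan1 = {''nd'', ''ST'', ''D'', ''PA'', ''PT'', ''X1'', ''qf'', ''qv'', ''j''}"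
  by (auto simp: scan1_def)

lemma mods_scan2 [simp]: "mods scan2 = {''nd'', ''ST'', ''D'', ''PA'', ''PT'', ''X2'', ''qf'', ''qv'', ''j'', ''y''}"
  by (auto simp: scan2_def)

lemma mods_select [simp]: "mods select = {''b'', ''j'', ''y''}"
  by (auto simp: select_def)

section \<open>One search: the program as an implementation of the abstract label-setting
  search\<close>

locale solver = machine +
  fixes c :: nat
  assumes c: "c \<le> 1" and vm: "vm (D w) (f w)"
    and card_eq: "S \<in> D w \<Longrightarrow> S' \<in> D w \<Longrightarrow> card S = card S'"

locale search = solver n \<gamma> D f \<Omega> c +
  exchange_graph n "D Omega1" "f Omega1" "side_dom n c (D Omega2)" "side_fun n c (f Omega2)" X T src snk p lam
  for n \<gamma> D f \<Omega> c X T src snk p lam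
begin

definition enc :: "state \<Rightarrow> bool" where
  "enc s \<longleftrightarrow> ivar s ''n'' = n \<and> ivar s ''c'' = c \<and> bits n (iarr s ''X1'') X \<and> bits n (iarr s ''X2'') (side n c T) \<and>
     bits n (iarr s ''SR'') src \<and> bits n (iarr s ''SK'') snk \<and> (\<forall>v<n. rarr s ''P'' v = p v)"

text \<open>The list \<open>L\<close> has \<open>card T\<close> cells and reaches all of
  \<open>T\<close>, hence contains no repetition, and running through it costs \<open>card T\<close>
  queries.\<close>

definition enc' :: "state \<Rightarrow> bool" where
  "enc' s \<longleftrightarrow> enc s \<and> rvar s ''w1'' = f Omega1 X \<and> rvar s ''w2'' = side_fun n c (f Omega2) T \<and>
     ivar s ''nl'' = card T \<and> (\<forall>y<card T. iarr s ''L'' y \<in> T) \<and> (\<forall>w\<in>T. \<exists>y<card T. iarr s ''L'' y = w)"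

lemma enc'_cong:
  assumes "enc' s" "ivar s' ''n'' = ivar s ''n''" "ivar s' ''c'' = ivar s ''c''" "iarr s' ''X1'' = iarr s ''X1''"
    "iarr s' ''X2'' = iarr s ''X2''" "iarr s' ''SR'' = iarr s ''SR''" "iarr s' ''SK'' = iarr s ''SK''"
    "rarr s' ''P'' = rarr s ''P''" "rvar s' ''w1'' = rvar s ''w1''" "rvar s' ''w2'' = rvar s ''w2''"
    "ivar s' ''nl'' = ivar s ''nl''" "iarr s' ''L'' = iarr s ''L''"
  shows "enc' s'"
  using assms unfolding enc'_def enc_def by simp

definition dst :: "(nat \<Rightarrow> nat \<Rightarrow> nat \<Rightarrow> bool) \<Rightarrow> (nat \<Rightarrow> nat) \<Rightarrow> nat \<Rightarrow> state \<Rightarrow> bool" where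
  "dst R \<tau> m s = search_inv R (iarr s ''ST'') (rarr s ''D'') (iarr s ''PA'') (iarr s ''PT'') \<tau> m"

text \<open>The settled set is frozen as \<open>S\<close>, since a scan changes labels but settles
  nothing. That \<open>v\<close> carries the largest settled label is what
  \<open>search_inv_keep\<close> and \<open>search_inv_update\<close> ask for.\<close>

definition scanning ::
  "(nat \<Rightarrow> nat \<Rightarrow> nat \<Rightarrow> bool) \<Rightarrow> (nat \<Rightarrow> nat) \<Rightarrow> nat \<Rightarrow> nat \<Rightarrow> nat set \<Rightarrow> state \<Rightarrow> bool"
where
  "scanning R \<tau> m v S s \<longleftrightarrow> enc' s \<and> ivar s ''v'' = v \<and> v < n \<and> v \<in> S \<and> dst R \<tau> m s \<and>
     (\<forall>u<n. iarr s ''ST'' u = 2 \<longrightarrow> rarr s ''D'' u \<le> rarr s ''D'' v) \<and> (\<forall>u<n. iarr s ''ST'' u = 2 \<longleftrightarrow> u \<in> S)"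

lemma scanning_mono:
  assumes "scanning R \<tau> m v S s" "\<And>t u w. R' t u w \<Longrightarrow> arc t u w \<Longrightarrow> R t u w"
  shows "scanning R' \<tau> m v S s"
proof -
  have "dst R' \<tau> m s"
    unfolding dst_def by (rule search_inv_mono[where R = R]) (use assms in \<open>auto simp: scanning_def dst_def\<close>)
  with assms(1) show ?thesis by (simp add: scanning_def)
qed

lemma wpt_relax:
  assumes s: "scanning R \<tau> m v S s" and j: "ivar s ''j'' = j" "j < n" "j \<notin> S"
    and qf: "ivar s ''qf'' = 1 \<longleftrightarrow> arc ty v j"
    and qv: "ivar s ''qf'' = 1 \<Longrightarrow> rvar s ''qv'' - rvar s w + p v - p j = red_cost ty v j"
    and R: "\<And>t' u' w'. u' \<noteq> v \<Longrightarrow> R t' u' w'"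
    and R': "\<And>t' u' w'. R' t' u' w' \<Longrightarrow> R t' u' w' \<or> (t' = ty \<and> u' = v \<and> w' = j)"
    and w: "w \<noteq> ''nd''"
    and post: "\<And>t s'. scanning R' \<tau> m v S s' \<Longrightarrow> t \<le> 60 \<Longrightarrow> agree (mods (relax ty w)) s s' \<Longrightarrow>
      (\<And>u. u \<noteq> j \<Longrightarrow> iarr s' ''ST'' u = iarr s ''ST'' u \<and> rarr s' ''D'' u = rarr s ''D'' u) \<Longrightarrow> Q t s'"
  shows "wpt (relax ty w) s Q"
proof -
  have d: "search_inv R (iarr s ''ST'') (rarr s ''D'') (iarr s ''PA'') (iarr s ''PT'') \<tau> m"
    and v: "ivar s ''v'' = v" "v < n" "iarr s ''ST'' v = 2" and e: "enc' s"
    and lab: "\<And>u. u < n \<Longrightarrow> iarr s ''ST'' u = 2 \<Longrightarrow> rarr s ''D'' u \<le> rarr s ''D'' v"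
    and S: "\<forall>u<n. iarr s ''ST'' u = 2 \<longleftrightarrow> u \<in> S" "v \<in> S"
    using s by (auto simp: scanning_def dst_def)
  have P: "rarr s ''P'' v = p v" "rarr s ''P'' j = p j" using e v j by (auto simp: enc'_def enc_def)
  have stj: "iarr s ''ST'' j \<noteq> 2" and vj: "v \<noteq> j" using S j by auto
  have "wpt (relax ty w) s (\<lambda>t s'. scanning R' \<tau> m v S s' \<and> t \<le> 60 \<and>
     (\<forall>u. u \<noteq> j \<longrightarrow> iarr s' ''ST'' u = iarr s ''ST'' u \<and> rarr s' ''D'' u = rarr s ''D'' u))"
  proof (cases "arc ty v j")
    case False
    have "scanning R' \<tau> m v S s" using s search_inv_no_arc[OF d False R'] by (simp add: scanning_def dst_def)
    then show ?thesis using False qf by (simp add: relax_def)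
  next
    case True
    then have q: "ivar s ''qf'' = 1" using qf by simp
    have nd: "rarr s ''D'' v + (rvar s ''qv'' - rvar s w + p v - p j) = rarr s ''D'' v + red_cost ty v j" using qv[OF q] by simp
    show ?thesis
    proof (cases "iarr s ''ST'' j = 0 \<or> rarr s ''D'' v + red_cost ty v j < rarr s ''D'' j")
      case False
      have "search_inv R' (iarr s ''ST'') (rarr s ''D'') (iarr s ''PA'') (iarr s ''PT'') \<tau> m"
        by (rule search_inv_keep[OF d v(2,3) j(2) lab _ R']) (use False in auto)
      moreover have "enc' (s\<lparr>rvar := (rvar s)(''nd'' := rarr s ''D'' v + red_cost ty v j)\<rparr>)"
        by (rule enc'_cong[OF e]) simp_all
      ultimately show ?thesis using False q v(1) j(1) P nd w s
        by (simp add: relax_def scanning_def dst_def)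
    next
      case True
      note upd = this
      let ?D = "(rarr s ''D'')(j := rarr s ''D'' v + red_cost ty v j)" and ?ST = "(iarr s ''ST'')(j := 1)"
      let ?s = "s\<lparr>rvar := (rvar s)(''nd'' := rarr s ''D'' v + red_cost ty v j),
        iarr := (iarr s)(''ST'' := ?ST, ''PA'' := (iarr s ''PA'')(j := v), ''PT'' := (iarr s ''PT'')(j := ty)),
        rarr := (rarr s)(''D'' := ?D)\<rparr>"
      have "search_inv R' ?ST ?D ((iarr s ''PA'')(j := v)) ((iarr s ''PT'')(j := ty)) \<tau> m"
        by (rule search_inv_update[OF d v(2,3) j(2) stj \<open>arc ty v j\<close> lab True R R'])
      moreover have "enc' ?s"
        by (rule enc'_cong[OF e]) simp_all
      moreover have "\<forall>u<n. ?ST u = 2 \<longrightarrow> ?D u \<le> ?D v" using lab vj by auto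
      moreover have "\<forall>u<n. ?ST u = 2 \<longleftrightarrow> u \<in> S" using S j by auto
      ultimately have "scanning R' \<tau> m v S ?s" using v S by (simp add: scanning_def dst_def)
      moreover have "wpt (relax ty w) s (\<lambda>t s'. s' = ?s \<and> t \<le> 60)"
        using upd q v(1) j(1) P nd w by (simp add: relax_def)
      ultimately show ?thesis by (elim wpt_mono) simp
    qed
  qed
  then show ?thesis by (rule wpt_mono_agree) (use post in simp)
qed

lemma wpt_step1:
  assumes s: "scanning R \<tau> m v S s" and j: "ivar s ''j'' = j" "j < n" "j \<notin> S" and X1: "v \<in> X" "j \<notin> X"
    and R: "\<And>t' u' w'. u' \<noteq> v \<Longrightarrow> R t' u' w'"
    and R': "\<And>t' u' w'. R' t' u' w' \<Longrightarrow> R t' u' w' \<or> (t' = 1 \<and> u' = v \<and> w' = j)"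
  shows "wpt (query_swap Omega1 ''X1'' ''v'' ''j'';; relax 1 ''w1'') s
    (\<lambda>t s'. scanning R' \<tau> m v S s' \<and> t \<le> 100 * G)"
proof -
  have e: "enc' s" and v: "ivar s ''v'' = v" "v < n" using s by (auto simp: scanning_def)
  have bx: "bits n (iarr s ''X1'') X" "rvar s ''w1'' = f Omega1 X" using e by (auto simp: enc'_def enc_def)
  let ?X = "insert j (X - {v})"
  let ?s1 = "s\<lparr>ivar := (ivar s)(''qf'' := 1), rvar := (rvar s)(''qv'' := f Omega1 ?X)\<rparr>"
  let ?s0 = "s\<lparr>ivar := (ivar s)(''qf'' := 0)\<rparr>"
  have a: "arc 1 v j \<longleftrightarrow> ?X \<in> D Omega1" using X1 j by (simp add: arc_def)
  have tg: "?X = toggle (ivar s ''j'') (toggle (ivar s ''v'') X)" using toggle_swap X1 j v by fastforce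
  have "enc' ?s1" by (rule enc'_cong[OF e]) simp_all
  then have s1: "scanning R \<tau> m v S ?s1" using s by (simp add: scanning_def dst_def)
  have "enc' ?s0" by (rule enc'_cong[OF e]) simp_all
  then have s0: "scanning R \<tau> m v S ?s0" using s by (simp add: scanning_def dst_def)
  let ?Q = "\<lambda>t s'. scanning R' \<tau> m v S s' \<and> 25 + \<gamma> + t \<le> 100 * G"
  have "wpt (relax 1 ''w1'') ?s1 ?Q" if "?X \<in> D Omega1"
    by (rule wpt_relax[where j = j, OF s1 _ j(2,3) _ _ R R']) (use j a bx that \<gamma> in \<open>auto simp: red_cost_def G_def\<close>)
  moreover have "wpt (relax 1 ''w1'') ?s0 ?Q" if "?X \<notin> D Omega1"
    by (rule wpt_relax[where j = j, OF s0 _ j(2,3) _ _ R R']) (use j a bx that \<gamma> in \<open>auto simp: red_cost_def G_def\<close>)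
  ultimately show ?thesis
    using v j by (simp add: wpt_query_swap[OF bx(1) _ _ _ _ tg] del: One_nat_def)
qed

text \<open>Unlike in \<open>wpt_step1\<close>, it is recorded that label and status change at
  \<open>j\<close> only. As \<open>j\<close> is in \<open>T\<close>, the tournament tree for the
  labels outside \<open>T\<close> stays valid.\<close>

lemma wpt_step2:
  assumes s: "scanning R \<tau> m v S s" and j: "ivar s ''j'' = j" "j < n" "j \<notin> S" and X1: "v \<notin> T" "j \<in> T"
    and R: "\<And>t' u' w'. u' \<noteq> v \<Longrightarrow> R t' u' w'"
    and R': "\<And>t' u' w'. R' t' u' w' \<Longrightarrow> R t' u' w' \<or> (t' = 2 \<and> u' = v \<and> w' = j)"
  shows "wpt (query_swap Omega2 ''X2'' ''v'' ''j'';; relax 2 ''w2'') s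
    (\<lambda>t s'. scanning R' \<tau> m v S s' \<and> t \<le> 100 * G \<and>
       (\<forall>u. u \<noteq> j \<longrightarrow> iarr s' ''ST'' u = iarr s ''ST'' u \<and> rarr s' ''D'' u = rarr s ''D'' u))"
proof -
  have e: "enc' s" and v: "ivar s ''v'' = v" "v < n" using s by (auto simp: scanning_def)
  have bx: "bits n (iarr s ''X2'') (side n c T)" "rvar s ''w2'' = side_fun n c (f Omega2) T"
    using e by (auto simp: enc'_def enc_def)
  let ?T = "insert v (T - {j})"
  let ?X = "side n c ?T"
  let ?s1 = "s\<lparr>ivar := (ivar s)(''qf'' := 1), rvar := (rvar s)(''qv'' := f Omega2 ?X)\<rparr>"
  let ?s0 = "s\<lparr>ivar := (ivar s)(''qf'' := 0)\<rparr>"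
  have Tn: "?T \<subseteq> {..<n}" using T v by auto
  have a: "arc 2 v j \<longleftrightarrow> ?X \<in> D Omega2" unfolding arc_def using X1 v Tn by (simp add: side_dom_def)
  have "?T = toggle j (toggle v T)" using toggle_swap2 X1 by fastforce
  then have tg: "?X = toggle (ivar s ''j'') (toggle (ivar s ''v'') (side n c T))" using toggle_side v j by simp
  have "enc' ?s1" by (rule enc'_cong[OF e]) simp_all
  then have s1: "scanning R \<tau> m v S ?s1" using s by (simp add: scanning_def dst_def)
  have "enc' ?s0" by (rule enc'_cong[OF e]) simp_all
  then have s0: "scanning R \<tau> m v S ?s0" using s by (simp add: scanning_def dst_def)
  have ccv: "red_cost 2 v j = f Omega2 ?X - side_fun n c (f Omega2) T + p v - p j"
    unfolding red_cost_def by (simp add: side_fun_def)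
  let ?Q = "\<lambda>t s'. scanning R' \<tau> m v S s' \<and> 25 + \<gamma> + t \<le> 100 * G \<and>
       (\<forall>u. u \<noteq> j \<longrightarrow> iarr s' ''ST'' u = iarr s ''ST'' u \<and> rarr s' ''D'' u = rarr s ''D'' u)"
  have "wpt (relax 2 ''w2'') ?s1 ?Q" if "?X \<in> D Omega2"
    by (rule wpt_relax[where j = j, OF s1 _ j(2,3) _ _ R R'])
      (use j a bx that \<gamma> ccv in \<open>auto simp: G_def\<close>)
  moreover have "wpt (relax 2 ''w2'') ?s0 ?Q" if "?X \<notin> D Omega2"
    by (rule wpt_relax[where j = j, OF s0 _ j(2,3) _ _ R R']) (use j a bx that \<gamma> in \<open>auto simp: red_cost_def G_def\<close>)
  ultimately show ?thesis
    using v j by (simp add: wpt_query_swap[OF bx(1) _ _ _ _ tg] del: One_nat_def)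
qed

lemma wpt_scan1:
  assumes s: "scanning (\<lambda>t u w. u \<noteq> v) \<tau> m v S s" and v: "v \<in> X"
    and post: "\<And>t s'. scanning (\<lambda>t u w. u \<noteq> v \<or> t = 1) \<tau> m v S s' \<Longrightarrow> t \<le> 150 * G * (n + 1) \<Longrightarrow>
       agree (mods scan1) s s' \<Longrightarrow> Q t s'"
  shows "wpt scan1 s Q"
proof -
  have nn: "ivar s ''n'' = n" using s by (simp add: scanning_def enc'_def enc_def)
  let ?R = "\<lambda>i t u w. u \<noteq> v \<or> t = 1 \<and> w < i"
  have "wpt scan1 s (\<lambda>t s'. scanning (\<lambda>t u w. u \<noteq> v \<or> t = 1) \<tau> m v S s' \<and> t \<le> 150 * G * (n + 1))"
    unfolding scan1_def
  proof (rule wpt_For[where Inv = "\<lambda>i s'. scanning (?R i) \<tau> m v S s'" and T = "\<lambda>_. 120 * G"], goal_cases)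
    case 1
    have "enc' (s\<lparr>ivar := (ivar s)(''j'' := 0)\<rparr>)" by (rule enc'_cong) (use s in \<open>simp_all add: scanning_def\<close>)
    then show ?case using s by (simp add: scanning_def dst_def)
  next
    case (5 j s')
    have j: "j < n" "ivar s' ''j'' = j" using 5(1,3) nn by auto
    have e: "enc' s'" and st: "iarr s' ''ST'' j = 2 \<longleftrightarrow> j \<in> S" using 5(2) j by (auto simp: scanning_def)
    have bx: "iarr s' ''X1'' j = (if j \<in> X then 1 else 0)"
      using e j by (auto simp: enc'_def enc_def bits_iff)
    have upd: "scanning R \<tau> m v S (s2\<lparr>ivar := (ivar s2)(''j'' := Suc j)\<rparr>)" if "scanning R \<tau> m v S s2" for R s2
    proof -
      have "enc' (s2\<lparr>ivar := (ivar s2)(''j'' := Suc j)\<rparr>)" by (rule enc'_cong) (use that in \<open>simp_all add: scanning_def\<close>)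
      then show ?thesis using that by (simp add: scanning_def dst_def)
    qed
    have R': "?R (Suc j) t' u' w' \<Longrightarrow> ?R j t' u' w' \<or> (t' = 1 \<and> u' = v \<and> w' = j)" for t' u' w' by auto
    show ?case
    proof (cases "j \<in> X \<or> j \<in> S")
      case True
      have "scanning (?R (Suc j)) \<tau> m v S s'"
      proof (cases "j \<in> X")
        case True
        then have na: "\<not> arc 1 v j" by (simp add: arc_def)
        show ?thesis by (rule scanning_mono[OF 5(2)]) (use na in \<open>auto simp: less_Suc_eq\<close>)
      next
        case False
        then have jst: "iarr s' ''ST'' j = 2" using True st by simp
        have "dst (?R (Suc j)) \<tau> m s'"
          unfolding dst_def
          by (rule search_inv_keep[where R = "?R j" and v = v and w = j and t = 1])
            (use 5(2) j(1) R' jst in \<open>auto simp: scanning_def dst_def\<close>)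
        then show ?thesis using 5(2) by (simp add: scanning_def)
      qed
      then show ?thesis using upd True bx st j G1 by auto
    next
      case False
      have "wpt (query_swap Omega1 ''X1'' ''v'' ''j'';; relax 1 ''w1'') s'
         (\<lambda>t s''. scanning (?R (Suc j)) \<tau> m v S s'' \<and> t \<le> 100 * G)"
        by (rule wpt_step1[OF 5(2) j(2,1) _ v _ _ R']) (use False in auto)
      then have "wpt (query_swap Omega1 ''X1'' ''v'' ''j'';; relax 1 ''w1'') s'
         (\<lambda>t s''. scanning (?R (Suc j)) \<tau> m v S (s''\<lparr>ivar := (ivar s'')(''j'' := Suc j)\<rparr>) \<and> t + 20 \<le> 120 * G)"
        by (rule wpt_mono) (use upd G1 in auto)
      then show ?thesis using False bx st j by (elim wpt_mono | simp)+
    qed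
  next
    case (7 t s')
    have "scanning (\<lambda>t u w. u \<noteq> v \<or> t = 1) \<tau> m v S s'"
      by (rule scanning_mono[OF 7(1)]) (use arc_less nn in auto)
    moreover have "n * (120 * G + 8) = 120 * (n * G) + 8 * real n" "150 * G * (n + 1) = 150 * (n * G) + 150 * G"
      by (simp_all add: algebra_simps)
    moreover have "real n \<le> n * G" using G1 by (simp add: mult_le_cancel_left1)
    moreover have "t \<le> 6 + n * (120 * G + 8)" using 7(3) nn by simp
    ultimately show ?case using G1 by linarith
  qed (use G1 in auto)
  then show ?thesis by (rule wpt_mono_agree) (use post in simp)
qed

lemma wpt_scan2:
  assumes s: "scanning (\<lambda>t u w. u \<noteq> v \<or> t = 1) \<tau> m v S s" and v: "v \<notin> T"
    and post: "\<And>t s'. scanning (\<lambda>t u w. True) \<tau> m v S s' \<Longrightarrow> t \<le> 150 * G * (card T + 1) \<Longrightarrow>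
       (\<And>u. u \<notin> T \<Longrightarrow> iarr s' ''ST'' u = iarr s ''ST'' u \<and> rarr s' ''D'' u = rarr s ''D'' u) \<Longrightarrow>
       agree (mods scan2) s s' \<Longrightarrow> Q t s'"
  shows "wpt scan2 s Q"
proof -
  have nn: "ivar s ''nl'' = card T" and L: "\<forall>y<card T. iarr s ''L'' y \<in> T" "\<forall>w\<in>T. \<exists>y<card T. iarr s ''L'' y = w"
    using s by (auto simp: scanning_def enc'_def)
  let ?R = "\<lambda>i t u w. u \<noteq> v \<or> t = 1 \<or> (\<exists>y<i. w = iarr s ''L'' y)"
  let ?F = "\<lambda>s'. \<forall>u. u \<notin> T \<longrightarrow> iarr s' ''ST'' u = iarr s ''ST'' u \<and> rarr s' ''D'' u = rarr s ''D'' u"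
  have "wpt scan2 s (\<lambda>t s'. scanning (\<lambda>t u w. True) \<tau> m v S s' \<and> ?F s' \<and> t \<le> 150 * G * (card T + 1))"
    unfolding scan2_def
  proof (rule wpt_For[where Inv = "\<lambda>i s'. scanning (?R i) \<tau> m v S s' \<and> ?F s'" and T = "\<lambda>_. 120 * G"], goal_cases)
    case 1
    have "enc' (s\<lparr>ivar := (ivar s)(''y'' := 0)\<rparr>)" by (rule enc'_cong) (use s in \<open>simp_all add: scanning_def\<close>)
    then show ?case using s by (simp add: scanning_def dst_def)
  next
    case (5 i s')
    define j where "j = iarr s ''L'' i"
    have Li: "iarr s' ''L'' = iarr s ''L''" "ivar s' ''y'' = i" using agreeD(3)[OF 5(4)] 5(3) by simp_all
    let ?s = "s'\<lparr>ivar := (ivar s')(''j'' := j)\<rparr>"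
    have jT: "j \<in> T" using L 5(1) nn by (simp add: j_def)
    then have j: "j < n" "ivar ?s ''j'' = j" and Tj: "\<And>u. u \<notin> T \<Longrightarrow> u \<noteq> j" using T by auto
    have "enc' ?s" by (rule enc'_cong) (use 5(2) in \<open>simp_all add: scanning_def\<close>)
    then have sc: "scanning (?R i) \<tau> m v S ?s" using 5(2) by (simp add: scanning_def dst_def)
    have st: "iarr s' ''ST'' j = 2 \<longleftrightarrow> j \<in> S" using 5(2) j by (auto simp: scanning_def)
    have upd: "scanning R \<tau> m v S (s2\<lparr>ivar := (ivar s2)(''y'' := Suc i)\<rparr>)" if "scanning R \<tau> m v S s2" for R s2
    proof -
      have "enc' (s2\<lparr>ivar := (ivar s2)(''y'' := Suc i)\<rparr>)" by (rule enc'_cong) (use that in \<open>simp_all add: scanning_def\<close>)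
      then show ?thesis using that by (simp add: scanning_def dst_def)
    qed
    have R': "?R (Suc i) t' u' w' \<Longrightarrow> arc t' u' w' \<Longrightarrow> ?R i t' u' w' \<or> (t' = 2 \<and> u' = v \<and> w' = j)" for t' u' w'
      by (auto simp: less_Suc_eq j_def arc_def)
    let ?R' = "\<lambda>t' u' w'. ?R i t' u' w' \<or> (t' = 2 \<and> u' = v \<and> w' = j)"
    have mono: "scanning (?R (Suc i)) \<tau> m v S s2" if "scanning ?R' \<tau> m v S s2" for s2
      by (rule scanning_mono[OF that]) (rule R')
    have "wpt (IfT (BNot (IEq (IArr ''ST'' (IVar ''j'')) (INum 2)))
       (query_swap Omega2 ''X2'' ''v'' ''j'';; relax 2 ''w2'')) ?s
       (\<lambda>t s''. scanning (?R (Suc i)) \<tau> m v S s'' \<and> ?F s'' \<and> t \<le> 110 * G)"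
    proof (cases "j \<in> S")
      case True
      then have jst: "iarr s' ''ST'' j = 2" using st by simp
      have "dst ?R' \<tau> m ?s"
        unfolding dst_def
        by (rule search_inv_keep[where R = "?R i" and v = v and w = j and t = 2])
          (use sc j(1) jst in \<open>auto simp: scanning_def dst_def\<close>)
      then have "scanning ?R' \<tau> m v S ?s" using sc by (simp add: scanning_def)
      then show ?thesis using mono[of ?s] 5(2) True st G1 by simp
    next
      case False
      have "wpt (query_swap Omega2 ''X2'' ''v'' ''j'';; relax 2 ''w2'') ?s
         (\<lambda>t s''. scanning ?R' \<tau> m v S s'' \<and> t \<le> 100 * G \<and>
         (\<forall>u. u \<noteq> j \<longrightarrow> iarr s'' ''ST'' u = iarr ?s ''ST'' u \<and> rarr s'' ''D'' u = rarr ?s ''D'' u))"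
        by (rule wpt_step2[OF sc j(2,1) False v jT]) auto
      then have "wpt (query_swap Omega2 ''X2'' ''v'' ''j'';; relax 2 ''w2'') ?s
         (\<lambda>t s''. scanning (?R (Suc i)) \<tau> m v S s'' \<and> ?F s'' \<and> t + 10 \<le> 110 * G)"
        by (rule wpt_mono) (use mono G1 5(2) Tj in auto)
      then show ?thesis using False st j by (elim wpt_mono | simp)+
    qed
    then show ?case
      unfolding wpt_Seq wpt_IAssign by (simp add: Li j_def[symmetric] del: wpt_Cond, elim wpt_mono) (use upd G1 in auto)
  next
    case (7 t s')
    have "scanning (\<lambda>t u w. True) \<tau> m v S s'"
    proof (rule scanning_mono)
      show "scanning (?R (card T)) \<tau> m v S s'" using 7(1) nn by simp
      fix t u w assume "arc t u w"
      then have "t = 1 \<or> w \<in> T" by (auto simp: arc_def)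
      then show "?R (card T) t u w" using L(2) by auto
    qed
    moreover have "card T * (120 * G + 8) = 120 * (card T * G) + 8 * real (card T)" "150 * G * (card T + 1) = 150 * (card T * G) + 150 * G"
      by (simp_all add: algebra_simps)
    moreover have "real (card T) \<le> card T * G" using G1 by (simp add: mult_le_cancel_left1)
    moreover have "t \<le> 6 + card T * (120 * G + 8)" using 7(3) nn by simp
    ultimately show ?case using G1 7(1) by (intro conjI) (assumption | blast | linarith)+
  qed (use G1 in auto)
  then show ?thesis by (rule wpt_mono_agree) (use post in simp)
qed

lemma wpt_select:
  assumes e: "enc' s" and tr: "tournament n (rarr s ''D'') (iarr s ''TR'') {v. v < n \<and> iarr s ''ST'' v = 1 \<and> v \<notin> T}"
    and post: "\<And>t s'. (ivar s' ''b'' = 0 \<and> (\<forall>v<n. iarr s ''ST'' v \<noteq> 1)) \<or>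
        (ivar s' ''b'' \<noteq> 0 \<and> ivar s' ''b'' - 1 < n \<and> iarr s ''ST'' (ivar s' ''b'' - 1) = 1 \<and>
         (\<forall>w<n. iarr s ''ST'' w = 1 \<longrightarrow> rarr s ''D'' (ivar s' ''b'' - 1) \<le> rarr s ''D'' w)) \<Longrightarrow>
       t \<le> 60 * real (card T + 1) \<Longrightarrow> agree (mods select) s s' \<Longrightarrow> Q t s'"
  shows "wpt select s Q"
proof -
  have nn: "ivar s ''nl'' = card T" and L: "\<forall>y<card T. iarr s ''L'' y \<in> T" "\<forall>w\<in>T. \<exists>y<card T. iarr s ''L'' y = w"
    using e by (auto simp: enc'_def)
  let ?cand = "\<lambda>i. {v. v < n \<and> iarr s ''ST'' v = 1 \<and> v \<notin> T} \<union> {v. iarr s ''ST'' v = 1 \<and> (\<exists>y<i. v = iarr s ''L'' y)}"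
  let ?best = "\<lambda>b C. (b = 0 \<and> C = {}) \<or> (b \<noteq> 0 \<and> b - 1 \<in> C \<and> (\<forall>w\<in>C. rarr s ''D'' (b - 1) \<le> rarr s ''D'' w))"
  have "wpt select s (\<lambda>t s'. ?best (ivar s' ''b'') (?cand (card T)) \<and> t \<le> 60 * real (card T + 1))"
    unfolding select_def wpt_Seq wpt_IAssign
  proof (rule wpt_For[where Inv = "\<lambda>i s'. ?best (ivar s' ''b'') (?cand i)" and T = "\<lambda>_. 30"], goal_cases)
    case 1
    have "?best (iarr s ''TR'' 1) (?cand 0)"
    proof -
      have "{v. v < n \<and> iarr s ''ST'' v = 1 \<and> v \<notin> T} \<subseteq> {..<n}" by auto
      from tournament_root[OF tr this] show ?thesis by auto
    qed
    then show ?case by simp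
  next
    case (5 i s')
    note ag = agreeD[OF 5(4)]
    define j where "j = iarr s ''L'' i"
    have st: "iarr s' ''L'' = iarr s ''L''" "ivar s' ''y'' = i" "iarr s' ''ST'' = iarr s ''ST''" "rarr s' ''D'' = rarr s ''D''"
      using ag 5(3) by simp_all
    have cand: "?cand (Suc i) = (if iarr s ''ST'' j = 1 then insert j (?cand i) else ?cand i)"
      by (auto simp: less_Suc_eq j_def)
    show ?case
    proof (cases "iarr s ''ST'' j = 1")
      case False
      then have c: "?cand (Suc i) = ?cand i" using cand by simp
      show ?thesis unfolding c using 5(2) st False by (simp add: j_def[symmetric])
    next
      case True
      then have c: "?cand (Suc i) = insert j (?cand i)" using cand by simp
      define C where "C = ?cand i"
      show ?thesis unfolding c C_def[symmetric] using 5(2)[folded C_def] st True by (auto simp: j_def[symmetric])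
    qed
  next
    case (7 t s')
    then show ?case using nn by simp
  qed auto
  moreover have "?cand (card T) = {v. v < n \<and> iarr s ''ST'' v = 1}"
    using L T(2) by auto
  ultimately have "wpt select s (\<lambda>t s'. ?best (ivar s' ''b'') {v. v < n \<and> iarr s ''ST'' v = 1} \<and> t \<le> 60 * real (card T + 1))"
    by (simp only:)
  then show ?thesis by (rule wpt_mono_agree) (use post in auto)
qed

end

section \<open>Settling nodes until a sink is reached or no candidate is left\<close>

lemma mods_expand [simp]: "mods expand = {''ST'', ''nd'', ''D'', ''PA'', ''PT'', ''X1'', ''X2'', ''qf'', ''qv'', ''j'', ''y'', ''ta'', ''tb'', ''TR'', ''h''}"
  by (auto simp: expand_def)

lemma mods_settle [simp]: "mods settle = {''v'', ''ST'', ''go'', ''nd'', ''D'', ''PA'', ''PT'', ''X1'', ''X2'', ''qf'', ''qv'', ''j'', ''y'', ''ta'', ''tb'', ''TR'', ''h''}"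
  by (auto simp: settle_def)

lemma mods_search_loop [simp]: "mods search_loop = {''b'', ''v'', ''ST'', ''go'', ''nd'', ''D'', ''PA'', ''PT'', ''X1'', ''X2'', ''qf'', ''qv'', ''j'', ''y'', ''ta'', ''tb'', ''TR'', ''h''}"
  by (auto simp: search_loop_def)

context search
begin

text \<open>The numbering \<open>\<tau>\<close>, its bound \<open>m\<close> and the scanned arcs
  \<open>R\<close> are ghost data held by no variable, hence the existential. The arcs out of the
  reached sink are never scanned, so \<open>R\<close> cannot be required to hold everywhere.\<close>

definition found :: "state \<Rightarrow> bool" where
  "found s \<longleftrightarrow> (\<exists>\<tau> m R. dst R \<tau> m s \<and> ivar s ''v'' \<in> snk \<and> iarr s ''ST'' (ivar s ''v'') = 2 \<and>
     (\<forall>v\<in>snk. iarr s ''ST'' v = 2 \<longrightarrow> v = ivar s ''v'') \<and>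
     (\<forall>v<n. iarr s ''ST'' v = 2 \<longrightarrow> \<tau> v \<le> \<tau> (ivar s ''v'')) \<and>
     cert {..<n} (D Omega1) (f Omega1) (side_dom n c (D Omega2)) (side_fun n c (f Omega2)) X T src snk
       (\<lambda>v. p v + (if iarr s ''ST'' v = 2 then rarr s ''D'' v else rarr s ''D'' (ivar s ''v'')))
       (lam + rarr s ''D'' (ivar s ''v'')))"

definition infeasible :: bool where
  "infeasible \<longleftrightarrow> (\<forall>Z1\<in>D Omega1. \<forall>Z2\<in>side_dom n c (D Omega2). card (Z1 \<inter> Z2) \<le> card (X - src))"

definition growing :: "state \<Rightarrow> bool" where
  "growing s \<longleftrightarrow> (\<exists>\<tau> m. dst (\<lambda>_ _ _. True) \<tau> m s) \<and>
     tournament n (rarr s ''D'') (iarr s ''TR'') {v. v < n \<and> iarr s ''ST'' v = 1 \<and> v \<notin> T} \<and>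
     (\<forall>v\<in>snk. iarr s ''ST'' v \<noteq> 2)"

lemma scanning_agree:
  assumes "scanning R \<tau> m v S s" "agree W s s'"
    "W \<inter> {''n'', ''c'', ''X1'', ''X2'', ''SR'', ''SK'', ''P'', ''w1'', ''w2'', ''nl'', ''L'', ''v'', ''ST'', ''D'', ''PA'', ''PT''} = {}"
  shows "scanning R \<tau> m v S s'"
proof -
  have a: "x \<in> {''n'', ''c'', ''X1'', ''X2'', ''SR'', ''SK'', ''P'', ''w1'', ''w2'', ''nl'', ''L'', ''v'', ''ST'', ''D'', ''PA'', ''PT''} \<Longrightarrow>
     ivar s' x = ivar s x \<and> rvar s' x = rvar s x \<and> iarr s' x = iarr s x \<and> rarr s' x = rarr s x" for x
    using assms(2,3) by (auto simp: agree_def)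
  have "enc' s'" by (rule enc'_cong[of s]) (use assms(1) a in \<open>simp_all add: scanning_def\<close>)
  then show ?thesis using assms(1) a by (simp add: scanning_def dst_def)
qed

abbreviation "lg \<equiv> max 1 (log 2 (real n))"

lemma wpt_settle:
  assumes e: "enc' s" and go: "ivar s ''go'' = 1" and gr: "growing s"
    and v: "ivar s ''b'' = v + 1" "v < n" "iarr s ''ST'' v = 1"
    and min: "\<forall>w<n. iarr s ''ST'' w = 1 \<longrightarrow> rarr s ''D'' v \<le> rarr s ''D'' w"
    and sink: "\<And>t s'. v \<in> snk \<Longrightarrow> enc' s' \<Longrightarrow> ivar s' ''go'' = 2 \<Longrightarrow> found s' \<Longrightarrow> t \<le> 20 \<Longrightarrow> Q t s'"
    and inner: "\<And>t s'. v \<notin> snk \<Longrightarrow> v \<in> X \<union> ({..<n} - T) \<Longrightarrow> enc' s' \<Longrightarrow> ivar s' ''go'' = 1 \<Longrightarrow> growing s' \<Longrightarrow>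
      (\<forall>u<n. iarr s' ''ST'' u = 2 \<longleftrightarrow> iarr s ''ST'' u = 2 \<or> u = v) \<Longrightarrow>
      t \<le> 40 + 150 * G * (card T + 1) + 140 * lg + (if v \<in> X then 250 * G * (n + 1) else 0) \<Longrightarrow> Q t s'"
  shows "wpt settle s Q"
proof -
  let ?st = "iarr s ''ST''" and ?lab = "rarr s ''D''"
  define s1 where "s1 = s\<lparr>ivar := (ivar s)(''v'' := v), iarr := (iarr s)(''ST'' := ?st(v := 2))\<rparr>"
  from gr obtain \<tau> m where d: "search_inv (\<lambda>_ _ _. True) ?st ?lab (iarr s ''PA'') (iarr s ''PT'') \<tau> m"
    and tr: "tournament n ?lab (iarr s ''TR'') {v. v < n \<and> ?st v = 1 \<and> v \<notin> T}"
    and ns: "\<forall>v\<in>snk. ?st v \<noteq> 2"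
    by (auto simp: growing_def dst_def)
  have d1: "search_inv (\<lambda>t u w. u \<noteq> v) (?st(v := 2)) ?lab (iarr s ''PA'') (iarr s ''PT'') (\<tau>(v := m)) (Suc m)"
    by (rule search_inv_settle[OF d v(2,3)]) (use min in auto)
  have le: "\<And>u. u < n \<Longrightarrow> ?st u = 2 \<Longrightarrow> ?lab u \<le> ?lab v" using search_invD(4)[OF d] v by blast
  have e1: "enc' s1" by (rule enc'_cong[OF e]) (simp_all add: s1_def)
  have sk: "iarr s ''SK'' v = (if v \<in> snk then 1 else 0)" and x1: "bits n (iarr s ''X1'') X"
    and x2: "bits n (iarr s ''X2'') (side n c T)" and nn: "ivar s ''n'' = n" "ivar s ''c'' = c"
    using e v by (auto simp: enc'_def enc_def bits_iff)
  show ?thesis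
  proof (cases "v \<in> snk")
    case True
    define s2 where "s2 = s1\<lparr>ivar := (ivar s1)(''go'' := 2)\<rparr>"
    have "\<tau> u < m" if "u < n" "?st u = 2" for u using search_invD(6)[OF d] that by blast
    then have last: "\<forall>u<n. (?st(v := 2)) u = 2 \<longrightarrow> (\<tau>(v := m)) u \<le> (\<tau>(v := m)) v" by (auto intro: less_imp_le)
    have "0 \<le> ?lab v" using search_invD(5)[OF d] v by auto
    \<comment> \<open>The certificate is taken before \<open>v\<close> is settled, when no sink is.
      Settling \<open>v\<close> does not change the potential, because its label is the value
      \<open>?lab v\<close> at which the others are cut off.\<close>
    then have "cert {..<n} (D Omega1) (f Omega1) (side_dom n c (D Omega2)) (side_fun n c (f Omega2)) X T src snk
       (\<lambda>u. p u + (if (?st(v := 2)) u = 2 then ?lab u else ?lab v)) (lam + ?lab v)"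
      by (intro search_inv_cert[OF d]) (use le min ns in auto)
    moreover have s2: "ivar s2 ''v'' = v" "rarr s2 ''D'' = ?lab" "iarr s2 ''ST'' = ?st(v := 2)"
      "iarr s2 ''PA'' = iarr s ''PA''" "iarr s2 ''PT'' = iarr s ''PT''" by (simp_all add: s2_def s1_def)
    moreover have "\<forall>u\<in>snk. (?st(v := 2)) u = 2 \<longrightarrow> u = v" "(?st(v := 2)) v = 2" using ns by auto
    ultimately have "found s2"
      unfolding found_def dst_def s2 using d1 True last by blast
    moreover have "enc' s2" by (rule enc'_cong[OF e1]) (simp_all add: s2_def)
    ultimately have "Q 14 s2" by (intro sink[OF True]) (simp_all add: s2_def)
    then show ?thesis using v sk True by (simp add: settle_def s2_def s1_def)
  next
    case False
    \<comment> \<open>An element of \<open>T\<close> that is no sink belongs to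
      \<open>T - snk = X - src\<close>. So every expanded node lies in \<open>X\<close> or outside
      \<open>T\<close>, on which the count of iterations rests.\<close>
    have vQ: "v \<in> X \<union> ({..<n} - T)" using False bal v by auto
    define S where "S = {u. u < n \<and> (?st(v := 2)) u = 2}"
    have sc: "scanning (\<lambda>t u w. u \<noteq> v) (\<tau>(v := m)) (Suc m) v S s1"
      unfolding scanning_def dst_def using e1 d1 v le by (auto simp: s1_def S_def)
    have Ssnk: "u \<notin> snk" if "u \<in> S" for u using that ns False by (auto simp: S_def split: if_splits)
    let ?mid = "\<lambda>s2. scanning (\<lambda>t u w. u \<noteq> v \<or> t = 1) (\<tau>(v := m)) (Suc m) v S s2 \<and>
       tournament n (rarr s2 ''D'') (iarr s2 ''TR'') {u. u < n \<and> iarr s2 ''ST'' u = 1 \<and> u \<notin> T} \<and> ivar s2 ''go'' = 1"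
    have part1: "wpt (Cond (IEq (IArr ''X1'' (IVar ''v'')) (INum 1)) (scan1;; rebuild) delete_leaf) s1
       (\<lambda>t s2. ?mid s2 \<and> t \<le> 5 + 140 * lg + (if v \<in> X then 250 * G * (n + 1) else 0))"
    proof (cases "v \<in> X")
      case True
      have "wpt (scan1;; rebuild) s1 (\<lambda>t s2. ?mid s2 \<and> t \<le> 250 * G * (n + 1))"
        unfolding wpt_Seq
      proof (rule wpt_scan1[OF sc True], goal_cases)
        case (1 t1 s2)
        have e2: "ivar s2 ''n'' = n" "ivar s2 ''c'' = c" "bits n (iarr s2 ''X2'') (side n c T)"
          using 1(1) by (auto simp: scanning_def enc'_def enc_def)
        have L: "{u. u < n \<and> iarr s2 ''ST'' u = 1 \<and> iarr s2 ''X2'' u \<noteq> ivar s2 ''c''} = {u. u < n \<and> iarr s2 ''ST'' u = 1 \<and> u \<notin> T}"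
          using bits_side[OF e2(3) c] e2(2) by auto
        have go2: "ivar s2 ''go'' = 1" using agreeD(1)[OF 1(3), of "''go''"] go by (simp add: s1_def)
        show ?case
        proof (rule wpt_rebuild[OF e2(1)], goal_cases)
          case (1 t2 s3)
          have "scanning (\<lambda>t u w. u \<noteq> v \<or> t = 1) (\<tau>(v := m)) (Suc m) v S s3"
            by (rule scanning_agree[OF \<open>scanning (\<lambda>t u w. u \<noteq> v \<or> t = 1) (\<tau>(v := m)) (Suc m) v S s2\<close> 1(2)]) simp
          moreover have "100 * real (n + 1) \<le> 100 * G * real (n + 1)" using G1 by (intro mult_right_mono) auto
          moreover have "150 * G * real (n + 1) + 100 * G * real (n + 1) = 250 * G * real (n + 1)" by simp
          ultimately have "t1 + t2 \<le> 250 * G * real (n + 1)"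
            and sc3: "scanning (\<lambda>t u w. u \<noteq> v \<or> t = 1) (\<tau>(v := m)) (Suc m) v S s3"
            using 1(3) \<open>t1 \<le> 150 * G * real (n + 1)\<close> by linarith+
          then show ?case using agreeD[OF 1(2)] 1(1) go2 L by simp
        qed
      qed
      then show ?thesis using True bits_iff[OF x1 v(2)]
        by (simp add: s1_def[symmetric] del: wpt_Seq) (simp add: s1_def, elim wpt_mono, clarsimp, linarith)
    next
      case False
      have tr1: "tournament n (rarr s1 ''D'') (iarr s1 ''TR'') {v. v < n \<and> ?st v = 1 \<and> v \<notin> T}"
        using tr by (simp add: s1_def)
      have "wpt delete_leaf s1 (\<lambda>t s2. ?mid s2 \<and> t \<le> 140 * lg)"
      proof (rule wpt_delete_leaf[OF _ _ tr1], goal_cases)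
        case (3 t s2)
        have "scanning (\<lambda>t u w. u \<noteq> v \<or> t = 1) (\<tau>(v := m)) (Suc m) v S s1"
          by (rule scanning_mono[OF sc]) (use False in \<open>auto simp: arc_def\<close>)
        then have "scanning (\<lambda>t u w. u \<noteq> v \<or> t = 1) (\<tau>(v := m)) (Suc m) v S s2"
          by (rule scanning_agree[OF _ 3(2)]) simp
        moreover have "{v. v < n \<and> ?st v = 1 \<and> v \<notin> T} - {v} = {u. u < n \<and> iarr s2 ''ST'' u = 1 \<and> u \<notin> T}"
          using agreeD(3)[OF 3(2), of "''ST''"] by (auto simp: s1_def split: if_splits)
        ultimately show ?case using agreeD[OF 3(2)] 3(1,3) go by (simp add: s1_def)
      qed (use nn v in \<open>simp_all add: s1_def\<close>)
      moreover have "iarr s1 ''X1'' v = 0" "ivar s1 ''v'' = v"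
        using False bits_iff[OF x1 v(2)] by (simp_all add: s1_def)
      ultimately show ?thesis using False by simp
    qed
    have part2: "wpt (IfT (BNot (IEq (IArr ''X2'' (IVar ''v'')) (IVar ''c''))) scan2) s2
       (\<lambda>t s3. enc' s3 \<and> ivar s3 ''go'' = 1 \<and> growing s3 \<and>
         (\<forall>u<n. iarr s3 ''ST'' u = 2 \<longleftrightarrow> iarr s ''ST'' u = 2 \<or> u = v) \<and> t \<le> 10 + 150 * G * (card T + 1))"
      if mid: "?mid s2" for s2
    proof -
      have e2: "ivar s2 ''v'' = v" "ivar s2 ''c'' = c" "bits n (iarr s2 ''X2'') (side n c T)"
        using mid by (auto simp: scanning_def enc'_def enc_def)
      have done3: "enc' s3 \<and> growing s3 \<and> (\<forall>u<n. iarr s3 ''ST'' u = 2 \<longleftrightarrow> iarr s ''ST'' u = 2 \<or> u = v)"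
        if "scanning (\<lambda>_ _ _. True) (\<tau>(v := m)) (Suc m) v S s3"
          "tournament n (rarr s3 ''D'') (iarr s3 ''TR'') {u. u < n \<and> iarr s3 ''ST'' u = 1 \<and> u \<notin> T}" for s3
        unfolding growing_def using that Ssnk snk by (auto simp: scanning_def S_def)
      have x2v: "iarr s2 ''X2'' v = c \<longleftrightarrow> v \<in> T" using bits_side[OF e2(3) c v(2)] .
      show ?thesis
      proof (cases "v \<in> T")
        case True
        have "scanning (\<lambda>_ _ _. True) (\<tau>(v := m)) (Suc m) v S s2"
          by (rule scanning_mono[OF conjunct1[OF mid]]) (use True in \<open>auto simp: arc_def\<close>)
        then show ?thesis using done3[of s2] mid True x2v e2 G1 by simp
      next
        case False
        have "wpt scan2 s2 (\<lambda>t s3. enc' s3 \<and> ivar s3 ''go'' = 1 \<and> growing s3 \<and>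
         (\<forall>u<n. iarr s3 ''ST'' u = 2 \<longleftrightarrow> iarr s ''ST'' u = 2 \<or> u = v) \<and> t \<le> 150 * G * (card T + 1))"
        proof (rule wpt_scan2[OF conjunct1[OF mid] False], goal_cases)
          case (1 t s3)
          \<comment> \<open>The scan alters labels and status in \<open>T\<close> only, so neither
            the leaves of the tree nor their keys change.\<close>
          have L: "{u. u < n \<and> iarr s3 ''ST'' u = 1 \<and> u \<notin> T} = {u. u < n \<and> iarr s2 ''ST'' u = 1 \<and> u \<notin> T}"
            using 1(3) by auto
          have "tournament n (rarr s3 ''D'') (iarr s3 ''TR'') {u. u < n \<and> iarr s3 ''ST'' u = 1 \<and> u \<notin> T}"
            unfolding L using mid agreeD(3)[OF 1(4), of "''TR''"] 1(3) by (auto intro: tournament_cong)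
          then show ?case using done3[OF 1(1)] agreeD(1)[OF 1(4), of "''go''"] mid 1(2) by simp
        qed
        then show ?thesis using False x2v e2 by (simp, elim wpt_mono) simp
      qed
    qed
    have "wpt expand s1 (\<lambda>t s'. Q (12 + t) s')"
      unfolding expand_def wpt_Seq[of "Cond _ _ _"]
      by (rule wpt_mono[OF part1], rule wpt_mono[OF part2], blast)
        (rule inner[OF False vQ]; auto)
    then show ?thesis using v sk False by (simp add: settle_def s1_def)
  qed
qed

lemma wpt_search_loop:
  assumes e: "enc' s" and go: "ivar s ''go'' = 1" and gr: "growing s"
    and post: "\<And>t s'. enc' s' \<Longrightarrow> ivar s' ''go'' = 0 \<and> infeasible \<or> ivar s' ''go'' = 2 \<and> found s' \<Longrightarrow>
      t \<le> (300 * G * real (card T + 1) + 140 * lg) * (2 + real (card (X \<union> ({..<n} - T)))) + 250 * G * real (n + 1) * real (card X) \<Longrightarrow>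
      agree (mods search_loop) s s' \<Longrightarrow> Q t s'"
  shows "wpt search_loop s Q"
proof -
  let ?Q = "X \<union> ({..<n} - T)"
  define a where "a = 300 * G * real (card T + 1) + 140 * lg"
  define b where "b = 250 * G * real (n + 1)"
  have a0: "300 * G \<le> a" "0 \<le> b" and fQ: "finite ?Q"
    using G1 X by (auto simp: a_def b_def intro!: add_nonneg_nonneg add_increasing2)
  let ?q = "\<lambda>s. real (card {u\<in>?Q. iarr s ''ST'' u \<noteq> 2})" and ?x = "\<lambda>s. real (card {u\<in>X. iarr s ''ST'' u \<noteq> 2})"
  \<comment> \<open>An expanded node takes \<open>a\<close> from the potential, and a node of
    \<open>X\<close> another \<open>b\<close> for its scan and the new tree. The extra
    \<open>a\<close> in \<open>1 + ?q s\<close> pays for the last iteration, which settles a sink or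
    finds no candidate.\<close>
  let ?\<Phi> = "\<lambda>s. if ivar s ''go'' = 1 then a * (1 + ?q s) + b * ?x s else 0"
  let ?I = "\<lambda>s. enc' s \<and> (ivar s ''go'' = 0 \<and> infeasible \<or> ivar s ''go'' = 1 \<and> growing s \<or> ivar s ''go'' = 2 \<and> found s)"
  have "wpt search_loop s (\<lambda>t s'. enc' s' \<and> (ivar s' ''go'' = 0 \<and> infeasible \<or> ivar s' ''go'' = 2 \<and> found s') \<and>
     t \<le> a * (2 + real (card ?Q)) + b * real (card X))"
    unfolding search_loop_def
  proof (rule wpt_While[where Inv = ?I and \<Phi> = ?\<Phi>], goal_cases)
    case 1
    show ?case using e go gr by simp
  next
    case (2 s1)
    have go1: "ivar s1 ''go'' = 1" using 2(3) by simp
    then have e1: "enc' s1" and gr1: "growing s1" using 2(1) by auto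
    have tr: "tournament n (rarr s1 ''D'') (iarr s1 ''TR'') {v. v < n \<and> iarr s1 ''ST'' v = 1 \<and> v \<notin> T}"
      using gr1 by (simp add: growing_def)
    have \<Phi>1: "?\<Phi> s1 = a * (1 + ?q s1) + b * ?x s1" using go1 by simp
    have x0: "0 \<le> b * ?x s1" and q0: "a \<le> a * (1 + ?q s1)" using a0 G1 by simp_all
    have c0: "60 * real (card T + 1) + 60 \<le> a"
    proof -
      have "60 * real (card T + 1) + 60 \<le> 300 * (1 * real (card T + 1))" by simp
      also have "\<dots> \<le> 300 * (G * real (card T + 1))" using G1 by (intro mult_left_mono mult_right_mono) auto
      also have "\<dots> \<le> a" by (simp add: a_def)
      finally show ?thesis .
    qed
    have Ma: "60 * real (card T + 1) + 60 \<le> ?\<Phi> s1"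
      unfolding \<Phi>1 using x0 q0 c0 by linarith
    show ?case
      unfolding wpt_Seq
    proof (rule wpt_select[OF e1 tr], goal_cases)
      case (1 t1 s2)
      have ag: "ivar s2 ''go'' = 1" "iarr s2 ''ST'' = iarr s1 ''ST''" "rarr s2 ''D'' = rarr s1 ''D''" "iarr s2 ''TR'' = iarr s1 ''TR''"
        "iarr s2 ''PA'' = iarr s1 ''PA''" "iarr s2 ''PT'' = iarr s1 ''PT''"
        using agreeD[OF 1(3)] go1 by simp_all
      have e2: "enc' s2" by (rule enc'_cong[OF e1]) (use agreeD[OF 1(3)] in simp_all)
      have gr2: "growing s2" using gr1 by (simp add: growing_def dst_def ag)
      show ?case
      proof (cases "ivar s2 ''b'' = 0")
        case True
        then have no: "\<forall>v<n. iarr s1 ''ST'' v \<noteq> 1" using 1(1) by auto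
        from gr1 obtain \<tau> m where d: "search_inv (\<lambda>_ _ _. True) (iarr s1 ''ST'') (rarr s1 ''D'') (iarr s1 ''PA'') (iarr s1 ''PT'') \<tau> m"
          by (auto simp: growing_def dst_def)
        have "infeasible"
          unfolding infeasible_def using search_inv_infeasible[OF d] no gr1 by (auto simp: growing_def)
        moreover have "enc' (s2\<lparr>ivar := (ivar s2)(''go'' := 0)\<rparr>)" by (rule enc'_cong[OF e2]) simp_all
        ultimately show ?thesis using True 1(2) Ma by simp
      next
        case False
        define v where "v = ivar s2 ''b'' - 1"
        have v: "ivar s2 ''b'' = v + 1" "v < n" "iarr s2 ''ST'' v = 1"
          "\<forall>w<n. iarr s2 ''ST'' w = 1 \<longrightarrow> rarr s2 ''D'' v \<le> rarr s2 ''D'' w"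
          using 1(1) False ag by (auto simp: v_def)
        have "wpt settle s2 (\<lambda>t s''. ?I s'' \<and> 20 + t1 + t + ?\<Phi> s'' \<le> ?\<Phi> s1)"
        proof (rule wpt_settle[OF e2 ag(1) gr2 v], goal_cases)
          case (1 t s3)
          then show ?case using \<open>t1 \<le> _\<close> Ma by simp
        next
          case (2 t s3)
          have st3: "iarr s3 ''ST'' u = 2 \<longleftrightarrow> iarr s1 ''ST'' u = 2 \<or> u = v" if "u < n" for u
            using 2(6) that ag by simp
          have Qn: "?Q \<subseteq> {..<n}" using X by auto
          have v1: "iarr s1 ''ST'' v \<noteq> 2" using v(3) ag by simp
          have "{u\<in>?Q. iarr s1 ''ST'' u \<noteq> 2} = insert v {u\<in>?Q. iarr s3 ''ST'' u \<noteq> 2}"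
            using st3 Qn 2(2) v1 by auto
          moreover have "v \<notin> {u\<in>?Q. iarr s3 ''ST'' u \<noteq> 2}" using st3[OF v(2)] by simp
          ultimately have q: "?q s1 = ?q s3 + 1" using fQ by simp
          have x: "?x s1 = ?x s3 + (if v \<in> X then 1 else 0)"
          proof (cases "v \<in> X")
            case True
            then have "{u\<in>X. iarr s1 ''ST'' u \<noteq> 2} = insert v {u\<in>X. iarr s3 ''ST'' u \<noteq> 2}"
              using st3 X v1 by auto
            moreover have "v \<notin> {u\<in>X. iarr s3 ''ST'' u \<noteq> 2}" using st3[OF v(2)] by simp
            ultimately show ?thesis using X True by simp
          next
            case False
            then have "{u\<in>X. iarr s1 ''ST'' u \<noteq> 2} = {u\<in>X. iarr s3 ''ST'' u \<noteq> 2}"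
              using st3 X by auto
            then show ?thesis using False by simp
          qed
          have P3: "?\<Phi> s3 = a * (1 + ?q s3) + b * ?x s3" using 2(4) by simp
          have t: "t \<le> 40 + 150 * G * real (card T + 1) + 140 * lg + (if v \<in> X then b else 0)"
            using 2(7) unfolding b_def by (cases "v \<in> X") simp_all
          have g: "a * (1 + (i + 1)) + b * (j + k) = a * (1 + i) + b * j + (a + b * k)" for i j k
            by (simp add: algebra_simps)
          have "?\<Phi> s1 = ?\<Phi> s3 + (a + b * (if v \<in> X then 1 else 0))"
            by (rule trans[OF \<Phi>1]) (simp only: P3 q x g)
          then have "?\<Phi> s1 - ?\<Phi> s3 = a + (if v \<in> X then b else 0)" by (cases "v \<in> X") simp_all
          moreover have "100 * 1 * real (card T + 1) \<le> 100 * G * real (card T + 1)"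
            using G1 by (intro mult_right_mono mult_left_mono) auto
          moreover have "50 * 1 * 1 \<le> 50 * G * real (card T + 1)"
            using G1 by (intro mult_mono) auto
          ultimately have "20 + t1 + t + ?\<Phi> s3 \<le> ?\<Phi> s1"
            using t \<open>t1 \<le> _\<close> unfolding a_def by argo
          then show ?case using 2 by blast
        qed
        note W = this
        have nb: "\<not> bval (IEq (IVar ''b'') (INum 0)) s2" using False by simp
        show ?thesis
          unfolding wpt_Cond if_not_P[OF nb]
        proof (rule wpt_mono[OF W], elim conjE, intro conjI)
          fix t s''
          assume "20 + t1 + t + ?\<Phi> s'' \<le> ?\<Phi> s1"
          then show "1 + real (bcost (IEq (IVar ''go'') (INum 1))) + (t1 + (1 + real (bcost (IEq (IVar ''b'') (INum 0))) + t)) +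
            ?\<Phi> s'' \<le> ?\<Phi> s1"
            by (simp only: bcost.simps icost.simps)
        qed
      qed
    qed
  next
    case (3 s1)
    then show ?case using a0 G1 by simp
  next
    case (4 t s1)
    have ng: "ivar s1 ''go'' \<noteq> 1" using 4(3) by simp
    have t4: "t \<le> a * (1 + ?q s) + b * ?x s + 4" using 4(4) ng go by simp
    have "?q s \<le> real (card ?Q)" "?x s \<le> real (card X)"
      using fQ X by (auto intro!: card_mono)
    then have "a * (1 + ?q s) \<le> a * (1 + real (card ?Q))" "b * ?x s \<le> b * real (card X)"
      using a0 G1 by (auto intro!: mult_left_mono)
    moreover have "a * (2 + real (card ?Q)) = a + a * (1 + real (card ?Q))" by (simp add: algebra_simps)
    moreover have "4 \<le> a" using a0 G1 by simp
    ultimately have "t \<le> a * (2 + real (card ?Q)) + b * real (card X)"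
      using t4 by linarith
    then show ?case using 4(1) ng by blast
  qed
  then show ?thesis by (rule wpt_mono_agree) (use post in \<open>simp add: a_def b_def\<close>)
qed

end

section \<open>Preparing a search and augmenting along its path\<close>

definition prepare :: com where
  "prepare =
     Query Omega1 ''X1'' ''qf'' ''w1'';; Query Omega2 ''X2'' ''qf'' ''w2'';; IAssign ''nl'' (INum 0);;
     For ''y'' ''n'' (IfT (IEq (IArr ''X2'' (IVar ''y'')) (IVar ''c''))
       (IStore ''L'' (IVar ''nl'') (IVar ''y'');; IAssign ''nl'' (IAdd (IVar ''nl'') (INum 1))));;
     For ''y'' ''n'' (IStore ''PT'' (IVar ''y'') (INum 0);; Cond (IEq (IArr ''SR'' (IVar ''y'')) (INum 1))
       (IStore ''ST'' (IVar ''y'') (INum 1);; RStore ''D'' (IVar ''y'') (RNum 0)) (IStore ''ST'' (IVar ''y'') (INum 0)));;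
     rebuild;; IAssign ''go'' (INum 1)"

text \<open>At this point \<open>v\<close> still holds the reached sink, so unsettled nodes rise by
  its label: the potential of \<open>search_inv_cert\<close> with that label as
  \<open>\<Delta>\<close>.\<close>

definition update_potential :: com where
  "update_potential = For ''y'' ''n'' (Cond (IEq (IArr ''ST'' (IVar ''y'')) (INum 2))
     (RStore ''P'' (IVar ''y'') (RAdd (RArr ''P'' (IVar ''y'')) (RArr ''D'' (IVar ''y''))))
     (RStore ''P'' (IVar ''y'') (RAdd (RArr ''P'' (IVar ''y'')) (RArr ''D'' (IVar ''v'')))))"

text \<open>The walk ends at a source, marked by 0 in \<open>PT\<close>. An arc flips the bits of
  both its ends, in \<open>X1\<close> or \<open>X2\<close> according to its type; flipping commutes
  with complementation, so the code is the same for both values of \<open>c\<close>.\<close>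

definition augment_path :: com where
  "augment_path =
     IStore ''SK'' (IVar ''v'') (INum 0);;
     While (BNot (IEq (IArr ''PT'' (IVar ''v'')) (INum 0)))
       (IAssign ''u'' (IArr ''PA'' (IVar ''v''));;
        Cond (IEq (IArr ''PT'' (IVar ''v'')) (INum 1)) (flip ''X1'' ''u'';; flip ''X1'' ''v'') (flip ''X2'' ''u'';; flip ''X2'' ''v'');;
        IAssign ''v'' (IVar ''u''));;
     IStore ''SR'' (IVar ''v'') (INum 0)"

lemma mods_prepare [simp]:
  "mods prepare = {''qf'', ''w1'', ''w2'', ''nl'', ''y'', ''L'', ''PT'', ''ST'', ''D'', ''ta'', ''tb'', ''TR'', ''h'', ''go''}"
  by (auto simp: prepare_def)

lemma mods_update_potential [simp]: "mods update_potential = {''y'', ''P''}"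
  by (auto simp: update_potential_def)

lemma mods_augment_path [simp]: "mods augment_path = {''SK'', ''SR'', ''u'', ''v'', ''X1'', ''X2''}"
  by (auto simp: augment_path_def)

context search
begin

lemma wpt_prepare:
  assumes e: "enc s"
    and post: "\<And>t s'. enc' s' \<Longrightarrow> ivar s' ''go'' = 1 \<Longrightarrow> growing s' \<Longrightarrow> t \<le> 200 * G * real (n + 1) \<Longrightarrow>
      agree (mods prepare) s s' \<Longrightarrow> Q t s'"
  shows "wpt prepare s Q"
proof -
  have b: "ivar s ''n'' = n" "ivar s ''c'' = c" "bits n (iarr s ''X1'') X" "bits n (iarr s ''X2'') (side n c T)"
    "bits n (iarr s ''SR'') src" using e by (auto simp: enc_def)
  have a1: "array_set n (iarr s ''X1'') = X" and a2: "array_set n (iarr s ''X2'') = side n c T"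
    using b array_set_bits by auto
  have XD: "X \<in> D Omega1" "side n c T \<in> D Omega2" using X T by (auto simp: side_dom_def)
  let ?s1 = "s\<lparr>ivar := (ivar s)(''qf'' := 1, ''nl'' := 0),
      rvar := (rvar s)(''w1'' := f Omega1 X, ''w2'' := side_fun n c (f Omega2) T)\<rparr>"
  let ?I = "\<lambda>i s'. ivar s' ''nl'' = card (T \<inter> {..<i}) \<and> (\<forall>y<ivar s' ''nl''. iarr s' ''L'' y \<in> T) \<and>
     (\<forall>w\<in>T. w < i \<longrightarrow> (\<exists>y<ivar s' ''nl''. iarr s' ''L'' y = w))"
  have T0: "T \<inter> {..<0::nat} = {}" by auto
  have TS: "T \<inter> {..<Suc i} = (if i \<in> T then insert i (T \<inter> {..<i}) else T \<inter> {..<i})" for i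
    by (auto simp: less_Suc_eq)
  have nG: "real n \<le> real n * G" using G1 by (simp add: mult_le_cancel_left1)
  have "wpt prepare s (\<lambda>t s'. enc' s' \<and> ivar s' ''go'' = 1 \<and> growing s' \<and> t \<le> 200 * G * real (n + 1))"
    unfolding prepare_def wpt_Seq
  proof (simp add: a1 a2 XD, rule wpt_For[where Inv = ?I and T = "\<lambda>_. 20"], goal_cases)
    case 1
    then show ?case by (simp add: T0)
  next
    case (5 i s')
    note ag = agreeD[OF 5(4)]
    have st: "ivar s' ''c'' = c" "iarr s' ''X2'' = iarr s ''X2''" "i < n" "ivar s' ''y'' = i"
      using ag 5(1,3) b by simp_all
    have iT: "iarr s ''X2'' i = c \<longleftrightarrow> i \<in> T" using bits_side[OF b(4) c st(3)] .
    let ?k = "ivar s' ''nl''" and ?L = "iarr s' ''L''"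
    have k: "?k = card (T \<inter> {..<i})" "\<And>y. y < ?k \<Longrightarrow> ?L y \<in> T" "\<And>w. w \<in> T \<Longrightarrow> w < i \<Longrightarrow> \<exists>y<?k. ?L y = w"
      using 5(2) by blast+
    show ?case
    proof (cases "i \<in> T")
      case True
      have "Suc ?k = card (T \<inter> {..<Suc i})" unfolding TS k(1) using True by simp
      moreover have "\<forall>y<Suc ?k. (?L(?k := i)) y \<in> T" using k(2) True by (simp add: less_Suc_eq)
      moreover have "\<exists>y<Suc ?k. (?L(?k := i)) y = w" if "w \<in> T" "w < Suc i" for w
      proof (cases "w = i")
        case False
        then obtain y where "y < ?k" "?L y = w" using k(3)[of w] \<open>w \<in> T\<close> \<open>w < Suc i\<close> by auto
        then show ?thesis by (intro exI[of _ y]) simp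
      qed (intro exI[of _ ?k], simp)
      ultimately show ?thesis using st iT True by simp
    next
      case False
      have "?k = card (T \<inter> {..<Suc i})" unfolding TS k(1) using False by simp
      moreover have "\<exists>y<?k. ?L y = w" if "w \<in> T" "w < Suc i" for w
        using k(3)[of w] that False by (cases "w = i") auto
      ultimately show ?thesis using st iT False k(2) by simp
    qed
  next
    case (7 t1 s2)
    note ag = agreeD[OF 7(2)]
    have n2: "ivar s2 ''n'' = n" using ag b by simp
    have TnT: "T \<inter> {..<n} = T" using T by auto
    have L: "ivar s2 ''nl'' = card T \<and> (\<forall>y<card T. iarr s2 ''L'' y \<in> T) \<and> (\<forall>w\<in>T. \<exists>y<card T. iarr s2 ''L'' y = w)"
      using 7(1) b T by (auto simp: TnT)
    have e2: "enc' s2" unfolding enc'_def enc_def using L e ag by (simp add: enc_def side_fun_def)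
    have t1: "t1 \<le> 6 + 28 * real n" using 7(3) b by simp
    show ?case
    proof (rule wpt_For[where Inv = "\<lambda>i s'. \<forall>v<i. iarr s' ''PT'' v = 0 \<and> iarr s' ''ST'' v = (if v \<in> src then 1 else 0) \<and>
        (v \<in> src \<longrightarrow> rarr s' ''D'' v = 0)" and T = "\<lambda>_. 20"], goal_cases)
      case (5 i s')
      have "bits n (iarr s' ''SR'') src"
        using agreeD(3)[OF 5(4), of "''SR''"] e2 by (simp add: enc'_def enc_def)
      then have "iarr s' ''SR'' i = (if i \<in> src then 1 else 0)"
        using 5(1) n2 by (simp add: bits_iff)
      then show ?case using 5(2,3) by (auto simp: less_Suc_eq)
    next
      case (7 t2 s3)
      have e3: "enc' s3" by (rule enc'_cong[OF e2]) (use agreeD[OF 7(2)] in simp_all)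
      have t2: "t2 \<le> 6 + 28 * real n" using 7(3) n2 by simp
      have st: "\<And>v. v < n \<Longrightarrow> iarr s3 ''PT'' v = 0 \<and> iarr s3 ''ST'' v = (if v \<in> src then 1 else 0) \<and>
        (v \<in> src \<longrightarrow> rarr s3 ''D'' v = 0)" using 7(1) n2 by simp
      have d: "dst (\<lambda>_ _ _. True) (\<lambda>_. 0) 0 s3"
        unfolding dst_def by (rule search_inv_init) (use st src in auto)
      have e3': "ivar s3 ''n'' = n" "ivar s3 ''c'' = c" "bits n (iarr s3 ''X2'') (side n c T)"
        using e3 by (auto simp: enc'_def enc_def)
      show ?case
      proof (rule wpt_rebuild[OF e3'(1)], goal_cases)
        case (1 t3 s4)
        have L: "{v. v < n \<and> iarr s3 ''ST'' v = 1 \<and> iarr s3 ''X2'' v \<noteq> ivar s3 ''c''} = {v. v < n \<and> iarr s3 ''ST'' v = 1 \<and> v \<notin> T}"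
          using bits_side[OF e3'(3) c] e3'(2) by auto
        let ?s5 = "s4\<lparr>ivar := (ivar s4)(''go'' := Suc 0)\<rparr>"
        have "enc' ?s5" by (rule enc'_cong[OF e3]) (use agreeD[OF 1(2)] in simp_all)
        moreover have g: "iarr s4 ''ST'' = iarr s3 ''ST''" "iarr s4 ''PT'' = iarr s3 ''PT''" "iarr s4 ''PA'' = iarr s3 ''PA''"
          "rarr s4 ''D'' = rarr s3 ''D''" using agreeD[OF 1(2)] by simp_all
        have ns: "iarr s3 ''ST'' v \<noteq> 2" if "v \<in> snk" for v
        proof -
          have "v < n" using snk that by auto
          then show ?thesis using st[of v] by (simp split: if_splits)
        qed
        have "growing ?s5"
          unfolding growing_def using d 1(1)[unfolded L] ns by (auto simp: dst_def g)
        moreover have "2 + 2 * \<gamma> + (2 + (t1 + (t2 + (t3 + 2)))) \<le> 200 * G * real (n + 1)"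
        proof -
          have "200 * G * real (n + 1) = 200 * (real n * G) + 200 * G" by (simp add: algebra_simps)
          moreover have "2 + 2 * \<gamma> = 2 * G" by (simp add: G_def)
          moreover have "100 * real (n + 1) = 100 * real n + 100" by simp
          ultimately show ?thesis using t1 t2 1(3) nG G1 by linarith
        qed
        ultimately show ?case by simp
      qed
    qed auto
  qed auto
  then show ?thesis by (rule wpt_mono_agree) (use post in simp)
qed

definition augmented :: "state \<Rightarrow> bool" where
  "augmented s \<longleftrightarrow> (\<exists>X' T' src' snk' p' lam'.
     cert {..<n} (D Omega1) (f Omega1) (side_dom n c (D Omega2)) (side_fun n c (f Omega2)) X' T' src' snk' p' lam' \<and>
     card (X' - src') = Suc (card (X - src)) \<and>
     bits n (iarr s ''X1'') X' \<and> bits n (iarr s ''X2'') (side n c T') \<and>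
     bits n (iarr s ''SR'') src' \<and> bits n (iarr s ''SK'') snk' \<and> (\<forall>v<n. rarr s ''P'' v = p' v))"

lemma wpt_augment:
  assumes e: "enc' s" and fo: "found s"
    and post: "\<And>t s'. augmented s' \<Longrightarrow> t \<le> 200 * real (n + 1) \<Longrightarrow>
       agree (mods (update_potential;; augment_path)) s s' \<Longrightarrow> Q t s'"
  shows "wpt (update_potential;; augment_path) s Q"
proof -
  let ?t = "ivar s ''v''" and ?st = "iarr s ''ST''" and ?lab = "rarr s ''D''" and ?par = "iarr s ''PA''" and ?pt = "iarr s ''PT''"
  let ?p = "\<lambda>v. p v + (if ?st v = 2 then ?lab v else ?lab ?t)"
  from fo obtain \<tau> m R where f: "search_inv R ?st ?lab ?par ?pt \<tau> m" "?t \<in> snk" "?st ?t = 2"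
     "\<forall>v\<in>snk. ?st v = 2 \<longrightarrow> v = ?t" "\<forall>v<n. ?st v = 2 \<longrightarrow> \<tau> v \<le> \<tau> ?t"
     "cert {..<n} (D Omega1) (f Omega1) (side_dom n c (D Omega2)) (side_fun n c (f Omega2)) X T src snk ?p (lam + ?lab ?t)"
    unfolding found_def dst_def by (elim exE conjE) (rule that)
  interpret au: augmentation n "D Omega1" "f Omega1" "side_dom n c (D Omega2)" "side_fun n c (f Omega2)" X T src snk p lam
    ?st ?lab ?par ?pt \<tau> m ?t ?p R "lam + ?lab ?t"
  proof
    show "search_inv R ?st ?lab ?par ?pt \<tau> m" "?t \<in> snk" "?st ?t = 2" by (fact f)+
    show "v \<in> snk \<Longrightarrow> ?st v = 2 \<Longrightarrow> v = ?t" for v using f(4) by blast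
    show "v < n \<Longrightarrow> ?st v = 2 \<Longrightarrow> \<tau> v \<le> \<tau> ?t" for v using f(5) by blast
    show "v < n \<Longrightarrow> ?st v = 2 \<Longrightarrow> ?p v = p v + ?lab v" for v by simp
    show "cert {..<n} (D Omega1) (f Omega1) (side_dom n c (D Omega2)) (side_fun n c (f Omega2)) X T src snk ?p (lam + ?lab ?t)"
      by (fact f)
  qed
  have b: "ivar s ''n'' = n" "bits n (iarr s ''X1'') X" "bits n (iarr s ''X2'') (side n c T)"
    "bits n (iarr s ''SR'') src" "bits n (iarr s ''SK'') snk" "\<forall>v<n. rarr s ''P'' v = p v"
    using e by (auto simp: enc'_def enc_def)
  have tn: "?t < n" using f(2) snk by auto
  have "wpt (update_potential;; augment_path) s (\<lambda>t s'. augmented s' \<and> t \<le> 200 * real (n + 1))"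
    unfolding wpt_Seq update_potential_def
  proof (rule wpt_For[where Inv = "\<lambda>i s'. \<forall>v<n. rarr s' ''P'' v = (if v < i then ?p v else p v)" and T = "\<lambda>_. 20"], goal_cases)
    case 1
    then show ?case using b by simp
  next
    case (5 i s')
    have "iarr s' ''ST'' = ?st" "rarr s' ''D'' = ?lab" "ivar s' ''v'' = ?t" "i < n"
      using agreeD[OF 5(4)] 5(1) b by simp_all
    then show ?case using 5(2,3) by (auto simp: less_Suc_eq)
  next
    case (7 t1 s1)
    note ag = agreeD[OF 7(2)]
    have P1: "\<forall>v<n. rarr s1 ''P'' v = ?p v" using 7(1) b by simp
    have t1: "t1 \<le> 6 + 28 * real n" using 7(3) b by simp
    let ?s2 = "s1\<lparr>iarr := (iarr s1)(''SK'' := (iarr s1 ''SK'')(ivar s1 ''v'' := 0))\<rparr>"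
    let ?I = "\<lambda>s'. \<exists>A B. au.augment_inv (ivar s' ''v'') A B \<and> bits n (iarr s' ''X1'') A \<and> bits n (iarr s' ''X2'') (side n c B)"
    \<comment> \<open>The nodes settled before \<open>v\<close>. This set shrinks strictly from a
      node to its parent, which bounds the number of arcs on the path by \<open>n\<close>.\<close>
    let ?E = "\<lambda>v. {u. u < n \<and> ?st u = 2 \<and> \<tau> u < \<tau> v}"
    have fE: "finite (?E v)" for v by simp
    have "wpt (While (BNot (IEq (IArr ''PT'' (IVar ''v'')) (INum 0)))
       (IAssign ''u'' (IArr ''PA'' (IVar ''v''));;
        Cond (IEq (IArr ''PT'' (IVar ''v'')) (INum 1)) (flip ''X1'' ''u'';; flip ''X1'' ''v'') (flip ''X2'' ''u'';; flip ''X2'' ''v'');;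
        IAssign ''v'' (IVar ''u''))) ?s2 (\<lambda>t s'. augmented (s'\<lparr>iarr := (iarr s')(''SR'' := (iarr s' ''SR'')(ivar s' ''v'' := 0))\<rparr>) \<and>
           t \<le> 60 * real n + 10)"
    proof (rule wpt_While[where Inv = ?I and \<Phi> = "\<lambda>s'. 60 * real (card (?E (ivar s' ''v'')))"], goal_cases)
      case 1
      show ?case by (rule exI[of _ X], rule exI[of _ T]) (use au.augment_inv_init ag b in simp)
    next
      case (2 s3)
      have st3: "iarr s3 ''PT'' = ?pt" "iarr s3 ''PA'' = ?par"
        using agreeD[OF 2(2)] ag by simp_all
      define v where "v = ivar s3 ''v''"
      define u where "u = ?par v"
      from 2(1) obtain A B where AB: "au.augment_inv v A B" "bits n (iarr s3 ''X1'') A" "bits n (iarr s3 ''X2'') (side n c B)"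
        by (auto simp: v_def)
      have pv: "?pt v \<noteq> 0" using 2(3) st3 by (simp add: v_def)
      then have vs: "v \<notin> src" using search_invD(1)[OF f(1)] by auto
      note stp = au.augment_inv_step[OF AB(1) vs u_def]
      have "u \<in> ?E v" "u \<notin> ?E u" "?E u \<subseteq> ?E v" using stp(1-3) by auto
      then have "card (?E u) < card (?E v)" by (intro psubset_card_mono) auto
      then have E: "60 * real (card (?E u)) + 60 \<le> 60 * real (card (?E v))" by simp
      have "?pt v = 1 \<or> ?pt v = 2" using stp(4) by (auto simp: arc_def)
      then show ?case
      proof
        assume p1: "?pt v = 1"
        note q = stp(7)[OF p1]
        let ?a = "iarr s3 ''X1''"
        let ?a1 = "?a(u := 1 - ?a u)"
        have "bits n (?a1(v := 1 - ?a1 v)) (toggle v (toggle u A))"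
          by (intro bits_toggle AB(2) stp)
        moreover have "toggle v (toggle u A) = insert v (A - {u})" using toggle_swap q by fast
        ultimately have "bits n (?a1(v := 1 - ?a1 v)) (insert v (A - {u}))" by simp
        then have "\<exists>A' B'. au.augment_inv u A' B' \<and> bits n (?a1(v := 1 - ?a1 v)) A' \<and> bits n (iarr s3 ''X2'') (side n c B')"
          using q AB(3) by blast
        then show ?case using p1 E stp(5) by (simp add: st3 v_def[symmetric] u_def[symmetric])
      next
        assume p2: "?pt v = 2"
        note q = stp(8)[OF p2]
        let ?a = "iarr s3 ''X2''"
        let ?a1 = "?a(u := 1 - ?a u)"
        have "bits n (?a1(v := 1 - ?a1 v)) (toggle v (toggle u (side n c B)))"
          by (intro bits_toggle AB(3) stp)
        moreover have "toggle v (toggle u B) = insert u (B - {v})" using toggle_swap2 q by fast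
        then have "toggle v (toggle u (side n c B)) = side n c (insert u (B - {v}))"
          using stp by (simp add: toggle_side)
        ultimately have "bits n (?a1(v := 1 - ?a1 v)) (side n c (insert u (B - {v})))" by simp
        then have "\<exists>A' B'. au.augment_inv u A' B' \<and> bits n (iarr s3 ''X1'') A' \<and> bits n (?a1(v := 1 - ?a1 v)) (side n c B')"
          using q AB(2) by blast
        then show ?case using p2 E stp(5) by (simp add: st3 v_def[symmetric] u_def[symmetric])
      qed
    next
      case (4 t2 s3)
      have st3: "iarr s3 ''PT'' = ?pt" "iarr s3 ''SR'' = iarr s ''SR''" "iarr s3 ''SK'' = (iarr s ''SK'')(?t := 0)" "rarr s3 ''P'' = rarr s1 ''P''"
        using agreeD[OF 4(2)] ag by simp_all
      define v where "v = ivar s3 ''v''"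
      from 4(1) obtain A B where AB: "au.augment_inv v A B" "bits n (iarr s3 ''X1'') A" "bits n (iarr s3 ''X2'') (side n c B)"
        by (auto simp: v_def)
      have vn: "v < n" "?st v = 2" using AB(1) by (auto simp: au.augment_inv_def)
      have "?pt v = 0" using 4(3) st3 by (simp add: v_def)
      then have "v \<in> src" using search_invD(2)[OF f(1) vn(1)] vn(2) by (auto simp: arc_def)
      note fin = au.augment_inv_final[OF AB(1) this]
      have "bits n ((iarr s ''SR'')(v := 0)) (src - {v})" "bits n ((iarr s ''SK'')(?t := 0)) (snk - {?t})"
        using b(4,5) by (auto simp: bits_def)
      then have "augmented (s3\<lparr>iarr := (iarr s3)(''SR'' := (iarr s3 ''SR'')(ivar s3 ''v'' := 0))\<rparr>)"
        unfolding augmented_def using fin AB(2,3) P1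
        by (intro exI[of _ A] exI[of _ B] exI[of _ "src - {v}"] exI[of _ "snk - {?t}"] exI[of _ ?p] exI[of _ "lam + ?lab ?t"])
          (simp add: st3 v_def[symmetric])
      moreover have "card (?E ?t) \<le> card {..<n}" by (intro card_mono) auto
      then have "t2 \<le> 60 * real n + 10" using 4(4) ag(1)[of "''v''"] by simp
      ultimately show ?case by blast
    qed auto
    then show ?case
      unfolding augment_path_def using t1 by (simp, elim wpt_mono) simp
  qed auto
  then show ?thesis by (rule wpt_mono_agree) (use post in simp)
qed

end

section \<open>Rounds of augmentation up to the required size\<close>

definition solve_loop :: com where
  "solve_loop = While (BAnd (IEq (IVar ''found'') (INum 1)) (ILess (IVar ''m'') (IVar ''kk'')))
     (prepare;; search_loop;;
      Cond (IEq (IVar ''go'') (INum 2))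
       ((update_potential;; augment_path);; IAssign ''m'' (IAdd (IVar ''m'') (INum 1)))
       (IAssign ''found'' (INum 0)))"

text \<open>Nothing is matched at the start: all of \<open>X\<close> are sources and all of
  \<open>T\<close> are sinks. With potential 0 the certificate then says just that both sets are
  minimizers.\<close>

definition solve :: com where
  "solve =
     For ''y'' ''n'' (RStore ''P'' (IVar ''y'') (RNum 0);; IStore ''SR'' (IVar ''y'') (IArr ''X1'' (IVar ''y''));;
       Cond (IEq (IArr ''X2'' (IVar ''y'')) (IVar ''c'')) (IStore ''SK'' (IVar ''y'') (INum 1)) (IStore ''SK'' (IVar ''y'') (INum 0)));;
     IAssign ''found'' (INum 1);; IAssign ''m'' (INum 0);; solve_loop"

abbreviation work_vars :: "vname set" where
  "work_vars \<equiv> {''b'', ''v'', ''ST'', ''go'', ''nd'', ''D'', ''PA'', ''PT'', ''X1'', ''X2'', ''qf'', ''qv'', ''j'', ''y'',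
     ''ta'', ''tb'', ''TR'', ''h'', ''w1'', ''w2'', ''nl'', ''L'', ''P'', ''SK'', ''SR'', ''u'', ''m'', ''found''}"

lemma mods_solve_loop [simp]: "mods solve_loop = work_vars"
  by (auto simp: solve_loop_def)

lemma mods_solve [simp]: "mods solve = work_vars"
  by (auto simp: solve_def)

context solver
begin

abbreviation "D1 \<equiv> D Omega1"
abbreviation "f1 \<equiv> f Omega1"
abbreviation "D2 \<equiv> side_dom n c (D Omega2)"
abbreviation "f2 \<equiv> side_fun n c (f Omega2)"

lemma vm_side: "vm D2 f2"
proof (cases "c = 1")
  case True
  then have "D2 = D Omega2" "f2 = f Omega2" using D_sub[of _ Omega2] by (auto simp: side_dom_def side_fun_def side_def)
  then show ?thesis using vm by simp
next
  case False
  have "vm {T. T \<subseteq> {..<n} \<and> {..<n} - T \<in> D Omega2} (\<lambda>T. f Omega2 ({..<n} - T))"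
    by (rule vm_compl[OF vm]) (use D_sub in auto)
  then show ?thesis using False by (simp add: side_dom_def side_fun_def side_def)
qed

lemma card_side_eq:
  assumes "S \<in> D2" "S' \<in> D2"
  shows "card S = card S'"
proof (cases "c = 1")
  case True
  then show ?thesis using assms card_eq[of S Omega2 S'] by (simp add: side_dom_def side_def)
next
  case False
  then have a: "S \<subseteq> {..<n}" "S' \<subseteq> {..<n}" "card ({..<n} - S) = card ({..<n} - S')"
    using assms card_eq by (auto simp: side_dom_def side_def)
  then have "card S \<le> n" "card S' \<le> n" using card_mono[of "{..<n}"] by (metis card_lessThan finite_lessThan)+
  moreover have "n - card S = n - card S'" using a by (simp add: card_Diff_subset finite_subset[of _ "{..<n}"])
  ultimately show ?thesis by linarith
qed

text \<open>\<open>0 \<le> lam\<close> is stated separately, because on an empty ground set the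
  bounds on \<open>p\<close> say nothing about \<open>lam\<close>. The matched part of size
  \<open>j\<close> can be smaller than \<open>X \<inter> T\<close>, since an element may be a source
  and a sink at once.\<close>

definition state_cert :: "nat \<Rightarrow> real \<Rightarrow> nat set \<Rightarrow> nat set \<Rightarrow> state \<Rightarrow> bool" where
  "state_cert j lam X T s \<longleftrightarrow> 0 \<le> lam \<and> ivar s ''n'' = n \<and> ivar s ''c'' = c \<and>
     bits n (iarr s ''X1'') X \<and> bits n (iarr s ''X2'') (side n c T) \<and>
     (\<exists>src snk p. cert {..<n} D1 f1 D2 f2 X T src snk p lam \<and> card (X - src) = j \<and>
       bits n (iarr s ''SR'') src \<and> bits n (iarr s ''SK'') snk \<and> (\<forall>v<n. rarr s ''P'' v = p v))"

lemma state_cert_mem: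
  assumes "state_cert j lam X T s"
  shows "X \<in> D1" "T \<in> D2" "X \<subseteq> {..<n}" "T \<subseteq> {..<n}" "j \<le> card X" "j \<le> card (X \<inter> T)"
proof -
  from assms obtain src snk p where c: "cert {..<n} D1 f1 D2 f2 X T src snk p lam" "card (X - src) = j"
    by (auto simp: state_cert_def)
  show XT: "X \<in> D1" "T \<in> D2" using c by (auto simp: cert_def argmin_def)
  show sub: "X \<subseteq> {..<n}" "T \<subseteq> {..<n}" using XT D_sub by (auto simp: side_dom_def)
  then have fin: "finite X" using finite_subset by blast
  then show "j \<le> card X" using c(2) by (auto intro: card_mono)
  have "X - src \<subseteq> X \<inter> T" using c by (auto simp: cert_def)
  then show "j \<le> card (X \<inter> T)" using c(2) fin by (auto intro: card_mono)
qed

lemma state_cert_bound: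
  assumes "state_cert j lam X T s" "Z1 \<in> D1" "Z2 \<in> D2"
  shows "f1 X + f2 T + lam * (real (card (Z1 \<inter> Z2)) - real j) \<le> f1 Z1 + f2 Z2"
proof -
  from assms obtain src snk p where c: "cert {..<n} D1 f1 D2 f2 X T src snk p lam" "card (X - src) = j"
    by (auto simp: state_cert_def)
  show ?thesis unfolding c(2)[symmetric]
    by (rule cert_bound[OF c(1)])
      (use D_sub card_side_eq[OF _ state_cert_mem(2)[OF assms(1)]] assms(2,3) in \<open>auto simp: side_dom_def\<close>)
qed

abbreviation lgn :: real where "lgn \<equiv> max 1 (log 2 (real n))"

definition round_time :: "nat \<Rightarrow> real" where
  "round_time r = 1600 * G * real (n + 1) * real (r + 1) + 300 * lgn * real (n + 1)"

text \<open>The disjunction on \<open>card T\<close> covers both representations of the second set.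
  Success is phrased through the augmentation that follows, so that the predicates
  \<open>found\<close> and \<open>infeasible\<close>, which belong to one fixed search, do not occur
  in the statement.\<close>

lemma wpt_round:
  assumes s: "state_cert j lam X T s" and r: "card X \<le> r" "card T \<le> r \<or> n - card T \<le> r"
    and fail: "\<And>t s'. ivar s' ''go'' = 0 \<Longrightarrow> (\<And>Z1 Z2. Z1 \<in> D1 \<Longrightarrow> Z2 \<in> D2 \<Longrightarrow> card (Z1 \<inter> Z2) \<le> j) \<Longrightarrow>
      t + 30 \<le> round_time r \<Longrightarrow> agree work_vars s s' \<Longrightarrow> ivar s' ''m'' = ivar s ''m'' \<Longrightarrow> ivar s' ''found'' = ivar s ''found'' \<Longrightarrow> Q t s'"
    and success: "\<And>t s'. ivar s' ''go'' = 2 \<Longrightarrow>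
      wpt (update_potential;; augment_path) s' (\<lambda>t' s''. (\<exists>X' T' lam'. state_cert (Suc j) lam' X' T' s'') \<and>
        agree work_vars s s'' \<and> t + t' + 30 \<le> round_time r \<and> ivar s'' ''m'' = ivar s ''m'' \<and> ivar s'' ''found'' = ivar s ''found'') \<Longrightarrow> Q t s'"
  shows "wpt (prepare;; search_loop) s Q"
proof -
  from s obtain src snk p where c: "cert {..<n} D1 f1 D2 f2 X T src snk p lam" "card (X - src) = j"
    and b: "bits n (iarr s ''SR'') src" "bits n (iarr s ''SK'') snk" "\<forall>v<n. rarr s ''P'' v = p v"
    "ivar s ''n'' = n" "ivar s ''c'' = c" "bits n (iarr s ''X1'') X" "bits n (iarr s ''X2'') (side n c T)"
    by (auto simp: state_cert_def)
  note XT = state_cert_mem[OF s]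
  interpret se: search n \<gamma> D f \<Omega> c X T src snk p lam
  proof
    show "vm D1 f1" "vm D2 f2" by (fact vm vm_side)+
    show "Z \<in> D1 \<Longrightarrow> card Z = card X" for Z using card_eq XT(1) by blast
    show "Z \<in> D2 \<Longrightarrow> card Z = card T" for Z using card_side_eq XT(2) by blast
    show "cert {..<n} D1 f1 D2 f2 X T src snk p lam" by (fact c)
  qed (use D_sub in \<open>auto simp: side_dom_def\<close>)
  have e: "se.enc s" using b by (simp add: se.enc_def)
  have time: "200 * G * real (n + 1) + ((300 * G * real (card T + 1) + 140 * lgn) * (2 + real (card (X \<union> ({..<n} - T)))) +
      250 * G * real (n + 1) * real (card X)) + 200 * real (n + 1) + 30 \<le> round_time r"
  proof -
    have sub: "X \<union> ({..<n} - T) \<subseteq> {..<n}" using XT by auto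
    have q1: "card (X \<union> ({..<n} - T)) \<le> n" using card_mono[OF _ sub] by simp
    have q2: "card (X \<union> ({..<n} - T)) \<le> card X + (n - card T)"
      using card_Un_le[of X "{..<n} - T"] XT(4) by (simp add: card_Diff_subset finite_subset[of _ "{..<n}"])
    have tn: "card T \<le> n" using XT(4) card_mono[of "{..<n}" T] by simp
    have "(card T + 1) * (2 + card (X \<union> ({..<n} - T))) \<le> 2 * ((n + 1) * (r + 1))"
    proof (cases "card T \<le> r")
      case True
      then have "(card T + 1) * (2 + card (X \<union> ({..<n} - T))) \<le> (r + 1) * (2 + n)"
        using q1 by (intro mult_mono) auto
      also have "\<dots> \<le> 2 * ((n + 1) * (r + 1))" by (simp add: algebra_simps)
      finally show ?thesis .
    next
      case False
      then have "(card T + 1) * (2 + card (X \<union> ({..<n} - T))) \<le> (n + 1) * (2 + (r + r))"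
        using q2 r tn by (intro mult_mono) auto
      also have "\<dots> = 2 * ((n + 1) * (r + 1))" by simp
      finally show ?thesis .
    qed
    then have "real ((card T + 1) * (2 + card (X \<union> ({..<n} - T)))) \<le> real (2 * ((n + 1) * (r + 1)))"
      by (rule of_nat_mono)
    then have a1: "real (card T + 1) * (2 + real (card (X \<union> ({..<n} - T)))) \<le> 2 * (real (n + 1) * real (r + 1))"
      by (simp only: of_nat_mult of_nat_add of_nat_numeral of_nat_1)
    have a: "300 * G * (real (card T + 1) * (2 + real (card (X \<union> ({..<n} - T))))) \<le> 300 * G * (2 * (real (n + 1) * real (r + 1)))"
      using a1 G1 by (intro mult_left_mono) auto
    have b: "140 * lgn * (2 + real (card (X \<union> ({..<n} - T)))) \<le> 140 * lgn * (2 * real (n + 1))"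
      using q1 by (intro mult_left_mono) auto
    have c: "250 * G * real (n + 1) * real (card X) \<le> 250 * G * real (n + 1) * real (r + 1)"
      using r G1 by (intro mult_left_mono) auto
    let ?N = "real (n + 1)" and ?R = "real (r + 1)"
    have d: "?N * 1 \<le> ?N * ?R" by (intro mult_left_mono) auto
    have e: "G * (?N * 1) \<le> G * (?N * ?R)" using d G1 by (intro mult_left_mono) auto
    have "1 * (?N * 1) \<le> G * (?N * ?R)" using d G1 by (intro mult_mono) auto
    then have f: "?N \<le> G * (?N * ?R)" by (simp only: mult_1 mult_1_right)
    have "1 * 1 \<le> lgn * ?N" by (intro mult_mono) auto
    then have g: "1 \<le> lgn * ?N" by (simp only: mult_1)
    have N: "1 \<le> ?N" by simp
    have arith: "200 * M + ((A + B) + C) + 200 * N + 30 \<le> 1600 * E + 300 * F"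
      if "A \<le> 600 * E" "B \<le> 280 * F" "C \<le> 250 * E" "M \<le> E" "N \<le> E" "1 \<le> F" "1 \<le> N" for A B C E F M N :: real
      using that by linarith
    have sp: "(300 * G * real (card T + 1) + 140 * lgn) * (2 + real (card (X \<union> ({..<n} - T)))) =
       300 * G * (real (card T + 1) * (2 + real (card (X \<union> ({..<n} - T))))) + 140 * lgn * (2 + real (card (X \<union> ({..<n} - T))))"
      by (simp add: algebra_simps)
    have e1: "300 * G * (2 * (?N * ?R)) = 600 * (G * (?N * ?R))" "250 * G * ?N * ?R = 250 * (G * (?N * ?R))"
      "200 * G * ?N = 200 * (G * (?N * 1))" "140 * lgn * (2 * ?N) = 280 * (lgn * ?N)"
      "1600 * G * ?N * ?R = 1600 * (G * (?N * ?R))" "300 * lgn * ?N = 300 * (lgn * ?N)"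
      by simp_all
    show ?thesis
      unfolding round_time_def sp e1
      by (rule arith[OF a[unfolded e1] b[unfolded e1] c[unfolded e1] e f g N])
  qed
  have sum2: "t1 + t2 + 30 \<le> R" if "A + B + E + 30 \<le> R" "t1 \<le> A" "t2 \<le> B" "0 \<le> E" for t1 t2 A B E R :: real
    using that by linarith
  have sum3: "t1 + t2 + t3 + 30 \<le> R" if "A + B + E + 30 \<le> R" "t1 \<le> A" "t2 \<le> B" "t3 \<le> E" for t1 t2 t3 A B E R :: real
    using that by linarith
  show ?thesis
    unfolding wpt_Seq
  proof (rule se.wpt_prepare[OF e], goal_cases)
    case (1 t1 s1)
    have ag1: "agree work_vars s s1" by (rule agree_mono[OF 1(5)]) auto
    show ?case
    proof (rule se.wpt_search_loop[OF 1(1-3)], goal_cases)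
      case (1 t2 s2)
      have ag2: "agree work_vars s s2" by (rule agree_trans[OF ag1], rule agree_mono[OF 1(4)]) auto
      have mf: "ivar s2 ''m'' = ivar s ''m''" "ivar s2 ''found'' = ivar s ''found''"
        using agreeD(1)[OF 1(4)] agreeD(1)[OF \<open>agree (mods prepare) s s1\<close>] by simp_all
      from 1(2) show ?case
      proof
        assume h: "ivar s2 ''go'' = 0 \<and> se.infeasible"
        show ?thesis
        proof (rule fail)
          show "ivar s2 ''go'' = 0" "agree work_vars s s2" "ivar s2 ''m'' = ivar s ''m''" "ivar s2 ''found'' = ivar s ''found''"
            using h ag2 mf by auto
          show "card (Z1 \<inter> Z2) \<le> j" if "Z1 \<in> D1" "Z2 \<in> D2" for Z1 Z2
            using h that c(2) by (auto simp: se.infeasible_def)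
          show "t1 + t2 + 30 \<le> round_time r" by (rule sum2[OF time \<open>t1 \<le> _\<close> 1(3)]) simp
        qed
      next
        assume h: "ivar s2 ''go'' = 2 \<and> se.found s2"
        show ?thesis
        proof (rule success[OF conjunct1[OF h]], rule se.wpt_augment[OF 1(1) conjunct2[OF h]], goal_cases)
          case (1 t3 s3)
          have ag3: "agree work_vars s s3" by (rule agree_trans[OF ag2], rule agree_mono[OF 1(3)]) auto
          from 1(1) obtain X' T' src' snk' p' lam' where au:
            "cert {..<n} D1 f1 D2 f2 X' T' src' snk' p' lam'" "card (X' - src') = Suc (card (X - src))"
            "bits n (iarr s3 ''X1'') X'" "bits n (iarr s3 ''X2'') (side n c T')"
            "bits n (iarr s3 ''SR'') src'" "bits n (iarr s3 ''SK'') snk'" "\<forall>v<n. rarr s3 ''P'' v = p' v"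
            unfolding se.augmented_def by blast
          \<comment> \<open>The matched part is nonempty, hence so is the ground set, and
            \<open>0 \<le> lam'\<close> can be read off the bounds on the potential at 0.\<close>
          have "X' \<subseteq> {..<n}" using au(3) by (simp add: bits_def)
          moreover have "X' - src' \<noteq> {}" using au(2) by (metis card.empty nat.distinct(1))
          ultimately have "n \<noteq> 0" by auto
          then have "0 \<le> p' 0 \<and> p' 0 \<le> lam'" using au(1) by (auto simp: cert_def)
          then have "0 \<le> lam'" by linarith
          moreover have "\<exists>src snk p. cert {..<n} D1 f1 D2 f2 X' T' src snk p lam' \<and> card (X' - src) = Suc j \<and>
             bits n (iarr s3 ''SR'') src \<and> bits n (iarr s3 ''SK'') snk \<and> (\<forall>v<n. rarr s3 ''P'' v = p v)"
            by (rule exI[of _ src'], rule exI[of _ snk'], rule exI[of _ p']) (use au c(2) in simp)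
          moreover have "ivar s3 ''n'' = n" "ivar s3 ''c'' = c" using agreeD(1)[OF ag3] b by simp_all
          ultimately have "state_cert (Suc j) lam' X' T' s3"
            unfolding state_cert_def using au(3,4) by blast
          moreover have "t1 + t2 + t3 + 30 \<le> round_time r"
            by (rule sum3[OF time \<open>t1 \<le> _\<close> \<open>t2 \<le> _\<close> 1(2)])
          ultimately show ?case using ag3 agreeD(1)[OF 1(3)] mf by auto
        qed
      qed
    qed
  qed
qed

lemma state_cert_init:
  assumes "ivar s ''n'' = n" "ivar s ''c'' = c" "bits n (iarr s ''X1'') X" "bits n (iarr s ''X2'') (side n c T)"
    "bits n (iarr s ''SR'') X" "bits n (iarr s ''SK'') T" "\<forall>v<n. rarr s ''P'' v = 0"
    and opt: "X \<in> argmin D1 f1" "T \<in> argmin D2 f2"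
  shows "state_cert 0 0 X T s"
proof -
  have "X \<subseteq> {..<n}" "T \<subseteq> {..<n}" using opt D_sub by (auto simp: argmin_def side_dom_def)
  then have "cert {..<n} D1 f1 D2 f2 X T X T (\<lambda>_. 0) 0" using opt by (simp add: cert_def)
  then show ?thesis
    unfolding state_cert_def using assms(1-7)
    by (intro conjI exI[of _ X] exI[of _ T] exI[of _ "\<lambda>_. 0"]) auto
qed

text \<open>Each success enlarges the matched part, which is contained in a set of constant size at
  most \<open>r\<close>, so there are at most \<open>min K r\<close> successes; the summand 1 pays
  for a round that fails. For \<open>K > r\<close> the loop therefore ends by infeasibility and not
  by its counter.\<close>

lemma wpt_solve:
  assumes n: "ivar s ''n'' = n" "ivar s ''c'' = c" "ivar s ''kk'' = K"
    and b: "bits n (iarr s ''X1'') X" "bits n (iarr s ''X2'') (side n c T)"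
    and opt: "X \<in> argmin D1 f1" "T \<in> argmin D2 f2"
    and r: "card X \<le> r" "card T \<le> r \<or> n - card T \<le> r"
    and post: "\<And>t s'. ivar s' ''found'' = 1 \<and> (\<exists>X' T' lam. state_cert K lam X' T' s') \<or>
        ivar s' ''found'' = 0 \<and> (\<forall>Z1\<in>D1. \<forall>Z2\<in>D2. card (Z1 \<inter> Z2) < K) \<Longrightarrow>
      t \<le> 50 * real (n + 1) + round_time r * real (min K r + 1) \<Longrightarrow>
      agree work_vars s s' \<Longrightarrow> Q t s'"
  shows "wpt solve s Q"
proof -
  let ?I = "\<lambda>s. ivar s ''kk'' = K \<and>
     (ivar s ''found'' = 1 \<and> (\<exists>X T lam. state_cert (ivar s ''m'') lam X T s \<and> card X \<le> r \<and> (card T \<le> r \<or> n - card T \<le> r)) \<and> ivar s ''m'' \<le> min K r \<or>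
      ivar s ''found'' = 0 \<and> (\<forall>Z1\<in>D1. \<forall>Z2\<in>D2. card (Z1 \<inter> Z2) < K))"
  let ?\<Phi> = "\<lambda>s. if ivar s ''found'' = 1 then round_time r * real (min K r + 1 - ivar s ''m'') else 0"
  have rt0: "0 \<le> round_time r" using G1 unfolding round_time_def by (intro add_nonneg_nonneg mult_nonneg_nonneg) auto
  have "wpt solve s (\<lambda>t s'. (ivar s' ''found'' = 1 \<and> (\<exists>X' T' lam. state_cert K lam X' T' s') \<or>
        ivar s' ''found'' = 0 \<and> (\<forall>Z1\<in>D1. \<forall>Z2\<in>D2. card (Z1 \<inter> Z2) < K)) \<and>
      t \<le> 50 * real (n + 1) + round_time r * real (min K r + 1))"
    unfolding solve_def wpt_Seq
  proof (rule wpt_For[where Inv = "\<lambda>i s'. \<forall>v<i. rarr s' ''P'' v = 0 \<and> iarr s' ''SR'' v = iarr s ''X1'' v \<and>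
        iarr s' ''SK'' v = (if v \<in> T then 1 else 0)" and T = "\<lambda>_. 20"], goal_cases)
    case (5 i s')
    have st: "ivar s' ''c'' = c" "iarr s' ''X2'' = iarr s ''X2''" "iarr s' ''X1'' = iarr s ''X1''" "i < n"
      using agreeD[OF 5(4)] 5(1) n by simp_all
    have "iarr s ''X2'' i = c \<longleftrightarrow> i \<in> T" using bits_side[OF b(2) c st(4)] .
    then show ?case using 5(2,3) st by (auto simp: less_Suc_eq)
  next
    case (7 t1 s1)
    note ag = agreeD[OF 7(2)]
    have st: "ivar s1 ''n'' = n" "ivar s1 ''c'' = c" "ivar s1 ''kk'' = K" "iarr s1 ''X1'' = iarr s ''X1''" "iarr s1 ''X2'' = iarr s ''X2''"
      using ag n by simp_all
    have t1: "t1 \<le> 6 + 28 * real n" using 7(3) n by simp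
    have Tn: "T \<subseteq> {..<n}" using opt(2) by (auto simp: argmin_def side_dom_def)
    have SR: "bits n (iarr s1 ''SR'') X" and SK: "bits n (iarr s1 ''SK'') T" and P: "\<forall>v<n. rarr s1 ''P'' v = 0"
      using 7(1) b(1) n Tn by (auto simp: bits_def)
    let ?s2 = "s1\<lparr>ivar := (ivar s1)(''found'' := 1, ''m'' := 0)\<rparr>"
    have I2: "?I ?s2"
      using state_cert_init[of ?s2 X T] st SR SK P b opt r by auto
    have "wpt solve_loop ?s2 (\<lambda>t s'. (ivar s' ''found'' = 1 \<and> (\<exists>X' T' lam. state_cert K lam X' T' s') \<or>
        ivar s' ''found'' = 0 \<and> (\<forall>Z1\<in>D1. \<forall>Z2\<in>D2. card (Z1 \<inter> Z2) < K)) \<and>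
      t \<le> round_time r * real (min K r + 1) + 10)"
      unfolding solve_loop_def
    proof (rule wpt_While[where Inv = ?I and \<Phi> = ?\<Phi>, OF I2], goal_cases)
      case (1 s3)
      have f3: "ivar s3 ''found'' = 1" "ivar s3 ''m'' < K" using 1(1,3) by auto
      then obtain X T lam where sc: "state_cert (ivar s3 ''m'') lam X T s3" "card X \<le> r" "card T \<le> r \<or> n - card T \<le> r"
        and m: "ivar s3 ''m'' \<le> r" and kk: "ivar s3 ''kk'' = K" using 1(1) by auto
      let ?m = "ivar s3 ''m''"
      have \<Phi>3: "?\<Phi> s3 = round_time r + round_time r * real (min K r - ?m)"
        using f3 m by (simp add: Suc_diff_le algebra_simps)
      have p0: "0 \<le> round_time r * real (min K r - ?m)" using rt0 by simp
      have assoc: "wpt (a;; b;; c) s Q \<longleftrightarrow> wpt ((a;; b);; c) s Q" for a b c s Q by (simp add: add.assoc)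
      show ?case
        unfolding assoc[of prepare] wpt_Seq[of "prepare;; search_loop"]
      proof (rule wpt_round[OF sc], goal_cases)
        case (1 t s4)
        have "ivar s4 ''kk'' = K" using agreeD(1)[OF 1(4), of "''kk''"] kk by simp
        moreover have "card (Z1 \<inter> Z2) < K" if "Z1 \<in> D1" "Z2 \<in> D2" for Z1 Z2
          using 1(2)[OF that] f3(2) by linarith
        moreover have "t + 30 \<le> ?\<Phi> s3" using 1(3) \<Phi>3 p0 by linarith
        ultimately show ?case using 1(1) by auto
      next
        case (2 t s4)
        have "wpt ((update_potential;; augment_path);; IAssign ''m'' (IAdd (IVar ''m'') (INum 1))) s4
          (\<lambda>t' s'. ?I s' \<and> 20 + (t + t') + ?\<Phi> s' \<le> ?\<Phi> s3)"
          unfolding wpt_Seq[of "update_potential;; augment_path"] wpt_IAssign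
        proof (rule wpt_mono[OF 2(2)], elim conjE exE)
          fix t' s5 X' T' lam'
          assume h: "state_cert (Suc ?m) lam' X' T' s5" "agree work_vars s3 s5" "t + t' + 30 \<le> round_time r"
            "ivar s5 ''m'' = ?m" "ivar s5 ''found'' = ivar s3 ''found''"
          let ?s6 = "s5\<lparr>ivar := (ivar s5)(''m'' := ival (IAdd (IVar ''m'') (INum 1)) s5)\<rparr>"
          have m6: "ivar ?s6 ''m'' = Suc ?m" "ivar ?s6 ''found'' = 1" "ivar ?s6 ''kk'' = K"
            using h(4,5) f3 kk agreeD(1)[OF h(2), of "''kk''"] by simp_all
          have sc6: "state_cert (Suc ?m) lam' X' T' ?s6" using h(1) by (simp add: state_cert_def)
          have "card X' = card X" "card T' = card T"
            using card_eq[OF state_cert_mem(1)[OF h(1)] state_cert_mem(1)[OF sc(1)]]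
              card_side_eq[OF state_cert_mem(2)[OF h(1)] state_cert_mem(2)[OF sc(1)]] by simp_all
          moreover have "Suc ?m \<le> card X'" using state_cert_mem(5)[OF h(1)] .
          ultimately have "\<exists>X T lam. state_cert (ivar ?s6 ''m'') lam X T ?s6 \<and> card X \<le> r \<and> (card T \<le> r \<or> n - card T \<le> r)"
            and "ivar ?s6 ''m'' \<le> min K r"
            using sc6 sc(2,3) f3(2) unfolding m6(1) by (metis, simp)
          then have "?I ?s6" using m6(2,3) by blast
          moreover have "?\<Phi> ?s6 = round_time r * real (min K r - ?m)" using m6 by simp
          ultimately show "?I ?s6 \<and> 20 + (t + (t' + (1 + real (icost (IAdd (IVar ''m'') (INum 1)))))) + ?\<Phi> ?s6 \<le> ?\<Phi> s3"
            using h(3) \<Phi>3 by simp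
        qed
        note W = this
        have bg: "bval (IEq (IVar ''go'') (INum 2)) s4" using 2(1) by simp
        show ?case
          unfolding wpt_Cond if_P[OF bg]
        proof (rule wpt_mono[OF W], rule conjI, erule conjunct1, drule conjunct2, goal_cases)
          case (1 t' s5)
          then show ?case unfolding bcost.simps icost.simps by linarith
        qed
      qed
    next
      case (2 s3)
      then show ?case using rt0 by simp
    next
      case (3 t s3)
      have "0 \<le> ?\<Phi> s3" using rt0 by simp
      then have t: "t \<le> round_time r * real (min K r + 1) + 10" using 3(4) by simp
      show ?case
      proof (cases "ivar s3 ''found'' = 1")
        case True
        then have "ivar s3 ''m'' = K" using 3(1,3) by auto
        then show ?thesis using True 3(1) t by auto
      next
        case False
        then show ?thesis using 3(1) t by auto
      qed
    qed
    then show ?case using t1 by (simp, elim wpt_mono) auto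
  qed auto
  then show ?thesis by (rule wpt_mono_agree) (use post in simp)
qed

end

section \<open>Walks between minimizers\<close>

definition count_both :: com where
  "count_both = IAssign ''cnt'' (INum 0);;
     For ''y'' ''n'' (IfT (BAnd (IEq (IArr ''X1'' (IVar ''y'')) (INum 1)) (IEq (IArr ''X2'' (IVar ''y'')) (IVar ''c'')))
       (IAssign ''cnt'' (IAdd (IVar ''cnt'') (INum 1))))"

text \<open>Any element of \<open>z\<close> outside \<open>x\<close> whose exchange with
  \<open>i\<close> keeps the minimum value \<open>mv\<close> will do, so simply the last one found
  is kept in \<open>bi\<close>.\<close>

definition walk_step :: "oracle_id \<Rightarrow> vname \<Rightarrow> vname \<Rightarrow> com" where
  "walk_step w x z =
     IAssign ''bi'' (IVar ''i'');;
     For ''j'' ''n'' (IfT (BAnd (IEq (IArr x (IVar ''j'')) (INum 0)) (IEq (IArr z (IVar ''j'')) (INum 1)))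
       (query_swap w x ''i'' ''j'';;
        IfT (BAnd (IEq (IVar ''qf'') (INum 1)) (REq (RVar ''qv'') (RVar ''mv''))) (IAssign ''bi'' (IVar ''j''))));;
     flip x ''i'';; flip x ''bi'';; count_both"

definition walk :: "oracle_id \<Rightarrow> vname \<Rightarrow> vname \<Rightarrow> com" where
  "walk w x z =
     Query w x ''qf'' ''mv'';;
     For ''i'' ''n'' (IfT (BAnd (BAnd (IEq (IArr x (IVar ''i'')) (INum 1)) (IEq (IArr z (IVar ''i'')) (INum 0)))
         (BNot (IEq (IVar ''cnt'') (IVar ''kk''))))
       (walk_step w x z))"

lemma mods_count_both [simp]: "mods count_both = {''cnt'', ''y''}"
  by (auto simp: count_both_def)

lemma mods_walk_step [simp]: "mods (walk_step w x z) = {x, ''bi'', ''j'', ''qf'', ''qv'', ''cnt'', ''y''}"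
  by (auto simp: walk_step_def)

lemma mods_walk [simp]: "mods (walk w x z) = {x, ''i'', ''mv'', ''bi'', ''j'', ''qf'', ''qv'', ''cnt'', ''y''}"
  by (auto simp: walk_def)

context solver
begin

lemma wpt_count_both:
  assumes n: "ivar s ''n'' = n" "ivar s ''c'' = c" and b: "bits n (iarr s ''X1'') X" "bits n (iarr s ''X2'') (side n c T)"
    and post: "\<And>t s'. ivar s' ''cnt'' = card (X \<inter> T) \<Longrightarrow> t \<le> 30 * real (n + 1) \<Longrightarrow> agree (mods count_both) s s' \<Longrightarrow> Q t s'"
  shows "wpt count_both s Q"
proof -
  have "X \<subseteq> {..<n}" using b by (simp add: bits_def)
  then have XT: "X \<inter> T \<inter> {..<n} = X \<inter> T" by auto
  have "X \<inter> T \<inter> {..<Suc i} = (if i \<in> X \<inter> T then insert i (X \<inter> T \<inter> {..<i}) else X \<inter> T \<inter> {..<i})" for i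
    by (auto simp: less_Suc_eq)
  then have cS: "card (X \<inter> T \<inter> {..<Suc i}) = card (X \<inter> T \<inter> {..<i}) + (if i \<in> X \<inter> T then 1 else 0)" for i
    by simp
  have "wpt count_both s (\<lambda>t s'. ivar s' ''cnt'' = card (X \<inter> T) \<and> t \<le> 30 * real (n + 1))"
    unfolding count_both_def wpt_Seq wpt_IAssign
  proof (rule wpt_For[where Inv = "\<lambda>i s'. ivar s' ''cnt'' = card (X \<inter> T \<inter> {..<i})" and T = "\<lambda>_. 14"], goal_cases)
    case (5 i s')
    have st: "ivar s' ''c'' = c" "iarr s' ''X2'' = iarr s ''X2''" "iarr s' ''X1'' = iarr s ''X1''" "i < n"
      using agreeD[OF 5(4)] 5(1) n by simp_all
    have "iarr s ''X2'' i = c \<longleftrightarrow> i \<in> T" using bits_side[OF b(2) c st(4)] .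
    moreover have "iarr s ''X1'' i = 1 \<longleftrightarrow> i \<in> X" using bits_iff[OF b(1) st(4)] by simp
    ultimately show ?case using 5(2,3) st cS[of i] by auto
  next
    case (7 t s')
    then show ?case using n XT by simp
  qed auto
  then show ?thesis by (rule wpt_mono_agree) (use post in simp)
qed

end

context machine
begin

text \<open>\<open>h\<close> is the size of the intersection as a function of the set being moved,
  the other one being fixed; keeping it abstract lets the same walk serve both sets. That a suitable
  element exists is the exchange property of minimizers, applied to \<open>S\<close> and the target
  \<open>Z\<close>.\<close>

lemma wpt_walk_step:
  assumes b: "bits n (iarr s x) S" "bits n (iarr s z) Z" and n: "ivar s ''n'' = n"
    and i: "ivar s ''i'' = i" "i \<in> S" "i \<notin> Z"
    and vm: "vm (D w) (f w)" and opt: "S \<in> argmin (D w) (f w)" "Z \<in> argmin (D w) (f w)"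
    and mv: "rvar s ''mv'' = f w S"
    and x: "x \<notin> {''i'', ''bi'', ''j'', ''qf'', ''qv'', ''n'', ''mv'', ''cnt'', ''y'', z}" "z \<notin> {''i'', ''bi'', ''j'', ''qf'', ''qv'', ''n'', ''mv'', ''cnt'', ''y''}"
    and count: "\<And>s' S' Q. agree {x, ''bi'', ''j'', ''qf'', ''qv''} s s' \<Longrightarrow> bits n (iarr s' x) S' \<Longrightarrow>
       (\<And>t s''. ivar s'' ''cnt'' = h S' \<Longrightarrow> t \<le> 30 * real (n + 1) \<Longrightarrow> agree {''cnt'', ''y''} s' s'' \<Longrightarrow> Q t s'') \<Longrightarrow>
       wpt count_both s' Q"
    and post: "\<And>t s' u. u \<in> Z \<Longrightarrow> u \<notin> S \<Longrightarrow> insert u (S - {i}) \<in> argmin (D w) (f w) \<Longrightarrow>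
       bits n (iarr s' x) (insert u (S - {i})) \<Longrightarrow> ivar s' ''cnt'' = h (insert u (S - {i})) \<Longrightarrow>
       t \<le> 150 * G * real (n + 1) \<Longrightarrow> agree (mods (walk_step w x z)) s s' \<Longrightarrow> Q t s'"
  shows "wpt (walk_step w x z) s Q"
proof -
  have "i < n" using b i by (auto simp: bits_def)
  let ?ex = "\<lambda>u. insert u (S - {i})"
  have am: "?ex u \<in> argmin (D w) (f w) \<longleftrightarrow> ?ex u \<in> D w \<and> f w (?ex u) = f w S" for u
    using opt(1) by (force simp: argmin_def)
  let ?J = "\<lambda>j s'. iarr s' x = iarr s x \<and>
     (ivar s' ''bi'' = i \<and> (\<forall>u<j. u \<in> Z \<and> u \<notin> S \<longrightarrow> ?ex u \<notin> argmin (D w) (f w)) \<or>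
      ivar s' ''bi'' \<in> Z \<and> ivar s' ''bi'' \<notin> S \<and> ?ex (ivar s' ''bi'') \<in> argmin (D w) (f w))"
  have "wpt (walk_step w x z) s (\<lambda>t s'. \<exists>u. u \<in> Z \<and> u \<notin> S \<and> ?ex u \<in> argmin (D w) (f w) \<and>
      bits n (iarr s' x) (?ex u) \<and> ivar s' ''cnt'' = h (?ex u) \<and> t \<le> 150 * G * real (n + 1))"
    unfolding walk_step_def wpt_Seq wpt_IAssign
  proof (rule wpt_For[where Inv = ?J and T = "\<lambda>_. 70 * G"], goal_cases)
    case 1
    then show ?case using i by simp
  next
    case (5 j s')
    note ag = agreeD[OF 5(4)]
    have j: "j < n" "ivar s' ''j'' = j" "ivar s' ''i'' = i" "rvar s' ''mv'' = f w S" "iarr s' z = iarr s z"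
      using 5(1,3) ag(1)[of "''i''"] ag(2)[of "''mv''"] ag(3)[of z] n i x mv by auto
    have bx: "bits n (iarr s' x) S" using 5(2) b by simp
    have xj: "iarr s' x j = (if j \<in> S then 1 else 0)" "iarr s' z j = (if j \<in> Z then 1 else 0)"
      using bits_iff[OF bx j(1)] bits_iff[OF b(2) j(1)] j(5) by simp_all
    have e: "?ex j = toggle (ivar s' ''j'') (toggle (ivar s' ''i'') S)" if "j \<notin> S" using toggle_swap i(2) that j by fastforce
    show ?case
    proof (cases "j \<in> Z \<and> j \<notin> S")
      case False
      then have "?J (Suc j) s'" using 5(2) less_Suc_eq by blast
      then show ?thesis using xj j False G1 by auto
    next
      case True
      have "wpt (query_swap w x ''i'' ''j'';;
        IfT (BAnd (IEq (IVar ''qf'') (INum 1)) (REq (RVar ''qv'') (RVar ''mv''))) (IAssign ''bi'' (IVar ''j''))) s'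
        (\<lambda>t s''. ?J (Suc j) s'' \<and> t \<le> 50 * G)"
      proof (cases "?ex j \<in> argmin (D w) (f w)")
        case am': True
        then have "?ex j \<in> D w" "f w (?ex j) = f w S" using am by auto
        then show ?thesis using True 5(2) j \<open>i < n\<close> \<gamma> am'
          by (simp add: wpt_query_swap[OF bx _ _ _ _ e] G_def)
      next
        case am': False
        then have J: "?J (Suc j) s'" using 5(2) less_Suc_eq by blast
        from am' am have "?ex j \<in> D w \<Longrightarrow> f w (?ex j) \<noteq> f w S" by blast
        then show ?thesis using True J j \<open>i < n\<close> \<gamma>
          by (simp add: wpt_query_swap[OF bx _ _ _ _ e] G_def)
      qed
      then show ?thesis using xj j True G1 by (simp del: wpt_Seq, elim wpt_mono) auto
    qed
  next
    case (7 t s')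
    note ag = agreeD[OF 7(2)]
    have j: "ivar s' ''i'' = i" using ag(1)[of "''i''"] i x by auto
    let ?u = "ivar s' ''bi''"
    obtain u0 where "u0 \<in> Z" "u0 \<notin> S" "?ex u0 \<in> argmin (D w) (f w)"
      using argmin_exchange[OF vm opt i(2,3)] by blast
    moreover have "u0 < n" using \<open>u0 \<in> Z\<close> b(2) by (auto simp: bits_def)
    ultimately have u: "?u \<in> Z" "?u \<notin> S" "?ex ?u \<in> argmin (D w) (f w)" and x1: "iarr s' x = iarr s x"
      using 7(1) n by auto
    have un: "?u < n" using u b(2) by (auto simp: bits_def)
    have bx: "bits n (iarr s' x) S" using x1 b by simp
    have "bits n ((iarr s' x)(i := 1 - iarr s' x i)) (toggle i S)" (is "bits n ?a1 _")
      using bits_toggle[OF bx \<open>i < n\<close>] .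
    then have b2: "bits n (?a1(?u := 1 - ?a1 ?u)) (toggle ?u (toggle i S))"
      by (rule bits_toggle) (use un in auto)
    have tt: "toggle ?u (toggle i S) = ?ex ?u" using u i(2) by (auto simp: toggle_def)
    have t: "t \<le> 6 + n * (70 * G + 8)" using 7(3) n by simp
    have G: "real n \<le> n * G" using G1 by (simp add: mult_le_cancel_left1)
    have e: "6 + n * (70 * G + 8) = 6 + 70 * (n * G) + 8 * real n" "150 * G * real (n + 1) = 150 * (n * G) + 150 * G"
      "30 * real (n + 1) = 30 * real n + 30"
      by (simp_all add: algebra_simps)
    let ?s1 = "s'\<lparr>iarr := (iarr s')(x := ?a1(?u := 1 - ?a1 ?u))\<rparr>"
    have ags: "agree {x, ''bi'', ''j'', ''qf'', ''qv''} s ?s1"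
      using 7(2) by (auto simp: agree_def)
    have bs: "bits n (iarr ?s1 x) (?ex ?u)" using b2 tt by simp
    have "wpt count_both ?s1 (\<lambda>ta s''. \<exists>u. u \<in> Z \<and> u \<notin> S \<and> ?ex u \<in> argmin (D w) (f w) \<and>
      bits n (iarr s'' x) (?ex u) \<and> ivar s'' ''cnt'' = h (?ex u) \<and>
      1 + real (icost (IVar ''i'')) + (t + (6 + (6 + ta))) \<le> 150 * G * real (n + 1))"
    proof (rule count[OF ags bs], goal_cases)
      case (1 ta s'')
      have "iarr s'' x = iarr ?s1 x" using agreeD(3)[OF 1(3), of x] x by simp
      moreover have "t + ta + 20 \<le> 150 * G * real (n + 1)"
        using t 1(2) G G1 unfolding e by linarith
      ultimately show ?case using 1(1) u bs by auto
    qed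
    then show ?case by (simp add: j)
  qed (use x G1 in auto)
  then show ?thesis by (rule wpt_mono_agree) (use post in blast)
qed

text \<open>One pass over the indices suffices: elements that enter belong to \<open>Z\<close> and
  are never removed again, so unless \<open>K\<close> has been met, nothing of \<open>S - Z\<close>
  remains below the current index. If \<open>h S0\<close> already equals \<open>K\<close>, nothing
  moves; this leaves a pair alone that an earlier walk has completed.\<close>

lemma wpt_walk:
  assumes b: "bits n (iarr s x) S0" "bits n (iarr s z) Z" and n: "ivar s ''n'' = n" "ivar s ''kk'' = K" "ivar s ''cnt'' = h S0"
    and vm: "vm (D w) (f w)" and opt: "S0 \<in> argmin (D w) (f w)" "Z \<in> argmin (D w) (f w)"
    and card: "\<And>S S'. S \<in> D w \<Longrightarrow> S' \<in> D w \<Longrightarrow> card S = card S'"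
    and x: "x \<notin> {''i'', ''bi'', ''j'', ''qf'', ''qv'', ''n'', ''mv'', ''cnt'', ''y'', ''kk'', z}"
      "z \<notin> {''i'', ''bi'', ''j'', ''qf'', ''qv'', ''n'', ''mv'', ''cnt'', ''y'', ''kk''}"
    and count: "\<And>s' S' Q. agree (mods (walk w x z)) s s' \<Longrightarrow> bits n (iarr s' x) S' \<Longrightarrow>
       (\<And>t s''. ivar s'' ''cnt'' = h S' \<Longrightarrow> t \<le> 30 * real (n + 1) \<Longrightarrow> agree {''cnt'', ''y''} s' s'' \<Longrightarrow> Q t s'') \<Longrightarrow>
       wpt count_both s' Q"
    and h: "\<And>S u v. S \<in> D w \<Longrightarrow> u \<in> S \<Longrightarrow> v \<notin> S \<Longrightarrow> h S \<le> Suc (h (insert v (S - {u})))" and K: "K \<le> h S0"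
    and post: "\<And>t s' S. bits n (iarr s' x) S \<Longrightarrow> S \<in> argmin (D w) (f w) \<Longrightarrow> ivar s' ''cnt'' = h S \<Longrightarrow> K \<le> h S \<Longrightarrow>
       (h S0 = K \<longrightarrow> S = S0) \<Longrightarrow> h S = K \<or> S = Z \<Longrightarrow>
       t \<le> 300 * G * real (n + 1) * real (card S0 + 1) \<Longrightarrow> agree (mods (walk w x z)) s s' \<Longrightarrow> Q t s'"
  shows "wpt (walk w x z) s Q"
proof -
  have SD: "S0 \<in> D w" "Z \<in> D w" using opt by (auto simp: argmin_def)
  then have sub: "S0 \<subseteq> {..<n}" "Z \<subseteq> {..<n}" using D_sub by blast+
  have a0: "array_set n (iarr s x) = S0" using array_set_bits[OF b(1)] .
  let ?J = "\<lambda>i s'. \<exists>S. bits n (iarr s' x) S \<and> S \<in> argmin (D w) (f w) \<and> ivar s' ''cnt'' = h S \<and> K \<le> h S \<and>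
     (h S0 = K \<longrightarrow> S = S0) \<and> S \<subseteq> S0 \<union> Z \<and> (h S = K \<or> (\<forall>l<i. l \<in> S \<longrightarrow> l \<in> Z))"
  let ?T = "\<lambda>i. 30 * G + (if i \<in> S0 then 150 * G * real (n + 1) else 0)"
  let ?s1 = "s\<lparr>ivar := (ivar s)(''qf'' := 1), rvar := (rvar s)(''mv'' := f w S0)\<rparr>"
  have ag1: "agree (mods (walk w x z)) s ?s1" by (simp add: agree_def)
  have n1: "ivar ?s1 ''n'' = n" using n by simp
  have "wpt (For ''i'' ''n'' (IfT (BAnd (BAnd (IEq (IArr x (IVar ''i'')) (INum 1)) (IEq (IArr z (IVar ''i'')) (INum 0)))
         (BNot (IEq (IVar ''cnt'') (IVar ''kk'')))) (walk_step w x z))) ?s1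
     (\<lambda>t s'. \<exists>S. bits n (iarr s' x) S \<and> S \<in> argmin (D w) (f w) \<and> ivar s' ''cnt'' = h S \<and> K \<le> h S \<and>
     (h S0 = K \<longrightarrow> S = S0) \<and> (h S = K \<or> S = Z) \<and> 1 + \<gamma> + t \<le> 300 * G * real (n + 1) * real (card S0 + 1))"
  proof (rule wpt_For[where Inv = ?J and T = ?T], goal_cases)
    case 1
    show ?case by (rule exI[of _ S0]) (use b opt n K in simp)
  next
    case (5 i s')
    have i: "i < n" "ivar s' ''i'' = i" using 5(1,3) n1 by auto
    have "ivar s' ''n'' = ivar ?s1 ''n''" by (rule agreeD(1)[OF 5(4)]) (use x in auto)
    moreover have "ivar s' ''kk'' = ivar ?s1 ''kk''" by (rule agreeD(1)[OF 5(4)]) (use x in auto)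
    moreover have "rvar s' ''mv'' = rvar ?s1 ''mv''" by (rule agreeD(2)[OF 5(4)]) (use x in auto)
    moreover have "iarr s' z = iarr ?s1 z" by (rule agreeD(3)[OF 5(4)]) (use x in auto)
    ultimately have st: "ivar s' ''n'' = n" "ivar s' ''kk'' = K" "rvar s' ''mv'' = f w S0" "iarr s' z = iarr s z"
      using n(1,2) by simp_all
    from 5(2) obtain S where S: "bits n (iarr s' x) S" "S \<in> argmin (D w) (f w)" "ivar s' ''cnt'' = h S" "K \<le> h S"
      "h S0 = K \<longrightarrow> S = S0" "S \<subseteq> S0 \<union> Z" "h S = K \<or> (\<forall>l<i. l \<in> S \<longrightarrow> l \<in> Z)" by blast
    have SD': "S \<in> D w" using S(2) by (simp add: argmin_def)
    have bz: "bits n (iarr s' z) Z" using b(2) st by simp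
    have xi: "iarr s' x i = (if i \<in> S then 1 else 0)" "iarr s' z i = (if i \<in> Z then 1 else 0)"
      using bits_iff[OF S(1) i(1)] bits_iff[OF bz i(1)] by simp_all
    show ?case
    proof (cases "i \<in> S \<and> i \<notin> Z \<and> h S \<noteq> K")
      case False
      then have S7: "h S = K \<or> (\<forall>l<Suc i. l \<in> S \<longrightarrow> l \<in> Z)" using S(7) by (auto simp: less_Suc_eq)
      have "?J (Suc i) s'" by (rule exI[of _ S]) (intro conjI S(1-6) S7)
      moreover have nb: "\<not> bval (BAnd (BAnd (IEq (IArr x (IVar ''i'')) (INum 1)) (IEq (IArr z (IVar ''i'')) (INum 0)))
         (BNot (IEq (IVar ''cnt'') (IVar ''kk'')))) s'"
        using xi i False st S(3) by auto
      moreover have "16 \<le> ?T i" using G1 by (auto intro!: add_increasing2)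
      ultimately show ?thesis unfolding wpt_Cond if_not_P[OF nb] by simp
    next
      case True
      have mv: "rvar s' ''mv'' = f w S" using st(3) S(2) SD opt(1) by (force simp: argmin_def)
      have ags: "agree (mods (walk w x z)) s s'"
        using agree_trans[OF ag1, OF agree_mono[OF 5(4)]] by auto
      have "wpt (walk_step w x z) s' (\<lambda>t s''. ?J (Suc i) (s''\<lparr>ivar := (ivar s'')(''i'' := Suc i)\<rparr>) \<and> t + 20 \<le> ?T i)"
      proof (rule wpt_walk_step[OF S(1) bz st(1) i(2) _ _ vm S(2) opt(2) mv, where h = h], goal_cases)
        case (5 s1 S' Q)
        then show ?case by (intro count[OF agree_trans[OF ags agree_mono[OF 5(1)]]]) auto
      next
        case (6 t s'' u)
        let ?S = "insert u (S - {i})"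
        have c1: "K \<le> h ?S" using h[OF SD', of i u] True 6(2) S(4) by force
        have c2: "h S0 = K \<longrightarrow> ?S = S0" using S(5) True by auto
        have c3: "?S \<subseteq> S0 \<union> Z" using S(6) 6(1) by auto
        have c4: "h ?S = K \<or> (\<forall>l<Suc i. l \<in> ?S \<longrightarrow> l \<in> Z)" using S(7) True 6(1) by (auto simp: less_Suc_eq)
        have "?J (Suc i) s''" by (rule exI[of _ ?S]) (intro conjI 6(3-5) c1 c2 c3 c4)
        \<comment> \<open>Only elements of the starting set are exchanged out, so at most
          \<open>card S0\<close> indices incur the cost of a full step.\<close>
        moreover have "i \<in> S0" using S(6) True by auto
        ultimately show ?case using 6(6) G1 by simp
      qed (use True x in auto)
      note W = this
      have bb: "bval (BAnd (BAnd (IEq (IArr x (IVar ''i'')) (INum 1)) (IEq (IArr z (IVar ''i'')) (INum 0)))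
         (BNot (IEq (IVar ''cnt'') (IVar ''kk'')))) s'"
        using xi i True st S(3) by auto
      show ?thesis
        unfolding wpt_Cond if_P[OF bb]
      proof (rule wpt_mono[OF W], rule conjI, erule conjunct1, drule conjunct2, goal_cases)
        case (1 t s'')
        then show ?case unfolding bcost.simps icost.simps by linarith
      qed
    qed
  next
    case (7 t s')
    from 7(1)[unfolded n1] obtain S where S: "bits n (iarr s' x) S" "S \<in> argmin (D w) (f w)" "ivar s' ''cnt'' = h S" "K \<le> h S"
      "h S0 = K \<longrightarrow> S = S0" "h S = K \<or> (\<forall>l<n. l \<in> S \<longrightarrow> l \<in> Z)" by blast
    have SD': "S \<in> D w" using S(2) by (simp add: argmin_def)
    have "S \<subseteq> {..<n}" using D_sub[OF SD'] .
    then have "(\<forall>l<n. l \<in> S \<longrightarrow> l \<in> Z) \<Longrightarrow> S \<subseteq> Z" by auto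
    moreover have "finite Z" using sub(2) finite_subset by blast
    ultimately have fin: "h S = K \<or> S = Z" using S(6) card[OF SD' SD(2)] card_subset_eq by blast
    have "(\<Sum>i<n. ?T i + 8) = (\<Sum>i<n. 30 * G + 8) + (\<Sum>i<n. if i \<in> S0 then 150 * G * real (n + 1) else 0)"
      by (simp only: sum.distrib[symmetric] add_ac)
    also have "(\<Sum>i<n. if i \<in> S0 then 150 * G * real (n + 1) else 0) = card S0 * (150 * G * real (n + 1))"
      using sub(1) by (subst sum.inter_restrict[symmetric]) (auto simp: Int_absorb1)
    finally have t: "t \<le> 6 + n * (30 * G + 8) + card S0 * (150 * G * real (n + 1))" using 7(3) n1 by simp
    let ?c = "real (card S0)"
    have e: "300 * G * real (n + 1) * real (card S0 + 1) = 300 * (n * G * ?c) + 300 * (n * G) + 300 * (?c * G) + 300 * G"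
      "n * (30 * G + 8) = 30 * (n * G) + 8 * real n"
      "?c * (150 * G * real (n + 1)) = 150 * (n * G * ?c) + 150 * (?c * G)"
      by (simp_all add: algebra_simps)
    have "0 \<le> n * G * ?c" "0 \<le> ?c * G" using G1 by simp_all
    moreover have "1 + \<gamma> = G" by (simp add: G_def)
    moreover have "real n \<le> n * G" using G1 by (simp add: mult_le_cancel_left1)
    ultimately have "1 + \<gamma> + t \<le> 300 * G * real (n + 1) * real (card S0 + 1)"
      using t G1 unfolding e by linarith
    then show ?case by (intro exI[of _ S] conjI S(1-5) fin)
  next
    case (6 i)
    then show ?case using G1 by simp
  qed (use x in auto)
  then have "wpt (walk w x z) s (\<lambda>t s'. \<exists>S. bits n (iarr s' x) S \<and> S \<in> argmin (D w) (f w) \<and> ivar s' ''cnt'' = h S \<and> K \<le> h S \<and>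
     (h S0 = K \<longrightarrow> S = S0) \<and> (h S = K \<or> S = Z) \<and> t \<le> 300 * G * real (n + 1) * real (card S0 + 1))"
    by (simp add: walk_def a0 SD)
  then show ?thesis by (rule wpt_mono_agree) (use post in blast)
qed

end

section \<open>The algorithms\<close>

definition program_ge :: com where
  "program_ge = minimize Omega1 ''B1'' ''X1'';; minimize Omega2 ''B2'' ''X2'';;
     IAssign ''c'' (INum 1);; IAssign ''kk'' (IVar ''k'');; solve"

definition adjust :: com where
  "adjust = count_both;; IfT (ILess (IVar ''kk'') (IVar ''cnt'')) (walk Omega1 ''X1'' ''Z1'';; walk Omega2 ''X2'' ''Z2'')"

text \<open>
  If the initial minimizers have more than \<open>k\<close> common elements, the intersection must not exceed \<open>k\<close>;
  in terms of the complement (\<open>c = 0\<close>) it is the lower bound \<open>card X1 - k\<close>, and \<open>cnt + e = card X1\<close>.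
\<close>

definition choose_side :: com where
  "choose_side =
     (IAssign ''c'' (INum 0);; count_both);;
     (IAssign ''e'' (IVar ''cnt'');; IAssign ''c'' (INum 1);; count_both);;
     Cond (ILess (IVar ''k'') (IVar ''cnt''))
       (IAssign ''kk'' (ISub (IAdd (IVar ''cnt'') (IVar ''e'')) (IVar ''k''));; IAssign ''c'' (INum 0))
       (IAssign ''kk'' (IVar ''k''))"

text \<open>The initial minimizers are saved in \<open>Z1\<close> and \<open>Z2\<close>, because
  \<open>solve\<close> overwrites \<open>X1\<close> and \<open>X2\<close>, while the walks need the
  former as targets.\<close>

definition program_eq :: com where
  "program_eq = minimize Omega1 ''B1'' ''X1'';; minimize Omega2 ''B2'' ''X2'';;
     For ''y'' ''n'' (IStore ''Z1'' (IVar ''y'') (IArr ''X1'' (IVar ''y''));; IStore ''Z2'' (IVar ''y'') (IArr ''X2'' (IVar ''y'')));;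
     choose_side;; solve;; IfT (IEq (IVar ''found'') (INum 1)) adjust"

lemma side_side: "Y \<subseteq> {..<n} \<Longrightarrow> side n c (side n c Y) = Y"
  by (auto simp: side_def)

lemma side_subset: "Y \<subseteq> {..<n} \<Longrightarrow> side n c Y \<subseteq> {..<n}"
  by (auto simp: side_def)

context solver
begin

lemma side_mem: "Y \<in> D Omega2 \<Longrightarrow> side n c Y \<in> D2"
  using D_sub[of Y Omega2] by (simp add: side_dom_def side_side side_subset)

lemma argmin_side: "Y \<in> argmin (D Omega2) (f Omega2) \<Longrightarrow> side n c Y \<in> argmin D2 f2"
  using D_sub[of Y Omega2] by (auto simp: argmin_def side_dom_def side_fun_def side_side side_subset)

lemma argmin_side_iff:
  assumes "T \<in> argmin D2 f2"
  shows "side n c T \<in> argmin (D Omega2) (f Omega2)"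
proof -
  have T: "T \<in> D2" and le: "\<And>Z. Z \<in> D2 \<Longrightarrow> f2 T \<le> f2 Z" using assms by (auto simp: argmin_def)
  have "f Omega2 (side n c T) \<le> f Omega2 Y" if "Y \<in> D Omega2" for Y
    using le[OF side_mem[OF that]] D_sub[OF that] by (simp add: side_fun_def side_side)
  moreover have "side n c T \<in> D Omega2" using T by (simp add: side_dom_def)
  ultimately show ?thesis by (simp add: argmin_def)
qed

text \<open>An exchange loses at most one common element: \<open>u\<close> when the set itself is
  met, \<open>v\<close> when its complement is.\<close>

lemma card_exchange_le:
  assumes "finite X"
  shows "card (X \<inter> side n c S) \<le> Suc (card (X \<inter> side n c (insert v (S - {u}))))"
    and "card (X \<inter> S) \<le> Suc (card (X \<inter> insert v (S - {u})))"
proof -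
  have "X \<inter> side n c S \<subseteq> insert (if c = 1 then u else v) (X \<inter> side n c (insert v (S - {u})))"
    by (auto simp: side_def)
  then have "card (X \<inter> side n c S) \<le> card (insert (if c = 1 then u else v) (X \<inter> side n c (insert v (S - {u}))))"
    using assms by (intro card_mono) auto
  then show "card (X \<inter> side n c S) \<le> Suc (card (X \<inter> side n c (insert v (S - {u}))))"
    using assms by (simp add: card_insert_if split: if_splits)
  have "X \<inter> S \<subseteq> insert u (X \<inter> insert v (S - {u}))" by auto
  then have "card (X \<inter> S) \<le> card (insert u (X \<inter> insert v (S - {u})))"
    using assms by (intro card_mono) auto
  then show "card (X \<inter> S) \<le> Suc (card (X \<inter> insert v (S - {u})))"
    using assms by (simp add: card_insert_if split: if_splits)
qed

text \<open>Complementary slackness: the multiplier \<open>lam\<close> vanishes.\<close>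

lemma state_cert_slack:
  assumes s: "state_cert K lam X T s" and gt: "K < card (X \<inter> T)"
  shows "X \<in> argmin D1 f1" "side n c T \<in> argmin (D Omega2) (f Omega2)"
proof -
  note XT = state_cert_mem(1,2)[OF s]
  have "lam * (real (card (X \<inter> T)) - real K) \<le> 0"
    using state_cert_bound[OF s XT] by simp
  moreover have "0 \<le> lam" using s by (simp add: state_cert_def)
  ultimately have "lam = 0" using gt by (simp add: mult_le_0_iff)
  then have le: "f1 X + f2 T \<le> f1 Z1 + f2 Z2" if "Z1 \<in> D1" "Z2 \<in> D2" for Z1 Z2
    using state_cert_bound[OF s that] by simp
  show "X \<in> argmin D1 f1" using le[OF _ XT(2)] XT by (simp add: argmin_def)
  have "T \<in> argmin D2 f2" using le[OF XT(1)] XT by (simp add: argmin_def)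
  then show "side n c T \<in> argmin (D Omega2) (f Omega2)" by (rule argmin_side_iff)
qed

text \<open>If the intersection exceeds \<open>K\<close>, both sets are minimizers, and so is every
  set met on the walks. Any such pair with exactly \<open>K\<close> common elements is then optimal,
  even without the constraint.\<close>

lemma wpt_adjust:
  assumes s: "state_cert K lam X T s" and kk: "ivar s ''kk'' = K"
    and z: "bits n (iarr s ''Z1'') Z1" "bits n (iarr s ''Z2'') Z2"
    and opt: "Z1 \<in> argmin D1 f1" "Z2 \<in> argmin (D Omega2) (f Omega2)" and le: "card (Z1 \<inter> side n c Z2) \<le> K"
    and r: "\<And>w S. S \<in> D w \<Longrightarrow> card S \<le> r"
    and post: "\<And>t s' S1 S2. bits n (iarr s' ''X1'') S1 \<Longrightarrow> bits n (iarr s' ''X2'') S2 \<Longrightarrow> S1 \<in> D1 \<Longrightarrow> S2 \<in> D Omega2 \<Longrightarrow>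
      card (S1 \<inter> side n c S2) = K \<Longrightarrow>
      (\<And>Y1 Y2. Y1 \<in> D1 \<Longrightarrow> Y2 \<in> D Omega2 \<Longrightarrow> card (Y1 \<inter> side n c Y2) = K \<Longrightarrow> f1 S1 + f Omega2 S2 \<le> f1 Y1 + f Omega2 Y2) \<Longrightarrow>
      t \<le> 700 * G * real (n + 1) * real (r + 1) \<Longrightarrow> agree (mods adjust) s s' \<Longrightarrow> Q t s'"
  shows "wpt adjust s Q"
proof -
  note XT = state_cert_mem[OF s]
  have b: "ivar s ''n'' = n" "ivar s ''c'' = c" "bits n (iarr s ''X1'') X" "bits n (iarr s ''X2'') (side n c T)"
    using s by (auto simp: state_cert_def)
  have T2: "side n c T \<in> D Omega2" and ss: "side n c (side n c T) = T" using XT(2) by (auto simp: side_dom_def side_side)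
  let ?N = "real (n + 1)" and ?R = "real (r + 1)"
  have d: "?N * 1 \<le> ?N * ?R" by (intro mult_left_mono) auto
  have "1 * (?N * 1) \<le> G * (?N * ?R)" using d G1 by (intro mult_mono) auto
  note dN = this
  define E where "E = G * (?N * ?R)"
  have N1: "?N \<le> E" using dN unfolding E_def by (simp only: mult_1 mult_1_right)
  have walkt: "300 * G * ?N * real (card S + 1) \<le> 300 * E" if "S \<in> D w" for S w
  proof -
    have "300 * G * ?N * real (card S + 1) \<le> 300 * G * ?N * ?R"
      using r[OF that] G1 by (intro mult_left_mono) auto
    then show ?thesis by (simp only: E_def mult.assoc)
  qed
  have NR: "700 * G * ?N * ?R = 700 * E" by (simp only: E_def mult.assoc)
  have N0: "1 \<le> ?N" by simp
  have small: "t1 + 10 + t \<le> 700 * E" if "t1 \<le> 30 * N" "N \<le> E" "1 \<le> N" "t \<le> 600 * E" for t1 t N :: real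
    using that by linarith
  have E0: "0 \<le> E" using N0 N1 by linarith
  have "wpt adjust s (\<lambda>t s'. \<exists>S1 S2. bits n (iarr s' ''X1'') S1 \<and> bits n (iarr s' ''X2'') S2 \<and> S1 \<in> D1 \<and> S2 \<in> D Omega2 \<and>
      card (S1 \<inter> side n c S2) = K \<and>
      (\<forall>Y1\<in>D1. \<forall>Y2\<in>D Omega2. card (Y1 \<inter> side n c Y2) = K \<longrightarrow> f1 S1 + f Omega2 S2 \<le> f1 Y1 + f Omega2 Y2) \<and>
      t \<le> 700 * G * ?N * ?R)"
    unfolding adjust_def wpt_Seq[of count_both]
  proof (rule wpt_count_both[OF b], goal_cases)
    case (1 t1 s1)
    note ag = agreeD[OF 1(3)]
    have s1: "ivar s1 ''n'' = n" "ivar s1 ''c'' = c" "ivar s1 ''kk'' = K" "iarr s1 ''X1'' = iarr s ''X1''"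
      "iarr s1 ''X2'' = iarr s ''X2''" "iarr s1 ''Z1'' = iarr s ''Z1''" "iarr s1 ''Z2'' = iarr s ''Z2''"
      using ag b kk by simp_all
    show ?case
    proof (cases "K < card (X \<inter> T)")
      case False
      then have cK: "card (X \<inter> T) = K" using XT(6) by simp
      have opt': "f1 X + f Omega2 (side n c T) \<le> f1 Y1 + f Omega2 Y2"
        if "Y1 \<in> D1" "Y2 \<in> D Omega2" "card (Y1 \<inter> side n c Y2) = K" for Y1 Y2
        using state_cert_bound[OF s that(1) side_mem[OF that(2)]] that D_sub[OF that(2)]
        by (simp add: side_fun_def side_side)
      have tb: "t1 + 6 \<le> 700 * G * ?N * ?R" using small[OF 1(2) N1 N0, of 0] E0 unfolding NR by simp
      have nb: "\<not> bval (ILess (IVar ''kk'') (IVar ''cnt'')) s1" using False 1(1) s1 by simp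
      show ?thesis
        unfolding wpt_Cond if_not_P[OF nb] wpt_Skip
        by (rule exI[of _ X], rule exI[of _ "side n c T"])
          (use tb s1 b XT(1) T2 cK ss opt' in \<open>simp add: add_ac\<close>)
    next
      case True
      note mins = state_cert_slack[OF s True]
      have bz: "bits n (iarr s1 ''X1'') X" "bits n (iarr s1 ''Z1'') Z1" using s1 b z by simp_all
      have cnt1: "ivar s1 ''cnt'' = card (T \<inter> X)" using 1(1) by (simp add: Int_commute)
      have fT: "finite T" using XT(4) finite_subset by blast
      have "wpt (walk Omega1 ''X1'' ''Z1'';; walk Omega2 ''X2'' ''Z2'') s1 (\<lambda>t s'. \<exists>S1 S2. bits n (iarr s' ''X1'') S1 \<and>
        bits n (iarr s' ''X2'') S2 \<and> S1 \<in> D1 \<and> S2 \<in> D Omega2 \<and> card (S1 \<inter> side n c S2) = K \<and>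
        (\<forall>Y1\<in>D1. \<forall>Y2\<in>D Omega2. card (Y1 \<inter> side n c Y2) = K \<longrightarrow> f1 S1 + f Omega2 S2 \<le> f1 Y1 + f Omega2 Y2) \<and>
        t \<le> 600 * E)"
        unfolding wpt_Seq
      proof (rule wpt_walk[where h = "\<lambda>S. card (T \<inter> S)", OF bz s1(1,3) cnt1 vm mins(1) opt(1) card_eq], goal_cases)
        case (5 s' S' Q)
        have "iarr s' ''X2'' = iarr s ''X2''" "ivar s' ''n'' = n" "ivar s' ''c'' = c"
          using agreeD[OF 5(1)] s1 by simp_all
        then show ?case using 5(2,3) b by (intro wpt_count_both[of s' S' T]) (auto simp: Int_commute)
      next
        case (6 S u v)
        show ?case by (rule card_exchange_le(2)[OF fT])
      next
        case 7
        show ?case using True by (simp add: Int_commute)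
      next
        case (8 t2 s2 S1)
        note h1 = 8
        note ag2 = agreeD[OF 8(8)]
        have s2: "ivar s2 ''n'' = n" "ivar s2 ''c'' = c" "ivar s2 ''kk'' = K" "iarr s2 ''X2'' = iarr s ''X2''" "iarr s2 ''Z2'' = iarr s ''Z2''"
          using ag2 s1 by simp_all
        have bz2: "bits n (iarr s2 ''X2'') (side n c T)" "bits n (iarr s2 ''Z2'') Z2" using s2 b z by simp_all
        have S1D: "S1 \<in> D1" using 8(2) by (simp add: argmin_def)
        have fS1: "finite S1" using D_sub[OF S1D] finite_subset by blast
        have cnt2: "ivar s2 ''cnt'' = card (S1 \<inter> side n c (side n c T))" using 8(3) by (simp add: ss Int_commute)
        show ?case
        proof (rule wpt_walk[where h = "\<lambda>S. card (S1 \<inter> side n c S)", OF bz2 s2(1,3) cnt2 vm mins(2) opt(2) card_eq], goal_cases)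
          case (5 s' S' Q)
          have "iarr s' ''X1'' = iarr s2 ''X1''" "ivar s' ''n'' = n" "ivar s' ''c'' = c"
            using agreeD[OF 5(1)] s2 by simp_all
          moreover have "S' \<subseteq> {..<n}" using 5(2) by (simp add: bits_def)
          ultimately show ?case using 5(2,3) h1(1)
            by (intro wpt_count_both[of s' S1 "side n c S'"]) (auto simp: side_side)
        next
          case (6 S u v)
          show ?case by (rule card_exchange_le(1)[OF fS1])
        next
          case 7
          show ?case using h1(4) by (simp add: ss Int_commute)
        next
          case (8 t3 s3 S2)
          have S2D: "S2 \<in> D Omega2" using 8(2) by (simp add: argmin_def)
          \<comment> \<open>Missing \<open>K\<close> would mean that both walks ran to their ends.
            But \<open>Z1\<close> and \<open>Z2\<close> give at most \<open>K\<close>, whereas a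
            walk never falls below \<open>K\<close>.\<close>
          have "card (S1 \<inter> side n c S2) = K"
          proof (rule ccontr)
            assume ne: "card (S1 \<inter> side n c S2) \<noteq> K"
            then have S2: "S2 = Z2" using 8(6) by simp
            have "card (S1 \<inter> T) \<noteq> K" using 8(5) ne ss by auto
            then have "S1 = Z1" using h1(6) by (simp add: Int_commute)
            then have "card (S1 \<inter> side n c S2) \<le> K" using S2 le by simp
            then show False using 8(4) ne by simp
          qed
          moreover have "f1 S1 + f Omega2 S2 \<le> f1 Y1 + f Omega2 Y2" if "Y1 \<in> D1" "Y2 \<in> D Omega2" for Y1 Y2
            using h1(2) 8(2) that by (auto simp: argmin_def intro: add_mono)
          moreover have "bits n (iarr s3 ''X1'') S1" using h1(1) agreeD(3)[OF 8(8), of "''X1''"] by simp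
          moreover have "t2 + t3 \<le> 600 * E"
            using h1(7) 8(7) walkt[OF XT(1)] walkt[OF T2] by linarith
          ultimately show ?case using 8(1) S1D S2D by blast
        qed simp_all
      qed simp_all
      note W = this
      have bb: "bval (ILess (IVar ''kk'') (IVar ''cnt'')) s1" using True 1(1) s1 by simp
      show ?thesis
        unfolding wpt_Cond if_P[OF bb]
      proof (rule wpt_mono[OF W], elim exE conjE, intro exI conjI, goal_cases)
        case (7 t s' S1 S2)
        then show ?case using small[OF 1(2) N1 N0] unfolding NR bcost.simps icost.simps by fastforce
      qed
    qed
  qed
  then show ?thesis by (rule wpt_mono_agree) (use post in blast)
qed

end

section \<open>Both programs on the ground set \<open>{..<n}\<close>\<close>

locale valuated_pair = machine +
  fixes r :: nat
  assumes vm: "vm (D w) (f w)" and card_eq: "S \<in> D w \<Longrightarrow> S' \<in> D w \<Longrightarrow> card S = card S'"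
    and r: "S \<in> D w \<Longrightarrow> card S \<le> r"
begin

lemma solver:
  assumes "c \<le> 1"
  shows "solver n \<gamma> D f \<Omega> c"
proof
  show "c \<le> 1" by fact
  show "vm (D w) (f w)" for w by (fact vm)
  show "S \<in> D w \<Longrightarrow> S' \<in> D w \<Longrightarrow> card S = card S'" for S S' w by (fact card_eq)
qed

definition rtime :: real where
  "rtime = 1600 * G * real (n + 1) * real (r + 1) + 300 * max 1 (log 2 (real n)) * real (n + 1)"

text \<open>With the constraint \<open>P\<close> as a parameter, one specification covers the lower
  bound, the exact size and its complementary form, and passing between the last two is a rewriting
  of \<open>P\<close>.\<close>

definition optimal :: "(nat set \<Rightarrow> nat set \<Rightarrow> bool) \<Rightarrow> state \<Rightarrow> bool" where
  "optimal P s \<longleftrightarrow>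
     ivar s ''found'' = 0 \<and> (\<forall>Y1\<in>D Omega1. \<forall>Y2\<in>D Omega2. \<not> P Y1 Y2) \<or>
     ivar s ''found'' = 1 \<and> (\<exists>X1 X2. bits n (iarr s ''X1'') X1 \<and> bits n (iarr s ''X2'') X2 \<and>
       X1 \<in> D Omega1 \<and> X2 \<in> D Omega2 \<and> P X1 X2 \<and>
       (\<forall>Y1\<in>D Omega1. \<forall>Y2\<in>D Omega2. P Y1 Y2 \<longrightarrow> f Omega1 X1 + f Omega2 X2 \<le> f Omega1 Y1 + f Omega2 Y2))"

lemma wpt_minimize_both:
  assumes n: "ivar s ''n'' = n" and B: "bits n (iarr s ''B1'') B1" "bits n (iarr s ''B2'') B2" "B1 \<in> D Omega1" "B2 \<in> D Omega2"
    and post: "\<And>t s' X Y. bits n (iarr s' ''X1'') X \<Longrightarrow> bits n (iarr s' ''X2'') Y \<Longrightarrow>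
      X \<in> argmin (D Omega1) (f Omega1) \<Longrightarrow> Y \<in> argmin (D Omega2) (f Omega2) \<Longrightarrow>
      t \<le> 400 * (G * real (n + 1) * real (r + 1)) \<Longrightarrow>
      agree (mods (minimize Omega1 ''B1'' ''X1'';; minimize Omega2 ''B2'' ''X2'')) s s' \<Longrightarrow> Q t s'"
  shows "wpt (minimize Omega1 ''B1'' ''X1'';; minimize Omega2 ''B2'' ''X2'') s Q"
proof -
  have t: "200 * G * real (n + 1) * real (card S + 1) \<le> 200 * (G * real (n + 1) * real (r + 1))" if "S \<in> D w" for S w
  proof -
    have "200 * G * real (n + 1) * real (card S + 1) \<le> 200 * G * real (n + 1) * real (r + 1)"
      using r[OF that] G1 by (intro mult_left_mono) auto
    then show ?thesis by (simp only: mult.assoc)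
  qed
  show ?thesis
    unfolding wpt_Seq
  proof (rule wpt_minimize[OF n B(1,3) vm card_eq[OF _ B(3)]], goal_cases)
    case (4 t1 s1 X)
    have s1: "ivar s1 ''n'' = n" "bits n (iarr s1 ''B2'') B2" using agreeD[OF 4(4)] n B by simp_all
    note h = 4
    show ?case
    proof (rule wpt_minimize[OF s1 B(4) vm card_eq[OF _ B(4)]], goal_cases)
      case (4 t2 s2 Y)
      have "iarr s2 ''X1'' = iarr s1 ''X1''" using agreeD(3)[OF 4(4), of "''X1''"] by simp
      moreover have "t1 + t2 \<le> 400 * (G * real (n + 1) * real (r + 1))"
        using add_mono[OF order_trans[OF h(3) t[OF B(3)]] order_trans[OF 4(3) t[OF B(4)]]] by simp
      moreover have "agree (mods (minimize Omega1 ''B1'' ''X1'';; minimize Omega2 ''B2'' ''X2'')) s s2"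
        by (rule agree_trans[OF agree_mono[OF h(4)] agree_mono[OF 4(4)]]) auto
      ultimately show ?case using h(1,2) 4(1,2) by (intro post) auto
    qed auto
  qed auto
qed

lemma big: "real (n + 1) \<le> G * real (n + 1) * real (r + 1)"
proof -
  have "1 * real (n + 1) * 1 \<le> G * real (n + 1) * real (r + 1)" using G1 by (intro mult_mono) auto
  then show ?thesis by (simp only: mult_1 mult_1_right)
qed

lemma wpt_program_ge:
  assumes n: "ivar s ''n'' = n" "ivar s ''k'' = k"
    and B: "bits n (iarr s ''B1'') B1" "bits n (iarr s ''B2'') B2" "B1 \<in> D Omega1" "B2 \<in> D Omega2"
  shows "wpt program_ge s (\<lambda>t s'. optimal (\<lambda>Y1 Y2. k \<le> card (Y1 \<inter> Y2)) s' \<and>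
     t \<le> 1000 * (G * real (n + 1) * real (r + 1)) + rtime * real (k + 1))"
proof -
  interpret so: solver n \<gamma> D f \<Omega> 1 by (rule solver) simp
  have D2: "side_dom n 1 (D Omega2) = D Omega2" "side_fun n 1 g = g" "side n 1 Y = Y" for g Y
    using D_sub by (auto simp: side_dom_def side_fun_def side_def)
  have rt: "0 \<le> rtime" using G1 unfolding rtime_def by (intro add_nonneg_nonneg mult_nonneg_nonneg) auto
  have rt': "so.round_time r = rtime" by (simp add: so.round_time_def rtime_def)
  have assoc: "wpt (a;; b;; c) s Q \<longleftrightarrow> wpt ((a;; b);; c) s Q" for a b c s Q by (simp add: add.assoc)
  have sum: "t1 + t2 + 10 \<le> 1000 * E + F" if "t1 \<le> 400 * E" "t2 \<le> 50 * N + F" "N \<le> E" "1 \<le> N" for t1 t2 N E F :: real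
    using that by linarith
  show ?thesis
    unfolding program_ge_def assoc[of "minimize _ _ _"] wpt_Seq[of "minimize _ _ _;; _"]
  proof (rule wpt_minimize_both[OF n(1) B], goal_cases)
    case (1 t1 s1 X Y)
    let ?s2 = "s1\<lparr>ivar := (ivar s1)(''c'' := 1, ''kk'' := k)\<rparr>"
    have XY: "X \<in> D Omega1" "Y \<in> D Omega2" using 1(3,4) by (auto simp: argmin_def)
    have s2: "ivar ?s2 ''n'' = n" "ivar ?s2 ''c'' = 1" "ivar ?s2 ''kk'' = k" "bits n (iarr ?s2 ''X1'') X"
      "bits n (iarr ?s2 ''X2'') (side n 1 Y)" "ivar s1 ''k'' = k"
      using 1(1,2) n agreeD(1)[OF 1(6)] by (simp_all add: D2(3)[unfolded One_nat_def])
    have "wpt solve ?s2 (\<lambda>t s'. optimal (\<lambda>Y1 Y2. k \<le> card (Y1 \<inter> Y2)) s' \<and>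
       t1 + t + 10 \<le> 1000 * (G * real (n + 1) * real (r + 1)) + rtime * real (k + 1))"
    proof (rule so.wpt_solve[OF s2(1-5) 1(3), where r = r], goal_cases)
      case 1
      show ?case using \<open>Y \<in> argmin _ _\<close> unfolding D2 .
    next
      case 2
      show ?case using r[OF XY(1)] .
    next
      case 3
      show ?case using r[OF XY(2)] by simp
    next
      case (4 t s3)
      have "optimal (\<lambda>Y1 Y2. k \<le> card (Y1 \<inter> Y2)) s3"
        using 4(1)
      proof
        assume "ivar s3 ''found'' = 1 \<and> (\<exists>X' T' lam. so.state_cert k lam X' T' s3)"
        then obtain X' T' lam where sc: "so.state_cert k lam X' T' s3" and fo: "ivar s3 ''found'' = 1" by blast
        note mem = so.state_cert_mem[OF sc, unfolded D2]
        have lam: "0 \<le> lam" and b: "bits n (iarr s3 ''X1'') X'" "bits n (iarr s3 ''X2'') T'"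
          using sc unfolding so.state_cert_def D2 by blast+
        have le: "f Omega1 X' + f Omega2 T' \<le> f Omega1 Y1 + f Omega2 Y2"
          if "Y1 \<in> D Omega1" "Y2 \<in> D Omega2" "k \<le> card (Y1 \<inter> Y2)" for Y1 Y2
        proof -
          \<comment> \<open>For a feasible pair the multiplier term of
            \<open>state_cert_bound\<close> is nonnegative and may be dropped.\<close>
          have "0 \<le> lam * (real (card (Y1 \<inter> Y2)) - real k)" using lam that by simp
          then show ?thesis using so.state_cert_bound[OF sc that(1), unfolded D2, OF that(2)] by linarith
        qed
        show ?thesis
          unfolding optimal_def
          by (rule disjI2, rule conjI[OF fo], rule exI[of _ X'], rule exI[of _ T']) (use le mem b in simp)
      next
        assume h: "ivar s3 ''found'' = 0 \<and> (\<forall>Z1\<in>D Omega1. \<forall>Z2\<in>side_dom n 1 (D Omega2). card (Z1 \<inter> Z2) < k)"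
        show ?thesis using h[unfolded D2] by (auto simp: optimal_def not_le)
      qed
      moreover have "so.round_time r * real (min k r + 1) \<le> rtime * real (k + 1)"
        unfolding rt' using rt by (intro mult_left_mono) auto
      then have "t \<le> 50 * real (n + 1) + rtime * real (k + 1)" using 4(2) by linarith
      ultimately show ?case using sum[OF \<open>t1 \<le> _\<close> _ big] by simp
    qed
    then show ?case using s2(6) by (simp, elim wpt_mono) simp
  qed
qed

lemma wpt_choose_side:
  assumes n: "ivar s ''n'' = n" "ivar s ''k'' = k"
    and b: "bits n (iarr s ''X1'') X" "bits n (iarr s ''X2'') Y"
    and post: "\<And>t s'. ivar s' ''c'' = 1 \<and> ivar s' ''kk'' = k \<and> card (X \<inter> Y) \<le> k \<or>
        ivar s' ''c'' = 0 \<and> ivar s' ''kk'' = card X - k \<and> k < card (X \<inter> Y) \<Longrightarrow>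
      t \<le> 100 * real (n + 1) \<Longrightarrow> agree {''c'', ''cnt'', ''y'', ''e'', ''kk''} s s' \<Longrightarrow> Q t s'"
  shows "wpt choose_side s Q"
proof -
  interpret s0: solver n \<gamma> D f \<Omega> 0 by (rule solver) simp
  interpret s1: solver n \<gamma> D f \<Omega> 1 by (rule solver) simp
  have Xn: "X \<subseteq> {..<n}" and Yn: "Y \<subseteq> {..<n}" using b by (auto simp: bits_def)
  have XY: "X \<inter> side n 0 Y = X - Y" using Xn by (auto simp: side_def)
  have cX: "card (X \<inter> Y) + card (X - Y) = card X" using card_Int_Diff[of X Y] finite_subset[OF Xn] by simp
  have A: "wpt (IAssign ''c'' (INum 0);; count_both) s
     (\<lambda>t s'. ivar s' ''cnt'' = card (X - Y) \<and> agree {''c'', ''cnt'', ''y''} s s' \<and> t \<le> 30 * real (n + 1) + 2)"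
    unfolding wpt_Seq wpt_IAssign
  proof (rule s0.wpt_count_both[where X = X and T = "side n 0 Y"], goal_cases)
    case (5 t s')
    have "agree {''c'', ''cnt'', ''y''} s s'" using 5(3) by (auto simp: agree_def)
    then show ?case using 5(1,2) by (simp add: XY)
  qed (use n b in \<open>simp_all add: side_side[OF Yn]\<close>)
  have B: "wpt (IAssign ''e'' (IVar ''cnt'');; IAssign ''c'' (INum 1);; count_both) s'
     (\<lambda>t s''. ivar s'' ''cnt'' = card (X \<inter> Y) \<and> ivar s'' ''e'' = card (X - Y) \<and> ivar s'' ''c'' = 1 \<and>
        agree {''c'', ''cnt'', ''y'', ''e''} s s'' \<and> t \<le> 30 * real (n + 1) + 4)"
    if s': "ivar s' ''cnt'' = card (X - Y)" "agree {''c'', ''cnt'', ''y''} s s'" for s'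
    unfolding wpt_Seq wpt_IAssign
  proof (rule s1.wpt_count_both[where X = X and T = Y], goal_cases)
    case (5 t s'')
    have "agree {''c'', ''cnt'', ''y'', ''e''} s s''" using 5(3) s'(2) by (auto simp: agree_def)
    moreover have "ivar s'' ''e'' = card (X - Y)" "ivar s'' ''c'' = 1" using agreeD(1)[OF 5(3)] s'(1) by simp_all
    ultimately show ?case using 5(1,2) by simp
  qed (use n b agreeD[OF s'(2)] in \<open>simp_all add: side_def\<close>)
  have C: "wpt (Cond (ILess (IVar ''k'') (IVar ''cnt''))
       (IAssign ''kk'' (ISub (IAdd (IVar ''cnt'') (IVar ''e'')) (IVar ''k''));; IAssign ''c'' (INum 0))
       (IAssign ''kk'' (IVar ''k''))) s'' (\<lambda>t s'. (ivar s' ''c'' = 1 \<and> ivar s' ''kk'' = k \<and> card (X \<inter> Y) \<le> k \<or>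
        ivar s' ''c'' = 0 \<and> ivar s' ''kk'' = card X - k \<and> k < card (X \<inter> Y)) \<and> agree {''c'', ''cnt'', ''y'', ''e'', ''kk''} s s' \<and> t \<le> 20)"
    if h: "ivar s'' ''cnt'' = card (X \<inter> Y)" "ivar s'' ''e'' = card (X - Y)" "ivar s'' ''c'' = 1"
      "agree {''c'', ''cnt'', ''y'', ''e''} s s''" for s''
  proof -
    have k: "ivar s'' ''k'' = k" using agreeD(1)[OF h(4)] n by simp
    show ?thesis
    proof (cases "k < card (X \<inter> Y)")
      case True
      have "agree {''c'', ''cnt'', ''y'', ''e'', ''kk''} s (s''\<lparr>ivar := (ivar s'')(''kk'' := card X - k, ''c'' := 0)\<rparr>)"
        using h(4) by (auto simp: agree_def)
      then show ?thesis using True h(1-3) k cX by simp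
    next
      case False
      have "agree {''c'', ''cnt'', ''y'', ''e'', ''kk''} s (s''\<lparr>ivar := (ivar s'')(''kk'' := k)\<rparr>)"
        using h(4) by (auto simp: agree_def)
      then show ?thesis using False h(1-3) k by simp
    qed
  qed
  show ?thesis
    unfolding choose_side_def wpt_Seq[of "IAssign ''c'' (INum 0);; count_both"]
  proof (rule wpt_mono[OF A], elim conjE, goal_cases)
    case (1 t1 s')
    show ?case
      unfolding wpt_Seq[of "IAssign ''e'' _;; _"]
    proof (rule wpt_mono[OF B[OF 1(1,2)]], elim conjE, goal_cases)
      case (1 t2 s'')
      show ?case
      proof (rule wpt_mono[OF C[OF 1(1-4)]], elim conjE, rule post, goal_cases)
        case (2 t3 s3)
        then show ?case using \<open>t1 \<le> _\<close> 1(5) by simp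
      qed
    qed
  qed
qed

lemma wpt_program_eq:
  assumes n: "ivar s ''n'' = n" "ivar s ''k'' = k"
    and B: "bits n (iarr s ''B1'') B1" "bits n (iarr s ''B2'') B2" "B1 \<in> D Omega1" "B2 \<in> D Omega2"
  shows "wpt program_eq s (\<lambda>t s'. optimal (\<lambda>Y1 Y2. card (Y1 \<inter> Y2) = k) s' \<and>
     t \<le> 2000 * (G * real (n + 1) * real (r + 1)) + rtime * real (r + 1))"
proof -
  interpret s0: solver n \<gamma> D f \<Omega> 0 by (rule solver) simp
  interpret s1: solver n \<gamma> D f \<Omega> 1 by (rule solver) simp
  have rt: "0 \<le> rtime" using G1 unfolding rtime_def by (intro add_nonneg_nonneg mult_nonneg_nonneg) auto
  have assoc: "wpt (a;; b;; c) s Q \<longleftrightarrow> wpt ((a;; b);; c) s Q" for a b c s Q by (simp add: add.assoc)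
  let ?E = "G * real (n + 1) * real (r + 1)"
  let ?tail = "solve;; IfT (IEq (IVar ''found'') (INum 1)) adjust"
  \<comment> \<open>Both forms share the rest of the program, so it is treated once, with the form
    \<open>c\<close> and the required size \<open>K\<close> as parameters. The premise
    \<open>le\<close> holds by the choice made in \<open>choose_side\<close>.\<close>
  have tail: "wpt ?tail s1 (\<lambda>t s'. optimal (\<lambda>Y1 Y2. card (Y1 \<inter> side n c Y2) = K) s' \<and> t \<le> 800 * ?E + rtime * real (r + 1))"
    if c: "c \<le> 1" and s1: "ivar s1 ''n'' = n" "ivar s1 ''c'' = c" "ivar s1 ''kk'' = K"
      and b: "bits n (iarr s1 ''X1'') X" "bits n (iarr s1 ''X2'') Y" "bits n (iarr s1 ''Z1'') X" "bits n (iarr s1 ''Z2'') Y"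
      and opt: "X \<in> argmin (D Omega1) (f Omega1)" "Y \<in> argmin (D Omega2) (f Omega2)"
      and le: "card (X \<inter> side n c Y) \<le> K"
    for c K X Y s1
  proof -
    interpret so: solver n \<gamma> D f \<Omega> c by (rule solver[OF c])
    have XY: "X \<in> D Omega1" "Y \<in> D Omega2" using opt by (auto simp: argmin_def)
    have Yn: "Y \<subseteq> {..<n}" using D_sub[OF XY(2)] .
    have Y2: "side n c (side n c Y) = Y" using Yn by (rule side_side)
    have b2: "bits n (iarr s1 ''X2'') (side n c (side n c Y))" using b(2) Y2 by simp
    have rt': "so.round_time r = rtime" by (simp add: so.round_time_def rtime_def)
    have rY: "card (side n c Y) \<le> r \<or> n - card (side n c Y) \<le> r"
    proof -
      have "card ({..<n} - Y) = n - card Y" using Yn finite_subset[OF Yn] by (simp add: card_Diff_subset)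
      moreover have "card Y \<le> n" using card_mono[OF _ Yn] by simp
      ultimately show ?thesis using r[OF XY(2)] by (auto simp: side_def)
    qed
    have sum: "t1 + t + 10 \<le> 800 * E + F" if "t1 \<le> 50 * N + F" "t \<le> 700 * E" "N \<le> E" "1 \<le> N" for t1 t N E F :: real
      using that by linarith
    show ?thesis
      unfolding wpt_Seq
    proof (rule so.wpt_solve[OF s1 b(1) b2 opt(1) so.argmin_side[OF opt(2)] r[OF XY(1)] rY], goal_cases)
      case (1 t1 s2)
      have "so.round_time r * real (min K r + 1) \<le> rtime * real (r + 1)"
        unfolding rt' using rt by (intro mult_left_mono) auto
      then have t1: "t1 \<le> 50 * real (n + 1) + rtime * real (r + 1)" using 1(2) by linarith
      have N1: "1 \<le> real (n + 1)" by simp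
      have E0: "0 \<le> 700 * ?E" using G1 by simp
      from 1(1) show ?case
      proof
        assume h: "ivar s2 ''found'' = 0 \<and> (\<forall>Z1\<in>D Omega1. \<forall>Z2\<in>side_dom n c (D Omega2). card (Z1 \<inter> Z2) < K)"
        have "card (Y1 \<inter> side n c Y2) \<noteq> K" if "Y1 \<in> D Omega1" "Y2 \<in> D Omega2" for Y1 Y2
          using h that so.side_mem by blast
        then have "optimal (\<lambda>Y1 Y2. card (Y1 \<inter> side n c Y2) = K) s2" using h by (auto simp: optimal_def)
        then show ?thesis using h sum[OF t1 E0 big N1] by simp
      next
        assume h: "ivar s2 ''found'' = 1 \<and> (\<exists>X' T' lam. so.state_cert K lam X' T' s2)"
        then obtain X' T' lam where sc: "so.state_cert K lam X' T' s2" by blast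
        have s2: "ivar s2 ''kk'' = K" "bits n (iarr s2 ''Z1'') X" "bits n (iarr s2 ''Z2'') Y"
          using agreeD[OF 1(3)] s1 b by simp_all
        have "wpt adjust s2 (\<lambda>t s'. optimal (\<lambda>Y1 Y2. card (Y1 \<inter> side n c Y2) = K) s' \<and>
           t1 + t + 10 \<le> 800 * ?E + rtime * real (r + 1))"
        proof (rule so.wpt_adjust[OF sc s2 opt le r], goal_cases)
          case (2 t s3 S1 S2)
          have "ivar s3 ''found'' = 1" using agreeD(1)[OF 2(8), of "''found''"] h by (simp add: adjust_def)
          then have "optimal (\<lambda>Y1 Y2. card (Y1 \<inter> side n c Y2) = K) s3"
            unfolding optimal_def using 2(1-6) by simp (rule exI[of _ S1], simp, rule exI[of _ S2], simp)
          moreover have "t \<le> 700 * ?E" using 2(7) by (simp add: mult.assoc)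
          ultimately show ?case using sum[OF t1 _ big N1] by blast
        qed
        then show ?thesis using h by (simp, elim wpt_mono) simp
      qed
    qed
  qed
  have sum: "t0 + (t1 + (t2 + t4)) \<le> 2000 * E + F"
    if "t0 \<le> 400 * E" "t1 \<le> 40 * N" "t2 \<le> 100 * N" "t4 \<le> 800 * E + F" "N \<le> E" "1 \<le> N" for t0 t1 t2 t4 N E F :: real
    using that by linarith
  show ?thesis
    unfolding program_eq_def assoc[of "minimize _ _ _"] wpt_Seq[of "minimize _ _ _;; _"]
  proof (rule wpt_minimize_both[OF n(1) B], goal_cases)
    case (1 t0 s1 X Y)
    note h0 = 1
    have XY: "X \<in> D Omega1" "Y \<in> D Omega2" using 1(3,4) by (auto simp: argmin_def)
    have Yn: "Y \<subseteq> {..<n}" and fX: "finite X"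
      using D_sub[OF XY(2)] finite_subset[OF D_sub[OF XY(1)]] by simp_all
    have n1: "ivar s1 ''n'' = n" "ivar s1 ''k'' = k" using agreeD(1)[OF 1(6)] n by simp_all
    have cX: "card (X \<inter> Y) + card (X - Y) = card X" using fX card_Int_Diff[of X Y] by simp
    show ?case
      unfolding wpt_Seq[of "For _ _ _"]
    proof (rule wpt_For[where Inv = "\<lambda>i s'. \<forall>v<i. iarr s' ''Z1'' v = iarr s1 ''X1'' v \<and> iarr s' ''Z2'' v = iarr s1 ''X2'' v" and T = "\<lambda>_. 12"], goal_cases)
      case (5 i s')
      then show ?case using agreeD(3)[OF 5(4), of "''X1''"] agreeD(3)[OF 5(4), of "''X2''"] by (auto simp: less_Suc_eq)
    next
      case (7 t1 s2)
      note ag = agreeD[OF 7(2)]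
      have s2: "ivar s2 ''n'' = n" "ivar s2 ''k'' = k" "bits n (iarr s2 ''X1'') X" "bits n (iarr s2 ''X2'') Y"
        using ag n1 h0(1,2) by simp_all
      have z2: "bits n (iarr s2 ''Z1'') X" "bits n (iarr s2 ''Z2'') Y"
        using 7(1) h0(1,2) n1 by (simp_all add: bits_def)
      have "t1 \<le> 6 + 20 * real n" using 7(3) n1 by simp
      then have t1: "t1 \<le> 40 * real (n + 1)" by simp
      show ?case
        unfolding wpt_Seq[of choose_side]
      proof (rule wpt_choose_side[OF s2], goal_cases)
        case (1 t2 s3)
        note ag3 = agreeD[OF 1(3)]
        have s3: "ivar s3 ''n'' = n" "bits n (iarr s3 ''X1'') X" "bits n (iarr s3 ''X2'') Y"
          "bits n (iarr s3 ''Z1'') X" "bits n (iarr s3 ''Z2'') Y"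
          using ag3 s2 z2 by simp_all
        have "wpt ?tail s3 (\<lambda>t s'. optimal (\<lambda>Y1 Y2. card (Y1 \<inter> Y2) = k) s' \<and> t \<le> 800 * ?E + rtime * real (r + 1))"
          using 1(1)
        proof
          assume h: "ivar s3 ''c'' = 1 \<and> ivar s3 ''kk'' = k \<and> card (X \<inter> Y) \<le> k"
          have sd: "side n 1 Z = Z" for Z by (simp add: side_def)
          have "card (X \<inter> side n 1 Y) \<le> k" using h by (simp only: sd)
          from tail[OF _ s3(1) _ _ s3(2-5) h0(3,4) this] h show ?thesis unfolding sd by blast
        next
          assume h: "ivar s3 ''c'' = 0 \<and> ivar s3 ''kk'' = card X - k \<and> k < card (X \<inter> Y)"
          have sd: "card (Z1 \<inter> side n 0 Z2) + card (Z1 \<inter> Z2) = card X" if "Z1 \<in> D Omega1" for Z1 Z2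
          proof -
            have "Z1 \<inter> side n 0 Z2 = Z1 - Z2" using D_sub[OF that] by (auto simp: side_def)
            moreover have "card Z1 = card (Z1 \<inter> Z2) + card (Z1 - Z2)"
              using finite_subset[OF D_sub[OF that]] by (intro card_Int_Diff) simp
            ultimately show ?thesis using card_eq[OF that XY(1)] by simp
          qed
          \<comment> \<open>Hence the truncated subtraction \<open>card X - k\<close> is exact, and
            the constraint in complementary form is equivalent to the original one.\<close>
          have kX: "k < card X" using h cX by linarith
          have le: "card (X \<inter> side n 0 Y) \<le> card X - k" using sd[OF XY(1), of Y] h by linarith
          have eq: "card (Z1 \<inter> side n 0 Z2) = card X - k \<longleftrightarrow> card (Z1 \<inter> Z2) = k" if "Z1 \<in> D Omega1" for Z1 Z2
            using sd[OF that, of Z2] kX by linarith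
          have "optimal (\<lambda>Y1 Y2. card (Y1 \<inter> side n 0 Y2) = card X - k) s' \<longleftrightarrow> optimal (\<lambda>Y1 Y2. card (Y1 \<inter> Y2) = k) s'" for s'
            unfolding optimal_def by (simp add: eq cong: conj_cong)
          then show ?thesis using tail[OF _ s3(1) _ _ s3(2-5) h0(3,4) le] h by simp
        qed
        then show ?case
        proof (rule wpt_mono, elim conjE, intro conjI, goal_cases)
          case (2 t4 s4)
          show ?case by (rule sum[OF h0(5) t1 1(2) \<open>t4 \<le> _\<close> big]) simp
        qed
      qed
    qed auto
  qed
qed

end

section \<open>Transfer to an arbitrary ground set along an enumeration\<close>

lemma vm_pullback:
  assumes e: "bij_betw e {..<n} V" and vm: "valuated_matroid V \<omega>"
  shows "vm {S. S \<subseteq> {..<n} \<and> \<omega> (e ` S) < \<infinity>} (\<lambda>S. real_of_ereal (\<omega> (e ` S)))"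
  unfolding vm_def
proof (intro ballI)
  fix X Y v
  assume X: "X \<in> {S. S \<subseteq> {..<n} \<and> \<omega> (e ` S) < \<infinity>}" and Y: "Y \<in> {S. S \<subseteq> {..<n} \<and> \<omega> (e ` S) < \<infinity>}" and v: "v \<in> X - Y"
  have inj: "inj_on e {..<n}" and im: "e ` {..<n} = V" using e by (auto simp: bij_betw_def)
  have mem: "e a \<in> e ` S \<longleftrightarrow> a \<in> S" if "a < n" "S \<subseteq> {..<n}" for a S
    using inj_on_image_mem_iff[OF inj, of a S] that by simp
  have vn: "v < n" using X v by blast
  have "e ` X \<subseteq> V" "e ` Y \<subseteq> V" using X Y im by blast+
  then have dom: "e ` X \<in> vdom V \<omega>" "e ` Y \<in> vdom V \<omega>" using X Y by (simp_all add: vdom_def)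
  have "e v \<in> e ` X - e ` Y" using v mem[OF vn, of Y] Y by simp
  then obtain u' where u': "u' \<in> e ` Y - e ` X"
    and ex: "\<omega> ((e ` X - {e v}) \<union> {u'}) + \<omega> ((e ` Y \<union> {e v}) - {u'}) \<le> \<omega> (e ` X) + \<omega> (e ` Y)"
    using vm[unfolded valuated_matroid_def, THEN conjunct2, rule_format, OF dom] by blast
  then obtain u where u: "u \<in> Y" "u' = e u" "u \<notin> X" by blast
  have un: "u < n" using u Y by blast
  have sub: "insert u (X - {v}) \<subseteq> {..<n}" "insert v (Y - {u}) \<subseteq> {..<n}" using X Y vn un by blast+
  have neq: "e a \<noteq> e b" if "a < n" "b < n" "a \<noteq> b" for a b using inj that by (auto dest: inj_onD)
  have "(e ` X - {e v}) \<union> {u'} = e ` insert u (X - {v})" "(e ` Y \<union> {e v}) - {u'} = e ` insert v (Y - {u})"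
    using inj_on_image_set_diff[OF inj, of X "{v}"] inj_on_image_set_diff[OF inj, of Y "{u}"] X Y vn un u v neq[OF vn un]
    by (auto simp: u(2))
  note ex = ex[unfolded this]
  have "e ` insert u (X - {v}) \<subseteq> V" "e ` insert v (Y - {u}) \<subseteq> V" using sub im by blast+
  then have "\<omega> (e ` insert u (X - {v})) \<noteq> -\<infinity>" "\<omega> (e ` insert v (Y - {u})) \<noteq> -\<infinity>"
    "\<omega> (e ` X) \<noteq> -\<infinity>" "\<omega> (e ` Y) \<noteq> -\<infinity>"
    using vm dom unfolding valuated_matroid_def vdom_def by blast+
  moreover have "\<omega> (e ` X) \<noteq> \<infinity>" "\<omega> (e ` Y) \<noteq> \<infinity>" using X Y by auto
  \<comment> \<open>As the value -\<infinity> is excluded, a sum with a finite upper bound has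
    finite summands; so both exchanged sets are in the domain.\<close>
  ultimately have "\<omega> (e ` insert u (X - {v})) < \<infinity> \<and> \<omega> (e ` insert v (Y - {u})) < \<infinity> \<and>
     real_of_ereal (\<omega> (e ` insert u (X - {v}))) + real_of_ereal (\<omega> (e ` insert v (Y - {u})))
       \<le> real_of_ereal (\<omega> (e ` X)) + real_of_ereal (\<omega> (e ` Y))"
    using ex
    by (cases "\<omega> (e ` insert u (X - {v}))"; cases "\<omega> (e ` insert v (Y - {u}))"; cases "\<omega> (e ` X)"; cases "\<omega> (e ` Y)") auto
  then show "\<exists>u\<in>Y - X. insert u (X - {v}) \<in> {S. S \<subseteq> {..<n} \<and> \<omega> (e ` S) < \<infinity>} \<and>
      insert v (Y - {u}) \<in> {S. S \<subseteq> {..<n} \<and> \<omega> (e ` S) < \<infinity>} \<and>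
      real_of_ereal (\<omega> (e ` insert u (X - {v}))) + real_of_ereal (\<omega> (e ` insert v (Y - {u})))
      \<le> real_of_ereal (\<omega> (e ` X)) + real_of_ereal (\<omega> (e ` Y))"
    using u sub by blast
qed

locale enumerated =
  fixes V :: "'a set" and \<omega>1 \<omega>2 :: "'a set \<Rightarrow> ereal" and \<gamma> :: real and e :: "nat \<Rightarrow> 'a"
  assumes fin: "finite V" and vm1: "valuated_matroid V \<omega>1" and vm2: "valuated_matroid V \<omega>2"
    and \<gamma>: "0 \<le> \<gamma>" and e: "bij_betw e {..<card V} V"
begin

definition "om w = (case w of Omega1 \<Rightarrow> \<omega>1 | Omega2 \<Rightarrow> \<omega>2)"
definition "Dom w = {S. S \<subseteq> {..<card V} \<and> om w (e ` S) < \<infinity>}"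
definition "val w S = real_of_ereal (om w (e ` S))"

abbreviation "rk \<equiv> max (vrank V \<omega>1) (vrank V \<omega>2)"

lemma image_V: "S \<subseteq> {..<card V} \<Longrightarrow> e ` S \<subseteq> V" and inj: "inj_on e {..<card V}"
  using e by (auto simp: bij_betw_def)

lemma om_vm: "valuated_matroid V (om w)"
  using vm1 vm2 by (cases w) (auto simp: om_def)

lemma om_not_MInf: "A \<subseteq> V \<Longrightarrow> om w A \<noteq> -\<infinity>"
  using om_vm by (auto simp: valuated_matroid_def)

lemma om_val: "S \<in> Dom w \<Longrightarrow> om w (e ` S) = ereal (val w S)"
  using om_not_MInf[OF image_V] by (auto simp: Dom_def val_def ereal_real)

lemma card_image_e: "S \<subseteq> {..<card V} \<Longrightarrow> card (e ` S) = card S"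
  using inj by (intro card_image) (rule inj_on_subset)

lemma card_Dom: "S \<in> Dom w \<Longrightarrow> card S = vrank V (om w)"
  using vrank_eq_card[OF fin om_vm, of "e ` S" w] image_V card_image_e by (auto simp: Dom_def vdom_def)

sublocale vp: valuated_pair "card V" \<gamma> Dom val "oracles e \<omega>1 \<omega>2" rk
proof
  show "0 \<le> \<gamma>" by (rule \<gamma>)
next
  fix S w assume S: "S \<subseteq> {..<card V}"
  have "oracles e \<omega>1 \<omega>2 w S = om w (e ` S)" by (cases w) (auto simp: oracles_def om_def)
  then show "oracles e \<omega>1 \<omega>2 w S = (if S \<in> Dom w then ereal (val w S) else \<infinity>)"
    using om_val[of S w] S by (auto simp: Dom_def)
next
  show "S \<subseteq> {..<card V}" if "S \<in> Dom w" for S w using that by (simp add: Dom_def)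
  show "vm (Dom w) (val w)" for w
    unfolding Dom_def val_def[abs_def] by (rule vm_pullback[OF e om_vm])
  show "card S = card S'" if "S \<in> Dom w" "S' \<in> Dom w" for S S' w using that by (simp add: card_Dom)
  show "card S \<le> rk" if "S \<in> Dom w" for S w using card_Dom[OF that] by (cases w) (auto simp: om_def)
qed

lemma preimage:
  assumes "A \<subseteq> V" "om w A < \<infinity>"
  obtains S where "A = e ` S" "S \<in> Dom w"
proof -
  have "e ` {i. i < card V \<and> e i \<in> A} = A" using assms(1) e by (auto simp: bij_betw_def)
  then show thesis using that[of "{i. i < card V \<and> e i \<in> A}"] assms(2) by (auto simp: Dom_def)
qed

text \<open>A feasible pair of finite objective has two finite values, since -\<infinity> is
  excluded, and so is the image of a pair of index sets in the domains. All other feasible pairs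
  have infinite objective and cannot be better.\<close>

lemma correct_output_optimal:
  assumes o: "vp.optimal P s" and F: "F \<subseteq> Pow V \<times> Pow V"
    and P: "\<And>S1 S2. S1 \<subseteq> {..<card V} \<Longrightarrow> S2 \<subseteq> {..<card V} \<Longrightarrow> (e ` S1, e ` S2) \<in> F \<longleftrightarrow> P S1 S2"
  shows "correct_output (card V) e F (objective \<omega>1 \<omega>2) s"
proof -
  have obj: "objective \<omega>1 \<omega>2 (A1, A2) = om Omega1 A1 + om Omega2 A2" for A1 A2
    by (simp add: objective_def om_def)
  have sub: "S \<subseteq> {..<card V}" if "S \<in> Dom w" for S w using that by (simp add: Dom_def)
  have fin_pair: "\<exists>S1 S2. S1 \<in> Dom Omega1 \<and> S2 \<in> Dom Omega2 \<and> P S1 S2 \<and> A1 = e ` S1 \<and> A2 = e ` S2"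
    if A: "(A1, A2) \<in> F" "objective \<omega>1 \<omega>2 (A1, A2) < \<infinity>" for A1 A2
  proof -
    have AV: "A1 \<subseteq> V" "A2 \<subseteq> V" using A F by auto
    then have "om Omega1 A1 \<noteq> -\<infinity>" "om Omega2 A2 \<noteq> -\<infinity>" using om_not_MInf by auto
    then have "om Omega1 A1 < \<infinity>" "om Omega2 A2 < \<infinity>"
      using A(2) unfolding obj by (cases "om Omega1 A1"; cases "om Omega2 A2"; auto)+
    then obtain S1 S2 where S: "A1 = e ` S1" "S1 \<in> Dom Omega1" "A2 = e ` S2" "S2 \<in> Dom Omega2"
      using preimage AV by metis
    then have "P S1 S2" using A(1) P[OF sub[OF S(2)] sub[OF S(4)]] by simp
    with S show ?thesis by blast
  qed
  from o show ?thesis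
    unfolding vp.optimal_def
  proof
    assume h: "ivar s ''found'' = 0 \<and> (\<forall>Y1\<in>Dom Omega1. \<forall>Y2\<in>Dom Omega2. \<not> P Y1 Y2)"
    then have "\<not> (\<exists>x\<in>F. objective \<omega>1 \<omega>2 x < \<infinity>)" using fin_pair by fast
    then show ?thesis using h by (simp add: correct_output_def)
  next
    assume h: "ivar s ''found'' = 1 \<and> (\<exists>X1 X2. bits (card V) (iarr s ''X1'') X1 \<and> bits (card V) (iarr s ''X2'') X2 \<and>
       X1 \<in> Dom Omega1 \<and> X2 \<in> Dom Omega2 \<and> P X1 X2 \<and>
       (\<forall>Y1\<in>Dom Omega1. \<forall>Y2\<in>Dom Omega2. P Y1 Y2 \<longrightarrow> val Omega1 X1 + val Omega2 X2 \<le> val Omega1 Y1 + val Omega2 Y2))"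
    then obtain X1 X2 where b: "bits (card V) (iarr s ''X1'') X1" "bits (card V) (iarr s ''X2'') X2"
      and X: "X1 \<in> Dom Omega1" "X2 \<in> Dom Omega2" "P X1 X2"
      and opt: "\<And>Y1 Y2. Y1 \<in> Dom Omega1 \<Longrightarrow> Y2 \<in> Dom Omega2 \<Longrightarrow> P Y1 Y2 \<Longrightarrow> val Omega1 X1 + val Omega2 X2 \<le> val Omega1 Y1 + val Omega2 Y2"
      by blast
    have out: "output_pair (card V) e s = (e ` X1, e ` X2)"
      using b by (simp add: output_pair_def array_set_bits)
    have v: "objective \<omega>1 \<omega>2 (e ` S1, e ` S2) = ereal (val Omega1 S1 + val Omega2 S2)"
      if "S1 \<in> Dom Omega1" "S2 \<in> Dom Omega2" for S1 S2
      unfolding obj using om_val that by simp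
    have "objective \<omega>1 \<omega>2 (e ` X1, e ` X2) \<le> objective \<omega>1 \<omega>2 y" if y: "y \<in> F" for y
    proof (cases "objective \<omega>1 \<omega>2 y < \<infinity>")
      case True
      obtain A1 A2 where yA: "y = (A1, A2)" by force
      obtain S1 S2 where "S1 \<in> Dom Omega1" "S2 \<in> Dom Omega2" "P S1 S2" "A1 = e ` S1" "A2 = e ` S2"
        using fin_pair y True unfolding yA by blast
      then show ?thesis using opt v[OF X(1,2)] v by (simp add: yA)
    qed simp
    moreover have "(e ` X1, e ` X2) \<in> F" using P[OF sub[OF X(1)] sub[OF X(2)]] X(3) by simp
    ultimately have "finite_optimal F (objective \<omega>1 \<omega>2) (output_pair (card V) e s)"
      unfolding finite_optimal_def out using v[OF X(1,2)] by simp
    then show ?thesis using h by (simp add: correct_output_def)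
  qed
qed

lemma initial:
  assumes "B1 \<in> vdom V \<omega>1" "B2 \<in> vdom V \<omega>2"
  shows "ivar (initial_state (card V) e k B1 B2) ''n'' = card V" "ivar (initial_state (card V) e k B1 B2) ''k'' = k"
    "bits (card V) (iarr (initial_state (card V) e k B1 B2) ''B1'') {i. i < card V \<and> e i \<in> B1}"
    "bits (card V) (iarr (initial_state (card V) e k B1 B2) ''B2'') {i. i < card V \<and> e i \<in> B2}"
    "{i. i < card V \<and> e i \<in> B1} \<in> Dom Omega1" "{i. i < card V \<and> e i \<in> B2} \<in> Dom Omega2"
proof -
  have "e ` {i. i < card V \<and> e i \<in> B} = B" if "B \<subseteq> V" for B using that e by (auto simp: bij_betw_def)
  then show "{i. i < card V \<and> e i \<in> B1} \<in> Dom Omega1" "{i. i < card V \<and> e i \<in> B2} \<in> Dom Omega2"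
    using assms by (auto simp: Dom_def om_def vdom_def)
qed (auto simp: initial_state_def bits_def char_array_def)

lemma card_Int_image:
  "S1 \<subseteq> {..<card V} \<Longrightarrow> S2 \<subseteq> {..<card V} \<Longrightarrow> card (e ` S1 \<inter> e ` S2) = card (S1 \<inter> S2)"
  using inj_on_image_Int[OF inj, of S1 S2] card_image_e[of "S1 \<inter> S2"] by auto

lemma run_ge:
  assumes B: "B1 \<in> vdom V \<omega>1" "B2 \<in> vdom V \<omega>2"
  shows "\<exists>t s. exec (card V) (oracles e \<omega>1 \<omega>2) \<gamma> program_ge (initial_state (card V) e k B1 B2) t s \<and>
    t \<le> 1000 * (vp.G * real (card V + 1) * real (rk + 1)) + vp.rtime * real (k + 1) \<and>
    correct_output (card V) e (feasible_ge V k) (objective \<omega>1 \<omega>2) s"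
proof -
  have "correct_output (card V) e (feasible_ge V k) (objective \<omega>1 \<omega>2) s"
    if "vp.optimal (\<lambda>Y1 Y2. k \<le> card (Y1 \<inter> Y2)) s" for s
    by (rule correct_output_optimal[OF that]) (use image_V card_Int_image in \<open>auto simp: feasible_ge_def\<close>)
  then show ?thesis using vp.wpt_program_ge[OF initial(1-4)[OF B, of k] initial(5,6)[OF B]] unfolding vp.wpt_def by blast
qed

lemma run_eq:
  assumes B: "B1 \<in> vdom V \<omega>1" "B2 \<in> vdom V \<omega>2"
  shows "\<exists>t s. exec (card V) (oracles e \<omega>1 \<omega>2) \<gamma> program_eq (initial_state (card V) e k B1 B2) t s \<and>
    t \<le> 2000 * (vp.G * real (card V + 1) * real (rk + 1)) + vp.rtime * real (rk + 1) \<and>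
    correct_output (card V) e (feasible_eq V k) (objective \<omega>1 \<omega>2) s"
proof -
  have "correct_output (card V) e (feasible_eq V k) (objective \<omega>1 \<omega>2) s"
    if "vp.optimal (\<lambda>Y1 Y2. card (Y1 \<inter> Y2) = k) s" for s
    by (rule correct_output_optimal[OF that]) (use image_V card_Int_image in \<open>auto simp: feasible_eq_def\<close>)
  then show ?thesis using vp.wpt_program_eq[OF initial(1-4)[OF B, of k] initial(5,6)[OF B]] unfolding vp.wpt_def by blast
qed

text \<open>\<open>n + 1\<close>, \<open>r + 1\<close>, \<open>G\<close> and \<open>q\<close> are at
  most twice the corresponding factors, which gives 8 for a product of three and another 2 for
  \<open>q\<close>. The first coefficient is thus at most 2000 * 8 + 1600 * 8 * 2 = 41600 and the
  second 300 * 2 * 2 = 1200, both below 50000. \<open>\<kappa>\<close> stands for \<open>k\<close>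
  in the problem with a lower bound and for the rank in the exact one.\<close>

lemma time_bound:
  fixes q c :: real
  defines "N \<equiv> max 1 (real (card V))" and "R \<equiv> max 1 (real rk)" and "g \<equiv> max 1 \<gamma>" and "l \<equiv> max 1 (log 2 (real (card V)))"
  assumes \<kappa>: "1 \<le> \<kappa>" "0 \<le> q" "q \<le> 2 * \<kappa>" and c: "0 \<le> c" "c \<le> 2000"
  shows "c * (vp.G * real (card V + 1) * real (rk + 1)) + vp.rtime * q \<le> 50000 * (N * R * \<kappa> * g + N * \<kappa> * l)"
proof -
  let ?n = "real (card V + 1)" and ?r = "real (rk + 1)"
  define E where "E = g * N * R"
  define W where "W = l * N"
  have b: "?n \<le> 2 * N" "?r \<le> 2 * R" "vp.G \<le> 2 * g" "1 \<le> N" "1 \<le> R" "1 \<le> g" "1 \<le> l"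
    by (auto simp: N_def R_def g_def l_def vp.G_def)
  have E0: "0 \<le> E" "0 \<le> W" using b by (auto simp: E_def W_def)
  have "vp.G * ?n * ?r \<le> (2 * g) * (2 * N) * (2 * R)"
    using b vp.G1 by (intro mult_mono) auto
  then have e: "vp.G * ?n * ?r \<le> 8 * E" by (simp add: E_def)
  have "l * ?n \<le> l * (2 * N)" using b by (intro mult_left_mono) auto
  then have w: "l * ?n \<le> 2 * W" by (simp add: W_def)
  have "vp.rtime = 1600 * (vp.G * ?n * ?r) + 300 * (l * ?n)"
    by (simp only: vp.rtime_def l_def mult.assoc)
  then have rt: "vp.rtime \<le> 12800 * E + 600 * W" using e w by linarith
  have "vp.rtime * q \<le> (12800 * E + 600 * W) * (2 * \<kappa>)"
    by (rule mult_mono[OF rt \<kappa>(3)]) (use \<kappa> E0 in simp_all)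
  moreover have "c * (vp.G * ?n * ?r) \<le> 2000 * (8 * E)"
    by (rule mult_mono[OF c(2) e]) (use vp.G1 in simp_all)
  moreover have "E * 1 \<le> E * \<kappa>" using E0 \<kappa> by (intro mult_left_mono) auto
  moreover have "(12800 * E + 600 * W) * (2 * \<kappa>) = 25600 * (E * \<kappa>) + 1200 * (W * \<kappa>)" by (simp add: algebra_simps)
  moreover have "50000 * (N * R * \<kappa> * g + N * \<kappa> * l) = 50000 * (E * \<kappa>) + 50000 * (W * \<kappa>)"
    by (simp add: E_def W_def algebra_simps)
  moreover have "0 \<le> E * \<kappa>" "0 \<le> W * \<kappa>" using E0 \<kappa> by simp_all
  ultimately show ?thesis by linarith
qed

end

theorem theorem4:
  shows
    "(\<exists>P C. \<forall>(V :: 'a set) \<omega>1 \<omega>2 k \<gamma>.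
        finite V \<and> valuated_matroid V \<omega>1 \<and> valuated_matroid V \<omega>2 \<and> \<gamma> \<ge> 0 \<longrightarrow>
        (let n = max 1 (real (card V));
             r = max 1 (real (max (vrank V \<omega>1) (vrank V \<omega>2)));
             \<kappa> = max 1 (real k);
             g = max 1 \<gamma>;
             l = max 1 (log 2 (real (card V)))
         in solves_within P V \<omega>1 \<omega>2 k (feasible_ge V k) \<gamma> (C * (n * r * \<kappa> * g + n * \<kappa> * l))))
     \<and>
     (\<exists>P C. \<forall>(V :: 'a set) \<omega>1 \<omega>2 k \<gamma>.
        finite V \<and> valuated_matroid V \<omega>1 \<and> valuated_matroid V \<omega>2 \<and> \<gamma> \<ge> 0 \<longrightarrow>
        (let n = max 1 (real (card V));
             r = max 1 (real (max (vrank V \<omega>1) (vrank V \<omega>2)));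
             g = max 1 \<gamma>;
             l = max 1 (log 2 (real (card V)))
         in solves_within P V \<omega>1 \<omega>2 k (feasible_eq V k) \<gamma> (C * (n * r ^ 2 * g + n * r * l))))"
proof (rule conjI, goal_cases)
  case 1
  show ?case
  proof (rule exI[of _ program_ge], rule exI[of _ 50000], intro allI impI, goal_cases)
    case H: (1 V \<omega>1 \<omega>2 k \<gamma>)
    show ?case
      unfolding Let_def solves_within_def
    proof (intro allI impI, goal_cases)
      case h: (1 e B1 B2)
      interpret enumerated V \<omega>1 \<omega>2 \<gamma> e using H h by unfold_locales auto
      have B: "B1 \<in> vdom V \<omega>1" "B2 \<in> vdom V \<omega>2" using h by auto
      have "real (k + 1) \<le> 2 * max 1 (real k)" by simp
      then have "1000 * (vp.G * real (card V + 1) * real (rk + 1)) + vp.rtime * real (k + 1) \<le>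
        50000 * (max 1 (real (card V)) * max 1 (real rk) * max 1 (real k) * max 1 \<gamma> +
          max 1 (real (card V)) * max 1 (real k) * max 1 (log 2 (real (card V))))"
        by (intro time_bound) auto
      then show ?case using run_ge[OF B, of k] by (meson order_trans)
    qed
  qed
next
  case 2
  show ?case
  proof (rule exI[of _ program_eq], rule exI[of _ 50000], intro allI impI, goal_cases)
    case H: (1 V \<omega>1 \<omega>2 k \<gamma>)
    show ?case
      unfolding Let_def solves_within_def
    proof (intro allI impI, goal_cases)
      case h: (1 e B1 B2)
      interpret enumerated V \<omega>1 \<omega>2 \<gamma> e using H h by unfold_locales auto
      have B: "B1 \<in> vdom V \<omega>1" "B2 \<in> vdom V \<omega>2" using h by auto
      have "real (rk + 1) \<le> 2 * max 1 (real rk)" by simp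
      then have "2000 * (vp.G * real (card V + 1) * real (rk + 1)) + vp.rtime * real (rk + 1) \<le>
        50000 * (max 1 (real (card V)) * max 1 (real rk) * max 1 (real rk) * max 1 \<gamma> +
          max 1 (real (card V)) * max 1 (real rk) * max 1 (log 2 (real (card V))))"
        by (intro time_bound) auto
      then show ?case using run_eq[OF B, of k] unfolding power2_eq_square mult.assoc by (meson order_trans)
    qed
  qed
qed

end
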